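(* Let $\mathcal{C}$ be either the curve $\mathcal{X}_{a,b,n,1}$ or the curve $\mathcal{Y}_{n,1}$ (with the convention $b=0$, i.e. $p^b=1$, when $\mathcal{C}=\mathcal{Y}_{n,1}$), let $M=\frac{q^n+1}{q+1}$, let $P_\infty$ be the unique common pole of $x,y,z$, and let $P_1,\ldots,P_{q/p^b}$ be the distinct rational points of $\mathcal{C}$ of the form $P_\ell=(\alpha_\ell,0,0)$. For $1\leq m\leq q/p^b$, let $\Gamma_{m+1}$ be the set of all $(m+1)$-tuples $$\left(\frac{1}{p^b}\Big(\big(q^2-mp^b-p^b\sum_{\ell=1}^m j_\ell\big)(q^n+1)-iqM-kq^3\Big),\ j_1(q^n+1)+iM+k,\ \ldots,\ j_m(q^n+1)+iM+k\right)$$ where $i,k,j_1,\ldots,j_m$ are integers with $1\leq k\leq M$, $0\leq i\leq q$, $j_\ell\geq 0$ for all $\ell$, and $$\Big(q^2-mp^b-p^b\sum_{\ell=1}^m j_\ell\Big)(q^n+1)-iqM-kq^3>0 .$$ Then $\Gamma(P_\infty,P_1,\ldots,P_m)=\Gamma_{m+1}$.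
   Context: Curves. (i) For a prime $p$, integers $a,b\ge 1$ with $b\mid a$, $q=p^a$, $n\geq 3$ odd, $c\in\mathbb{F}_{q^2}$ with $c^{q-1}=-1$: $\mathcal{X}_{a,b,n,1}$ is the nonsingular, projective, absolutely irreducible curve over $\mathbb{F}_{q^{2n}}$ given by $c\,y^{q+1}=t(x):=\sum_{i=0}^{a/b-1}x^{p^{ib}}$ and $z^M=y^{q^2}-y$, with $M=\frac{q^n+1}{q+1}$. (ii) For a prime power $q$ and $n\ge 3$ odd: $\mathcal{Y}_{n,1}$ is the nonsingular, projective, absolutely irreducible curve over $\mathbb{F}_{q^{2n}}$ given by $y^{q+1}=x^q+x$ and $z^M=y^{q^2}-y$. The functions $x,y,z$ have a unique common pole $P_\infty$. The points $P_\ell=(\alpha_\ell,0,0)$ are the rational points with $y=z=0$, i.e. $\alpha_\ell$ runs over the roots of $t(x)=0$ (respectively $x^q+x=0$); there are $q/p^b$ of them (respectively $q$). Weierstrass semigroup and minimal generating set. For distinct rational points $R_1,\ldots,R_r$, $H(R_1,\ldots,R_r)$ is the set of $(n_1,\ldots,n_r)\in\mathbb{N}_0^r$ such that some rational function has pole divisor $n_1R_1+\cdots+n_rR_r$. Let $\preceq$ be the componentwise partial order on $\mathbb{N}_0^r$. For $\mathbf{n}\in\mathbb{N}_0^r$ let $\nabla_i(\mathbf{n})=\{(p_1,\ldots,p_r)\in H(R_1,\ldots,R_r): p_i=n_i\}$. For $r\geq 2$, $\Gamma(R_1,\ldots,R_r)=\{\mathbf{n}\in\mathbb{N}^r:$ for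 some $i$, $1\leq i\leq r$, $\mathbf{n}$ is minimal (with respect to $\preceq$) in $\nabla_i(\mathbf{n})\}$, where $\mathbb{N}$ denotes the positive integers. *)

theory Defs
  imports "HOL-Computational_Algebra.Computational_Algebra"
begin

text \<open>
  A nonsingular, projective, absolutely irreducible curve over a perfect field \<open>K\<close> is handled
  through its field of rational functions \<open>F\<close>: an algebraic function field in one variable with
  full constant field \<open>K\<close>. Here \<open>F\<close> is the whole type \<open>'f\<close> and \<open>K\<close> a subset of it. The (closed)
  points of the curve are the places of \<open>F/K\<close>, the rational points the places of degree one.
\<close>

section \<open>Function fields in one variable\<close>

definition is_subfield :: "'f::field set \<Rightarrow> bool" where
  "is_subfield L \<longleftrightarrow> 0 \<in> L \<and> 1 \<in> L \<and>
     (\<forall>u\<in>L. \<forall>w\<in>L. u - w \<in> L \<and> u * w \<in> L) \<and> (\<forall>u\<in>L. inverse u \<in> L)"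

definition algebraic_over :: "'f::field set \<Rightarrow> 'f \<Rightarrow> bool" where
  "algebraic_over L f \<longleftrightarrow> (\<exists>p :: 'f poly. p \<noteq> 0 \<and> (\<forall>i. coeff p i \<in> L) \<and> poly p f = 0)"

definition finite_over :: "'f::field set \<Rightarrow> bool" where
  "finite_over L \<longleftrightarrow>
     (\<exists>B. finite B \<and> (\<forall>f. \<exists>g. (\<forall>b\<in>B. g b \<in> L) \<and> f = (\<Sum>b\<in>B. g b * b)))"

text \<open>
  The last clause says that \<open>K\<close> is algebraically closed in \<open>F\<close>, which for perfect \<open>K\<close> is the
  absolute irreducibility of the curve.
\<close>

definition function_field :: "'f::field set \<Rightarrow> bool" where
  "function_field K \<longleftrightarrow> is_subfield K \<and>
     (\<exists>u. \<not> algebraic_over K u \<and> finite_over (is_subfield hull (insert u K))) \<and>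
     (\<forall>f. algebraic_over K f \<longrightarrow> f \<in> K)"

section \<open>Places\<close>

text \<open>
  A place is represented by its normalised discrete valuation. The value at \<open>0\<close> (really infinity)
  is fixed to the junk value \<open>0\<close>, so that distinct functions are distinct places; hence \<open>0\<close> has to
  be singled out wherever positivity of a valuation is meant to express vanishing.
\<close>

definition place :: "'f::field set \<Rightarrow> ('f \<Rightarrow> int) \<Rightarrow> bool" where
  "place K v \<longleftrightarrow> v 0 = 0 \<and>
     (\<forall>f g. f \<noteq> 0 \<longrightarrow> g \<noteq> 0 \<longrightarrow> v (f * g) = v f + v g) \<and>
     (\<forall>f g. f \<noteq> 0 \<longrightarrow> g \<noteq> 0 \<longrightarrow> f + g \<noteq> 0 \<longrightarrow> min (v f) (v g) \<le> v (f + g)) \<and>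
     (\<forall>u\<in>K. v u = 0) \<and>
     (\<exists>f. f \<noteq> 0 \<and> v f = 1)"

definition has_value :: "('f::field \<Rightarrow> int) \<Rightarrow> 'f \<Rightarrow> 'f \<Rightarrow> bool" where
  "has_value v f u \<longleftrightarrow> f = u \<or> v (f - u) > 0"

definition rational_place :: "'f::field set \<Rightarrow> ('f \<Rightarrow> int) \<Rightarrow> bool" where
  "rational_place K v \<longleftrightarrow> place K v \<and> (\<forall>f. v f \<ge> 0 \<longrightarrow> (\<exists>u\<in>K. has_value v f u))"

section \<open>Weierstrass semigroups and minimal generating sets\<close>

text \<open>Effective divisors are functions on places; \<open>divisor_of R ns\<close> is the
  divisor \<open>n\<^sub>1 R\<^sub>1 + \<dots> + n\<^sub>r R\<^sub>r\<close> for the lists \<open>R\<close> and \<open>ns\<close> of length \<open>r\<close>.\<close>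

definition pole_divisor :: "'f::field set \<Rightarrow> 'f \<Rightarrow> ('f \<Rightarrow> int) \<Rightarrow> nat" where
  "pole_divisor K f = (\<lambda>v. if place K v then nat (- v f) else 0)"

definition divisor_of :: "('f::field \<Rightarrow> int) list \<Rightarrow> nat list \<Rightarrow> ('f \<Rightarrow> int) \<Rightarrow> nat" where
  "divisor_of R ns = (\<lambda>v. \<Sum>i<length R. if R ! i = v then ns ! i else 0)"

definition weierstrass_semigroup :: "'f::field set \<Rightarrow> ('f \<Rightarrow> int) list \<Rightarrow> nat list set" where
  "weierstrass_semigroup K R =
     {ns. length ns = length R \<and> (\<exists>f. f \<noteq> 0 \<and> pole_divisor K f = divisor_of R ns)}"

definition nabla :: "'f::field set \<Rightarrow> ('f \<Rightarrow> int) list \<Rightarrow> nat \<Rightarrow> nat list \<Rightarrow> nat list set" where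
  "nabla K R i ns = {ps \<in> weierstrass_semigroup K R. ps ! i = ns ! i}"

definition minimal_generating_set :: "'f::field set \<Rightarrow> ('f \<Rightarrow> int) list \<Rightarrow> nat list set" where
  "minimal_generating_set K R =
     {ns. length ns = length R \<and> (\<forall>n\<in>set ns. n > 0) \<and>
        (\<exists>i<length R. ns \<in> nabla K R i ns \<and>
           (\<forall>ps\<in>nabla K R i ns. list_all2 (\<le>) ps ns \<longrightarrow> ps = ns))}"

section \<open>The curves\<close>

text \<open>
  In both definitions the field \<open>F\<close> is \<open>K(x,y,z)\<close>. The equations, together with \<open>F\<close> being of
  transcendence degree one over \<open>K\<close>, determine \<open>F\<close> up to isomorphism, since the affine curve they
  define is irreducible. The subfield of \<open>K\<close> with \<open>q\<^sup>2\<close> elements is \<open>{u \<in> K. u ^ (q ^ 2) = u}\<close>.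
\<close>

definition curve_X ::
  "'f::field set \<Rightarrow> 'f \<Rightarrow> 'f \<Rightarrow> 'f \<Rightarrow> nat \<Rightarrow> nat \<Rightarrow> nat \<Rightarrow> nat \<Rightarrow> 'f \<Rightarrow> bool" where
  "curve_X K x y z p a b n c \<longleftrightarrow>
     prime p \<and> a \<ge> 1 \<and> b \<ge> 1 \<and> b dvd a \<and> n \<ge> 3 \<and> odd n \<and>
     (let q = p ^ a; M = (q ^ n + 1) div (q + 1) in
        card K = q ^ (2 * n) \<and>
        c \<in> K \<and> c ^ (q ^ 2) = c \<and> c ^ (q - 1) = - 1 \<and>
        function_field K \<and> is_subfield hull (K \<union> {x, y, z}) = UNIV \<and>
        c * y ^ (q + 1) = (\<Sum>i<a div b. x ^ (p ^ (i * b))) \<and>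
        z ^ M = y ^ (q ^ 2) - y)"

definition curve_Y ::
  "'f::field set \<Rightarrow> 'f \<Rightarrow> 'f \<Rightarrow> 'f \<Rightarrow> nat \<Rightarrow> nat \<Rightarrow> nat \<Rightarrow> bool" where
  "curve_Y K x y z p a n \<longleftrightarrow>
     prime p \<and> a \<ge> 1 \<and> n \<ge> 3 \<and> odd n \<and>
     (let q = p ^ a; M = (q ^ n + 1) div (q + 1) in
        card K = q ^ (2 * n) \<and>
        function_field K \<and> is_subfield hull (K \<union> {x, y, z}) = UNIV \<and>
        y ^ (q + 1) = x ^ q + x \<and>
        z ^ M = y ^ (q ^ 2) - y)"

definition base_points ::
  "'f::field set \<Rightarrow> 'f \<Rightarrow> 'f \<Rightarrow> 'f \<Rightarrow> ('f \<Rightarrow> int) set" where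
  "base_points K x y z =
     {v. rational_place K v \<and> (\<exists>\<alpha>\<in>K. has_value v x \<alpha>) \<and> has_value v y 0 \<and> has_value v z 0}"

definition common_poles ::
  "'f::field set \<Rightarrow> 'f \<Rightarrow> 'f \<Rightarrow> 'f \<Rightarrow> ('f \<Rightarrow> int) set" where
  "common_poles K x y z = {v. place K v \<and> v x < 0 \<and> v y < 0 \<and> v z < 0}"

section \<open>The explicit set of tuples\<close>

text \<open>
  \<open>P\<close> stands for \<open>p\<^sup>b\<close>. The division by \<open>P\<close> below is exact for both curves, as \<open>P\<close> divides \<open>q\<close>; the
  division by \<open>q + 1\<close> is exact because \<open>n\<close> is odd.
\<close>

definition explicit_tuples :: "nat \<Rightarrow> nat \<Rightarrow> nat \<Rightarrow> nat \<Rightarrow> nat list set" where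
  "explicit_tuples q P n m =
     (let M = (q ^ n + 1) div (q + 1) in
      {ns. \<exists>(i::int) (k::int) (j :: nat \<Rightarrow> int).
         1 \<le> k \<and> k \<le> int M \<and> 0 \<le> i \<and> i \<le> int q \<and> (\<forall>l\<in>{1..m}. 0 \<le> j l) \<and>
         (let E = (int q ^ 2 - int m * int P - int P * (\<Sum>l=1..m. j l)) * (int q ^ n + 1)
                    - i * int q * int M - k * int q ^ 3
          in E > 0 \<and>
             map int ns =
               (E div int P) # map (\<lambda>l. j l * (int q ^ n + 1) + i * int M + k) [1..<Suc m])})"

end

theory Submission
  imports Defs
begin

text \<open>
  Write \<open>N = q\<^sup>n + 1 = M (q + 1)\<close> and let \<open>d = q / p\<^sup>b\<close> be the degree in \<open>x\<close> of the additive polynomial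
  \<open>T\<close> with \<open>c y\<^sup>q\<^sup>+\<^sup>1 = T(x)\<close>. The whole argument rests on the \<open>N\<close> monomials \<open>y\<^sup>B z\<^sup>A\<close> with
  \<open>A < M\<close> and \<open>B \<le> q\<close>.
  
  At the common pole the functions \<open>x, y, z\<close> have the values \<open>-N, -d M, -d q\<^sup>2\<close>, and at a point
  \<open>P\<^sub>l = (\<alpha>\<^sub>l, 0, 0)\<close> the functions \<open>x - \<alpha>\<^sub>l, y, z\<close> have the values \<open>N, M, 1\<close>
  (\<open>Pinf_values\<close>, \<open>base_point_values\<close>). Hence at each of these places the \<open>N\<close> monomials have values in
  pairwise different residue classes modulo \<open>N\<close>, while nonzero polynomials in \<open>x\<close> have values divisible
  by \<open>N\<close>. In an expansion \<open>f = \<Sum> r\<^sub>A\<^sub>B(x) y\<^sup>B z\<^sup>A\<close> no two terms can therefore cancel to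
  leading order, and the value of \<open>f\<close> is the minimum of the values of its terms, at all the places
  \<open>P\<^sub>\<infinity>, P\<^sub>1, \<dots>, P\<^sub>m\<close> simultaneously (\<open>separating_expansion\<close>).
  
  Suppose that \<open>f\<close> has poles only at these places. Clearing denominators by powers of the \<open>x - \<alpha>\<^sub>l\<close>
  moves all poles to \<open>P\<^sub>\<infinity>\<close>. A function with poles at most at \<open>P\<^sub>\<infinity>\<close> lies in the coordinate ring
  \<open>K[x, y, z]\<close> (\<open>coord_ring_integrally_closed\<close>), because the affine curve is nonsingular: it is etale
  over the \<open>z\<close>-line. So \<open>f\<close> is a sum of terms \<open>r(x) y\<^sup>B z\<^sup>A\<close> with \<open>r\<close> regular away from
  \<open>\<alpha>\<^sub>1, \<dots>, \<alpha>\<^sub>m, \<infinity>\<close>. Such a term, where \<open>r\<close> has a pole of order \<open>e\<^sub>l\<close> at \<open>\<alpha>\<^sub>l\<close> and of order \<open>\<delta>\<close> at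
  infinity, satisfies \<open>\<delta> \<ge> -\<Sum> e\<^sub>l\<close>, since \<open>r\<close> has as many zeros as poles; equality means that
  \<open>r\<close> is a constant multiple of \<open>\<Prod> (x - \<alpha>\<^sub>l)\<^sup>-\<^sup>e\<^sup>l\<close>.
  
  What is left is combinatorics (\<open>minimal_generating_set_points\<close>). A minimal tuple is the pole divisor of
  a single term, for otherwise the term that attains the value in question would be a smaller
  element, and that term is a pure product \<open>\<Prod> (x - \<alpha>\<^sub>l)\<^sup>-\<^sup>e\<^sup>l y\<^sup>B z\<^sup>A\<close>, for otherwise one could lower
  \<open>\<delta>\<close> or one of the \<open>e\<^sub>l\<close>. Conversely the pole order of such a product at \<open>P\<^sub>\<infinity>\<close> determines \<open>A\<close>, \<open>B\<close>
  and \<open>\<delta>\<close>, and the inequality \<open>\<delta> \<ge> -\<Sum> e\<^sub>l\<close> then leaves no room for a smaller tuple with the same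
  first entry. The substitution \<open>k = M - A\<close>, \<open>i = q - B\<close>, \<open>j\<^sub>l = e\<^sub>l - 1\<close> turns the resulting
  tuples into the explicit ones.
\<close>

section \<open>Subrings and polynomials over them\<close>

definition is_subring :: "'f::field set \<Rightarrow> bool" where
  "is_subring S \<longleftrightarrow> 0 \<in> S \<and> 1 \<in> S \<and> (\<forall>u\<in>S. \<forall>w\<in>S. u - w \<in> S \<and> u * w \<in> S)"

lemma subfield_imp_subring: "is_subfield S \<Longrightarrow> is_subring S"
  by (simp add: is_subfield_def is_subring_def)

lemma subring_hull: "is_subring (is_subring hull X)"
  by (rule hull_in) (auto simp: is_subring_def)

lemma subring_0: "is_subring S \<Longrightarrow> 0 \<in> S"
  and subring_1: "is_subring S \<Longrightarrow> 1 \<in> S"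
  and subring_diff: "is_subring S \<Longrightarrow> u \<in> S \<Longrightarrow> w \<in> S \<Longrightarrow> u - w \<in> S"
  and subring_mult: "is_subring S \<Longrightarrow> u \<in> S \<Longrightarrow> w \<in> S \<Longrightarrow> u * w \<in> S"
  by (auto simp: is_subring_def)

lemma subring_uminus: "is_subring S \<Longrightarrow> u \<in> S \<Longrightarrow> - u \<in> S"
  using subring_diff[of S 0 u] subring_0 by auto

lemma subring_add: "is_subring S \<Longrightarrow> u \<in> S \<Longrightarrow> w \<in> S \<Longrightarrow> u + w \<in> S"
  using subring_diff[of S u "- w"] subring_uminus by auto

lemma subring_power: "is_subring S \<Longrightarrow> u \<in> S \<Longrightarrow> u ^ k \<in> S"
  by (induction k) (auto simp: subring_1 subring_mult)

lemma subring_sum: "is_subring S \<Longrightarrow> (\<And>i. i \<in> I \<Longrightarrow> g i \<in> S) \<Longrightarrow> sum g I \<in> S"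
  by (induction I rule: infinite_finite_induct) (auto simp: subring_0 subring_add)

lemma subring_prod: "is_subring S \<Longrightarrow> (\<And>i. i \<in> I \<Longrightarrow> g i \<in> S) \<Longrightarrow> prod g I \<in> S"
  by (induction I rule: infinite_finite_induct) (auto simp: subring_1 subring_mult)

lemma subfield_inverse: "is_subfield S \<Longrightarrow> u \<in> S \<Longrightarrow> inverse u \<in> S"
  by (simp add: is_subfield_def)

definition polys_over :: "'f::field set \<Rightarrow> 'f poly set" where
  "polys_over S = {r. \<forall>i. coeff r i \<in> S}"

lemma polys_over_pCons: "pCons u r \<in> polys_over S \<longleftrightarrow> u \<in> S \<and> r \<in> polys_over S"
  unfolding polys_over_def mem_Collect_eq coeff_pCons
  by (metis Nat.old.nat.simps(4) old.nat.simps(5) not0_implies_Suc)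

lemma polys_over_0: "is_subring S \<Longrightarrow> 0 \<in> polys_over S"
  by (simp add: polys_over_def subring_0)

lemma polys_over_diff:
  "is_subring S \<Longrightarrow> r \<in> polys_over S \<Longrightarrow> s \<in> polys_over S \<Longrightarrow> r - s \<in> polys_over S"
  by (simp add: polys_over_def subring_diff)

lemma polys_over_add:
  "is_subring S \<Longrightarrow> r \<in> polys_over S \<Longrightarrow> s \<in> polys_over S \<Longrightarrow> r + s \<in> polys_over S"
  by (simp add: polys_over_def subring_add)

lemma polys_over_mult:
  "is_subring S \<Longrightarrow> r \<in> polys_over S \<Longrightarrow> s \<in> polys_over S \<Longrightarrow> r * s \<in> polys_over S"
  by (simp add: polys_over_def coeff_mult subring_sum subring_mult)

lemma polys_over_monom: "is_subring S \<Longrightarrow> u \<in> S \<Longrightarrow> monom u k \<in> polys_over S"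
  by (simp add: polys_over_def subring_0)

lemma polys_over_sum:
  "is_subring S \<Longrightarrow> (\<And>i. i \<in> I \<Longrightarrow> g i \<in> polys_over S) \<Longrightarrow> sum g I \<in> polys_over S"
  by (induction I rule: infinite_finite_induct) (auto simp: polys_over_0 polys_over_add)

lemma poly_in_subring:
  assumes A: "is_subring A" and "S \<subseteq> A" "u \<in> A" "r \<in> polys_over S"
  shows "poly r u \<in> A"
proof -
  have "coeff r i * u ^ i \<in> A" for i
    using assms by (auto simp: polys_over_def intro!: subring_mult[OF A] subring_power[OF A])
  then show ?thesis unfolding poly_altdef by (intro subring_sum[OF A])
qed

lemma subring_poly_values:
  assumes S: "is_subring S"
  shows "is_subring ((\<lambda>r. poly r u) ` polys_over S)"
proof -
  have "0 = poly 0 u" "1 = poly (pCons 1 0) u"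
    "\<And>r s. poly r u - poly s u = poly (r - s) u" "\<And>r s. poly r u * poly s u = poly (r * s) u"
    by auto
  moreover have "(pCons 1 0) \<in> polys_over S"
    using S by (simp add: polys_over_pCons polys_over_0 subring_1)
  ultimately show ?thesis
    unfolding is_subring_def
    using polys_over_0[OF S] polys_over_diff[OF S] polys_over_mult[OF S] by blast
qed

lemma poly_values_superset:
  assumes S: "is_subring S"
  shows "insert u S \<subseteq> (\<lambda>r. poly r u) ` polys_over S"
proof -
  have "u = poly [:0, 1:] u" "\<And>w. w = poly [:w:] u" by auto
  moreover have "[:0,1:] \<in> polys_over S" "\<And>w. w \<in> S \<Longrightarrow> [:w:] \<in> polys_over S"
    using S by (auto simp: polys_over_pCons polys_over_0 subring_0 subring_1)
  ultimately show ?thesis by blast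
qed

lemma polys_over_synthetic_div:
  assumes S: "is_subring S" and u: "u \<in> S"
  shows "r \<in> polys_over S \<Longrightarrow> synthetic_div r u \<in> polys_over S"
proof (induction r)
  case 0
  then show ?case by simp
next
  case (pCons a r)
  then have "r \<in> polys_over S" by (simp add: polys_over_pCons)
  moreover from this have "poly r u \<in> S" using poly_in_subring[OF S _ u] by blast
  ultimately show ?case using pCons.IH by (simp add: polys_over_pCons)
qed

lemma polys_over_division:
  assumes S: "is_subfield S" and d: "d \<in> polys_over S" "d \<noteq> 0"
  shows "h \<in> polys_over S \<Longrightarrow> \<exists>r s. r \<in> polys_over S \<and> s \<in> polys_over S \<and> h = d * r + s \<and>
    (s = 0 \<or> degree s < degree d)"
proof (induction "degree h" arbitrary: h rule: less_induct)
  case less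
  note R = subfield_imp_subring[OF S]
  show ?case
  proof (cases "h = 0 \<or> degree h < degree d")
    case True
    then show ?thesis using less.prems polys_over_0[OF R] by (intro exI[of _ 0] exI[of _ h]) auto
  next
    case False
    define m where "m = monom (lead_coeff h * inverse (lead_coeff d)) (degree h - degree d)"
    define h' where "h' = h - d * m"
    have m: "m \<in> polys_over S"
      unfolding m_def using d less.prems S R
      by (intro polys_over_monom subring_mult subfield_inverse) (auto simp: polys_over_def)
    have h'S: "h' \<in> polys_over S"
      unfolding h'_def using m d less.prems R by (intro polys_over_diff polys_over_mult)
    have lc: "lead_coeff h * inverse (lead_coeff d) \<noteq> 0" using False d by auto
    have dm: "degree (d * m) = degree h" "lead_coeff (d * m) = lead_coeff h"
    proof -
      show "degree (d * m) = degree h"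
        using False d lc by (subst degree_mult_eq) (auto simp: m_def degree_monom_eq)
      show "lead_coeff (d * m) = lead_coeff h"
        using lc d by (simp add: lead_coeff_mult m_def degree_monom_eq)
    qed
    have deg: "h' = 0 \<or> degree h' < degree h"
    proof (rule ccontr)
      assume neg: "\<not> (h' = 0 \<or> degree h' < degree h)"
      have "degree h' \<le> degree h" unfolding h'_def using dm by (intro degree_diff_le) auto
      then have "degree h' = degree h" using neg by auto
      then have "lead_coeff h' = 0" unfolding h'_def using dm by simp
      then show False using neg by simp
    qed
    show ?thesis
    proof (cases "h' = 0")
      case True
      then show ?thesis using m polys_over_0[OF R] unfolding h'_def
        by (intro exI[of _ m] exI[of _ 0]) auto
    next
      case False
      then obtain r s where rs: "r \<in> polys_over S" "s \<in> polys_over S" "h' = d * r + s"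
        "s = 0 \<or> degree s < degree d"
        using less.hyps[OF _ h'S] deg by blast
      have "h = d * (r + m) + s" using rs(3) unfolding h'_def by (simp add: algebra_simps)
      then show ?thesis using rs m polys_over_add[OF R] by blast
    qed
  qed
qed

text \<open>
  For finite \<open>S\<close> this makes remainders modulo a fixed polynomial accessible to the pigeonhole principle.
\<close>

lemma finite_polys_over_degree_less:
  assumes "finite S"
  shows "finite {r \<in> polys_over S. r = 0 \<or> degree r < k}"
proof -
  have "{r \<in> polys_over S. r = 0 \<or> degree r < k} \<subseteq> Poly ` {xs. set xs \<subseteq> S \<and> length xs \<le> k}"
  proof
    fix r assume r: "r \<in> {r \<in> polys_over S. r = 0 \<or> degree r < k}"
    have "set (coeffs r) \<subseteq> S" using r by (auto simp: polys_over_def coeffs_def)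
    moreover have "length (coeffs r) \<le> k" using r by (cases "r = 0") (auto simp: length_coeffs_degree)
    moreover have "r = Poly (coeffs r)" by simp
    ultimately show "r \<in> Poly ` {xs. set xs \<subseteq> S \<and> length xs \<le> k}" by blast
  qed
  then show ?thesis using finite_lists_length_le[OF assms] by (meson finite_imageI finite_subset)
qed

lemma sum_order_le_degree:
  fixes r :: "'f::field poly"
  assumes "r \<noteq> 0" "finite X"
  shows "(\<Sum>u\<in>X. order u r) \<le> degree r"
proof -
  have "(\<Sum>u\<in>X. order u r) = (\<Sum>u\<in>X \<inter> set_mset (proots r). count (proots r) u)"
    using assms by (intro sum.mono_neutral_cong_right) (auto simp: count_eq_zero_iff order_root)
  also have "\<dots> \<le> size (proots r)"
    unfolding size_multiset_overloaded_eq by (intro sum_mono2) auto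
  also have "\<dots> \<le> degree r" by (rule size_proots_le)
  finally show ?thesis .
qed

section \<open>Finitely generated modules\<close>

definition lin_span :: "'f::field set \<Rightarrow> 'i set \<Rightarrow> ('i \<Rightarrow> 'f) \<Rightarrow> 'f set" where
  "lin_span L I s = {\<Sum>i\<in>I. g i * s i | g. \<forall>i\<in>I. g i \<in> L}"

lemma lin_spanI: "(\<And>i. i \<in> I \<Longrightarrow> g i \<in> L) \<Longrightarrow> (\<Sum>i\<in>I. g i * s i) \<in> lin_span L I s"
  unfolding lin_span_def by blast

lemma lin_spanE:
  assumes "a \<in> lin_span L I s"
  obtains g where "\<And>i. i \<in> I \<Longrightarrow> g i \<in> L" "a = (\<Sum>i\<in>I. g i * s i)"
  using assms unfolding lin_span_def by blast

lemma lin_span_0: "is_subring L \<Longrightarrow> 0 \<in> lin_span L I s"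
  using lin_spanI[of I "\<lambda>_. 0" L s] by (simp add: subring_0)

lemma lin_span_add:
  assumes L: "is_subring L" and "a \<in> lin_span L I s" "b \<in> lin_span L I s"
  shows "a + b \<in> lin_span L I s"
proof -
  from assms(2) obtain g where g: "\<And>i. i \<in> I \<Longrightarrow> g i \<in> L" "a = (\<Sum>i\<in>I. g i * s i)"
    by (blast elim: lin_spanE)
  from assms(3) obtain h where h: "\<And>i. i \<in> I \<Longrightarrow> h i \<in> L" "b = (\<Sum>i\<in>I. h i * s i)"
    by (blast elim: lin_spanE)
  have "a + b = (\<Sum>i\<in>I. (g i + h i) * s i)"
    by (simp add: g h ring_distribs sum.distrib)
  then show ?thesis using lin_spanI[of I "\<lambda>i. g i + h i" L s] g h subring_add[OF L] by metis
qed

lemma lin_span_scale: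
  assumes L: "is_subring L" and "a \<in> lin_span L I s" "l \<in> L"
  shows "l * a \<in> lin_span L I s"
proof -
  from assms(2) obtain g where g: "\<And>i. i \<in> I \<Longrightarrow> g i \<in> L" "a = (\<Sum>i\<in>I. g i * s i)"
    by (blast elim: lin_spanE)
  have "l * a = (\<Sum>i\<in>I. (l * g i) * s i)"
    by (simp add: g sum_distrib_left mult.assoc)
  then show ?thesis using lin_spanI[of I "\<lambda>i. l * g i" L s] g assms(3) subring_mult[OF L] by metis
qed

lemma lin_span_sum:
  "is_subring L \<Longrightarrow> (\<And>j. j \<in> J \<Longrightarrow> a j \<in> lin_span L I s) \<Longrightarrow> sum a J \<in> lin_span L I s"
  by (induction J rule: infinite_finite_induct) (auto simp: lin_span_0 lin_span_add)

lemma lin_span_diff: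
  assumes L: "is_subring L" and "a \<in> lin_span L I s" "b \<in> lin_span L I s"
  shows "a - b \<in> lin_span L I s"
  using lin_span_add[OF L assms(2) lin_span_scale[OF L assms(3), of "-1"]]
  by (simp add: subring_uminus subring_1 L)

lemma lin_span_base:
  assumes L: "is_subring L" and "finite I" "i \<in> I"
  shows "s i \<in> lin_span L I s"
proof -
  have "s i = (\<Sum>j\<in>I. (if j = i then 1 else 0) * s j)"
    using assms(2,3) by (simp add: if_distrib[of "\<lambda>u. u * _"] cong: if_cong)
  then show ?thesis
    using lin_spanI[of I "\<lambda>j. if j = i then 1 else 0" L s] subring_0[OF L] subring_1[OF L] by metis
qed

lemma lin_span_mult_closed:
  assumes L: "is_subring L" and w: "\<And>i. i \<in> I \<Longrightarrow> w * s i \<in> lin_span L I s"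
    and a: "a \<in> lin_span L I s"
  shows "w * a \<in> lin_span L I s"
proof -
  from a obtain g where g: "\<And>i. i \<in> I \<Longrightarrow> g i \<in> L" "a = (\<Sum>i\<in>I. g i * s i)"
    by (blast elim: lin_spanE)
  have "w * a = (\<Sum>i\<in>I. g i * (w * s i))"
    by (simp add: g sum_distrib_left mult_ac)
  also have "\<dots> \<in> lin_span L I s"
    by (intro lin_span_sum[OF L] lin_span_scale[OF L] w g)
  finally show ?thesis .
qed

text \<open>
  The elements that multiply the module into itself form a ring, so it suffices to test generators.
\<close>

lemma subring_hull_subset_lin_span:
  assumes L: "is_subring L" and X: "\<And>w a. w \<in> X \<Longrightarrow> a \<in> lin_span L I s \<Longrightarrow> w * a \<in> lin_span L I s"
    and one: "1 \<in> lin_span L I s"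
  shows "is_subring hull X \<subseteq> lin_span L I s"
proof -
  have "is_subring hull X \<subseteq> {w. \<forall>a\<in>lin_span L I s. w * a \<in> lin_span L I s}"
  proof (rule hull_minimal)
    show "is_subring {w. \<forall>a\<in>lin_span L I s. w * a \<in> lin_span L I s}"
      unfolding is_subring_def
      by (auto simp: lin_span_0[OF L] left_diff_distrib lin_span_diff[OF L] mult.assoc)
  qed (use X in auto)
  then show ?thesis using one by force
qed

text \<open>
  Elimination: subtracting multiples of one vector clears the coefficient of a basis element in all
  others. Elements of the subring \<open>L\<close> need not be invertible, so the other vectors are first multiplied by a coefficient.
\<close>

lemma lin_span_dependent:
  assumes L: "is_subring L" and "finite I"
  shows "finite J \<Longrightarrow> card I < card J \<Longrightarrow> (\<And>j. j \<in> J \<Longrightarrow> w j \<in> lin_span L I s) \<Longrightarrow>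
    \<exists>c. (\<forall>j\<in>J. c j \<in> L) \<and> (\<exists>j\<in>J. c j \<noteq> 0) \<and> (\<Sum>j\<in>J. c j * w j) = 0"
  using assms(2)
proof (induction I arbitrary: J w rule: finite_induct)
  case empty
  then have "w j = 0" if "j \<in> J" for j using that by (auto simp: lin_span_def)
  moreover have "J \<noteq> {}" using empty by auto
  ultimately show ?case by (intro exI[of _ "\<lambda>_. 1"]) (auto simp: subring_1[OF L])
next
  case (insert i0 I J w)
  have "\<exists>G. \<forall>j\<in>J. (\<forall>i\<in>insert i0 I. G j i \<in> L) \<and> w j = (\<Sum>i\<in>insert i0 I. G j i * s i)"
    using insert.prems(3) by (intro bchoice) (simp add: lin_span_def, blast)
  then obtain G where G0: "\<forall>j\<in>J. (\<forall>i\<in>insert i0 I. G j i \<in> L) \<and>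
      w j = (\<Sum>i\<in>insert i0 I. G j i * s i)" ..
  have G: "G j i \<in> L" if "j \<in> J" "i \<in> insert i0 I" for i j
    using bspec[OF G0 that(1)] that(2) by blast
  have Gw: "w j = (\<Sum>i\<in>insert i0 I. G j i * s i)" if "j \<in> J" for j
    using bspec[OF G0 that] by simp
  define h where "h j = G j i0" for j
  define u where "u j = (\<Sum>i\<in>I. G j i * s i)" for j
  have hu: "h j \<in> L" "u j \<in> lin_span L I s" "w j = h j * s i0 + u j" if "j \<in> J" for j
  proof -
    show "h j \<in> L" using G that by (simp add: h_def)
    show "u j \<in> lin_span L I s" unfolding u_def using G[OF that] by (intro lin_spanI) auto
    show "w j = h j * s i0 + u j" using Gw[OF that] insert.hyps by (simp add: h_def u_def)
  qed
  show ?case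
  proof (cases "\<forall>j\<in>J. h j = 0")
    case True
    then have "w j \<in> lin_span L I s" if "j \<in> J" for j using hu that by auto
    moreover have "card I < card J" using insert by simp
    ultimately show ?thesis using insert.IH[of J w] insert.prems by blast
  next
    case False
    then obtain j0 where j0: "j0 \<in> J" "h j0 \<noteq> 0" by blast
    define w' where "w' j = h j0 * w j - h j * w j0" for j
    have "w' j \<in> lin_span L I s" if "j \<in> J - {j0}" for j
    proof -
      have "w' j = h j0 * u j - h j * u j0"
        using that j0 by (simp add: w'_def hu algebra_simps)
      then show ?thesis using that j0 hu by (simp add: lin_span_diff[OF L] lin_span_scale[OF L])
    qed
    moreover have "card I < card (J - {j0})" using insert j0 by simp
    ultimately obtain c where c: "\<forall>j\<in>J - {j0}. c j \<in> L" "\<exists>j\<in>J - {j0}. c j \<noteq> 0"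
      "(\<Sum>j\<in>J - {j0}. c j * w' j) = 0"
      using insert.IH[of "J - {j0}" w'] insert.prems by blast
    define c' where "c' j = (if j = j0 then - (\<Sum>j\<in>J - {j0}. c j * h j) else c j * h j0)" for j
    have "(\<Sum>j\<in>J. c' j * w j) = c' j0 * w j0 + (\<Sum>j\<in>J - {j0}. c' j * w j)"
      using insert.prems j0 by (simp add: sum.remove)
    also have "(\<Sum>j\<in>J - {j0}. c' j * w j) = (\<Sum>j\<in>J - {j0}. c j * h j0 * w j)"
      by (intro sum.cong) (auto simp: c'_def)
    also have "c' j0 * w j0 + \<dots> = (\<Sum>j\<in>J - {j0}. c j * w' j)"
      by (simp add: c'_def w'_def sum_distrib_left sum_distrib_right right_diff_distrib sum_subtractf mult_ac)
    finally have "(\<Sum>j\<in>J. c' j * w j) = 0" using c by simp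
    moreover have "\<forall>j\<in>J. c' j \<in> L"
      using c hu j0 unfolding c'_def
      by (auto intro!: subring_uminus[OF L] subring_sum[OF L] subring_mult[OF L])
    moreover have "\<exists>j\<in>J. c' j \<noteq> 0" using c j0 by (auto simp: c'_def)
    ultimately show ?thesis by blast
  qed
qed

text \<open>
  The powers of \<open>b\<close> are linearly dependent over \<open>L\<close>; after division by the lowest power of \<open>b\<close> that
  occurs, the constant term of the relation is a nonzero multiple of \<open>b\<close>. This plays the role of the norm.
\<close>

lemma exists_multiple_in_base:
  assumes L: "is_subring L" and A: "is_subring A" "L \<subseteq> A" and span: "finite I" "A \<subseteq> lin_span L I s"
    and b: "b \<in> A" "b \<noteq> 0"
  shows "\<exists>b'\<in>A. b * b' \<in> L \<and> b * b' \<noteq> 0"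
proof -
  have "b ^ k \<in> lin_span L I s" for k using span subring_power[OF A(1) b(1)] by blast
  then obtain c where c: "\<forall>k\<le>card I. c k \<in> L" "\<exists>k\<le>card I. c k \<noteq> 0"
    "(\<Sum>k\<le>card I. c k * b ^ k) = 0"
    using lin_span_dependent[OF L span(1), of "{..card I}" "\<lambda>k. b ^ k" s] by auto
  define k0 where "k0 = (LEAST k. c k \<noteq> 0)"
  have k0: "c k0 \<noteq> 0" "k0 \<le> card I"
    using c(2) LeastI[of "\<lambda>k. c k \<noteq> 0"] Least_le[of "\<lambda>k. c k \<noteq> 0"] unfolding k0_def
    by (blast, meson order_trans)
  have small: "c k = 0" if "k < k0" for k using that not_less_Least unfolding k0_def by blast
  define b' where "b' = - (\<Sum>k\<in>{k0<..card I}. c k * b ^ (k - k0 - 1))"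
  have "0 = (\<Sum>k\<in>{k0..card I}. c k * b ^ k)"
    unfolding c(3)[symmetric] using small by (intro sum.mono_neutral_right) (auto simp: not_le)
  also have "{k0..card I} = insert k0 {k0<..card I}" using k0 by auto
  also have "(\<Sum>k\<in>\<dots>. c k * b ^ k) = c k0 * b ^ k0 + (\<Sum>k\<in>{k0<..card I}. c k * b ^ k)"
    by simp
  also have "(\<Sum>k\<in>{k0<..card I}. c k * b ^ k) = (\<Sum>k\<in>{k0<..card I}. b ^ k0 * b * (c k * b ^ (k - k0 - 1)))"
  proof (intro sum.cong refl)
    fix k assume "k \<in> {k0<..card I}"
    then have "b ^ k = b ^ k0 * b * b ^ (k - k0 - 1)"
      by (subst power_Suc2[symmetric], subst power_add[symmetric]) auto
    then show "c k * b ^ k = b ^ k0 * b * (c k * b ^ (k - k0 - 1))" by simp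
  qed
  also have "\<dots> = - (b ^ k0 * (b * b'))"
    by (simp add: b'_def sum_distrib_left mult_ac)
  finally have "b ^ k0 * (c k0 - b * b') = 0" by (auto simp: algebra_simps)
  then have eq: "b * b' = c k0" using b by simp
  have "b' \<in> A"
    unfolding b'_def using c A b by (intro subring_uminus subring_sum subring_mult subring_power) auto
  moreover have "b * b' \<in> L" "b * b' \<noteq> 0" unfolding eq using k0 c by auto
  ultimately show ?thesis by blast
qed

section \<open>Places as valuations\<close>

text \<open>
  A place takes the junk value \<open>0\<close> at \<open>0\<close>. The relation below treats \<open>0\<close> as having infinite value,
  which makes it stable under sums and products without side conditions.
\<close>

definition val_ge :: "('f::field \<Rightarrow> int) \<Rightarrow> 'f \<Rightarrow> int \<Rightarrow> bool" where
  "val_ge v f k \<longleftrightarrow> f = 0 \<or> k \<le> v f"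

lemma place_zero: "place K v \<Longrightarrow> v 0 = 0"
  and place_mult: "place K v \<Longrightarrow> f \<noteq> 0 \<Longrightarrow> g \<noteq> 0 \<Longrightarrow> v (f * g) = v f + v g"
  and place_const: "place K v \<Longrightarrow> u \<in> K \<Longrightarrow> v u = 0"
  by (auto simp: place_def)

lemma place_one:
  assumes v: "place K v"
  shows "v 1 = 0"
  using place_mult[OF v, of 1 1] by simp

lemma place_uminus:
  assumes v: "place K v"
  shows "v (- f) = v f"
proof (cases "f = 0")
  case False
  have "v (-1) + v (-1) = 0" using place_mult[OF v, of "-1" "-1"] place_one[OF v] by simp
  then show ?thesis using place_mult[OF v, of "-1" f] False by simp
qed simp

lemma place_inverse:
  assumes v: "place K v" and "f \<noteq> 0"
  shows "v (inverse f) = - v f"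
  using place_mult[OF v, of f "inverse f"] assms place_one[OF v] by simp

lemma place_power:
  assumes v: "place K v" and "f \<noteq> 0"
  shows "v (f ^ k) = int k * v f"
  by (induction k) (use assms place_one[OF v] in \<open>auto simp: place_mult[OF v] algebra_simps\<close>)

lemma place_power_int:
  assumes v: "place K v" and "f \<noteq> 0"
  shows "v (f powi k) = k * v f"
  by (cases "k \<ge> 0") (use assms in \<open>auto simp: power_int_def place_power[OF v] place_inverse[OF v]\<close>)

lemma place_prod:
  assumes v: "place K v" and "\<And>i. i \<in> I \<Longrightarrow> f i \<noteq> 0"
  shows "v (prod f I) = (\<Sum>i\<in>I. v (f i))"
  using assms(2)
  by (induction I rule: infinite_finite_induct) (auto simp: place_one[OF v] place_mult[OF v])

lemma val_ge_add:
  assumes v: "place K v" and "val_ge v f k" "val_ge v g k"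
  shows "val_ge v (f + g) k"
proof (cases "f = 0 \<or> g = 0 \<or> f + g = 0")
  case False
  then have "min (v f) (v g) \<le> v (f + g)" using v by (auto simp: place_def)
  then show ?thesis using assms False by (auto simp: val_ge_def)
qed (use assms in \<open>auto simp: val_ge_def\<close>)

lemma val_ge_uminus: "place K v \<Longrightarrow> val_ge v (- f) k \<longleftrightarrow> val_ge v f k"
  by (simp add: val_ge_def place_uminus)

lemma val_ge_diff:
  assumes v: "place K v" and "val_ge v f k" "val_ge v g k"
  shows "val_ge v (f - g) k"
  using val_ge_add[OF v assms(2), of "- g"] val_ge_uminus[OF v] assms(3) by simp

lemma val_ge_mult:
  assumes v: "place K v" and "val_ge v f k" "val_ge v g l"
  shows "val_ge v (f * g) (k + l)"
  using assms(2,3) place_mult[OF v, of f g] by (cases "f = 0"; cases "g = 0") (auto simp: val_ge_def)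

lemma val_ge_mono: "val_ge v f k \<Longrightarrow> l \<le> k \<Longrightarrow> val_ge v f l"
  by (auto simp: val_ge_def)

lemma val_ge_sum:
  assumes v: "place K v" and "\<And>i. i \<in> I \<Longrightarrow> val_ge v (f i) k"
  shows "val_ge v (sum f I) k"
  using assms(2)
  by (induction I rule: infinite_finite_induct) (auto simp: val_ge_add[OF v], auto simp: val_ge_def)

lemma val_ge_const:
  assumes v: "place K v" and "u \<in> K"
  shows "val_ge v u 0"
  using place_const[OF assms] by (simp add: val_ge_def)

lemma place_add_dominant:
  assumes v: "place K v" and f: "f \<noteq> 0" and g: "val_ge v g (v f + 1)"
  shows "f + g \<noteq> 0" "v (f + g) = v f"
proof -
  show nz: "f + g \<noteq> 0"
  proof
    assume "f + g = 0"
    then have "f = - g" by (simp add: eq_neg_iff_add_eq_0)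
    then show False using g f place_uminus[OF v, of g] by (auto simp: val_ge_def)
  qed
  have "val_ge v (f + g) (v f)"
    using val_ge_add[OF v, of f "v f" g] g val_ge_mono[OF g] by (auto simp: val_ge_def)
  moreover have "\<not> v f + 1 \<le> v (f + g)"
  proof
    assume "v f + 1 \<le> v (f + g)"
    then have "val_ge v (f + g - g) (v f + 1)" by (intro val_ge_diff[OF v] g) (simp add: val_ge_def)
    then show False using f by (simp add: val_ge_def)
  qed
  ultimately show "v (f + g) = v f" using nz by (auto simp: val_ge_def)
qed

text \<open>
  The strict triangle inequality: the term of least value dominates the sum of all others.
\<close>

lemma place_sum_distinct:
  assumes v: "place K v" and fin: "finite I"
    and distinct: "\<forall>i\<in>I. \<forall>j\<in>I. t i \<noteq> 0 \<longrightarrow> t j \<noteq> 0 \<longrightarrow> v (t i) = v (t j) \<longrightarrow> i = j"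
    and nz: "\<exists>i\<in>I. t i \<noteq> 0"
  shows "sum t I \<noteq> 0"
    and "\<exists>i\<in>I. t i \<noteq> 0 \<and> v (sum t I) = v (t i)"
    and "\<And>i. i \<in> I \<Longrightarrow> val_ge v (t i) (v (sum t I))"
proof -
  define J where "J = {i\<in>I. t i \<noteq> 0}"
  have J: "finite J" "J \<noteq> {}" using fin nz by (auto simp: J_def)
  define i0 where "i0 = arg_min_on (\<lambda>i. v (t i)) J"
  have i0: "i0 \<in> J" unfolding i0_def by (rule arg_min_if_finite(1)[OF J])
  have least: "v (t i0) \<le> v (t i)" if "i \<in> J" for i
    unfolding i0_def by (rule arg_min_least[OF J that])
  have "val_ge v (t i) (v (t i0) + 1)" if "i \<in> I - {i0}" for i
  proof (cases "t i = 0")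
    case False
    then have "i \<in> J" "i \<noteq> i0" using that by (auto simp: J_def)
    then have "v (t i) \<noteq> v (t i0)" using distinct i0 by (auto simp: J_def)
    then show ?thesis using least[OF \<open>i \<in> J\<close>] by (auto simp: val_ge_def)
  qed (simp add: val_ge_def)
  then have "val_ge v (sum t (I - {i0})) (v (t i0) + 1)" by (rule val_ge_sum[OF v])
  moreover have "sum t I = t i0 + sum t (I - {i0})"
    using fin i0 by (simp add: J_def sum.remove)
  ultimately have *: "sum t I \<noteq> 0" "v (sum t I) = v (t i0)"
    using place_add_dominant[OF v, of "t i0"] i0 by (auto simp: J_def)
  show "sum t I \<noteq> 0" by (rule *)
  show "\<exists>i\<in>I. t i \<noteq> 0 \<and> v (sum t I) = v (t i)" using * i0 by (auto simp: J_def)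
  show "val_ge v (t i) (v (sum t I))" if "i \<in> I" for i
    using least[of i] that * by (auto simp: J_def val_ge_def)
qed

lemma place_poly_at_pole:
  assumes v: "place K v" and u: "v u < 0"
  shows "r \<in> polys_over K \<Longrightarrow> r \<noteq> 0 \<Longrightarrow> poly r u \<noteq> 0 \<and> v (poly r u) = int (degree r) * v u"
proof (induction r)
  case (pCons a r)
  have u0: "u \<noteq> 0" using u place_zero[OF v] by auto
  have a: "a \<in> K" and r: "r \<in> polys_over K" using pCons.prems by (auto simp: polys_over_pCons)
  show ?case
  proof (cases "r = 0")
    case True
    then show ?thesis using pCons.prems a place_const[OF v] by simp
  next
    case False
    then have IH: "poly r u \<noteq> 0" "v (poly r u) = int (degree r) * v u" using pCons.IH r by auto
    have 1: "v (u * poly r u) = int (Suc (degree r)) * v u"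
      using IH u0 by (simp add: place_mult[OF v] algebra_simps)
    have "v (u * poly r u) < 0" unfolding 1 using u by (simp add: mult_pos_neg)
    then have "val_ge v a (v (u * poly r u) + 1)"
      by (intro val_ge_mono[OF val_ge_const[OF v a]]) simp
    from place_add_dominant[OF v _ this] IH u0 1 False show ?thesis by (simp add: add.commute)
  qed
qed simp

lemma place_poly_integral:
  assumes v: "place K v" and u: "val_ge v u 0" and r: "r \<in> polys_over K"
  shows "val_ge v (poly r u) 0"
  using r
proof (induction r)
  case (pCons a r)
  then have "a \<in> K" "r \<in> polys_over K" by (auto simp: polys_over_pCons)
  then show ?case
    using pCons.IH val_ge_mult[OF v u, of "poly r u" 0] val_ge_const[OF v, of a]
    by (auto intro!: val_ge_add[OF v])
qed (simp add: val_ge_def)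

lemma has_value_iff: "has_value v f u \<longleftrightarrow> val_ge v (f - u) 1"
  by (auto simp: has_value_def val_ge_def)

lemma poly_minus_value:
  assumes K: "is_subring K" and v: "place K v" and \<alpha>: "\<alpha> \<in> K" and u: "val_ge v (u - \<alpha>) 1" and r: "r \<in> polys_over K"
  shows "val_ge v (poly r u - poly r \<alpha>) 1"
proof -
  have "val_ge v (u - \<alpha> + \<alpha>) 0"
    by (intro val_ge_add[OF v] val_ge_mono[OF u] val_ge_const[OF v \<alpha>]) simp
  then have u0: "val_ge v u 0" by simp
  have "poly r u = (u - \<alpha>) * poly (synthetic_div r \<alpha>) u + poly r \<alpha>"
    by (subst synthetic_div_correct'[of \<alpha> r, symmetric], subst poly_add, subst poly_mult) simp
  then have "poly r u - poly r \<alpha> = (u - \<alpha>) * poly (synthetic_div r \<alpha>) u" by simp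
  moreover have "val_ge v (poly (synthetic_div r \<alpha>) u) 0"
    by (rule place_poly_integral[OF v u0 polys_over_synthetic_div[OF K \<alpha> r]])
  ultimately show ?thesis using val_ge_mult[OF v u] by fastforce
qed

text \<open>
  Splitting off the linear factor \<open>X - \<alpha>\<close> lowers the order by one; once \<open>\<alpha>\<close> is no longer a root, the
  polynomial takes a nonzero constant value modulo the place.
\<close>

lemma place_poly_at_zero:
  assumes K: "is_subring K" and v: "place K v" and \<alpha>: "\<alpha> \<in> K" and u: "v (u - \<alpha>) > 0"
  shows "r \<in> polys_over K \<Longrightarrow> r \<noteq> 0 \<Longrightarrow> poly r u \<noteq> 0 \<and> v (poly r u) = int (order \<alpha> r) * v (u - \<alpha>)"
proof (induction "degree r" arbitrary: r rule: less_induct)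
  case less
  have u1: "val_ge v (u - \<alpha>) 1" using u by (auto simp: val_ge_def)
  have nz: "u - \<alpha> \<noteq> 0" using u place_zero[OF v] by auto
  show ?case
  proof (cases "poly r \<alpha> = 0")
    case False
    have "poly r \<alpha> \<in> K" using poly_in_subring[OF K _ \<alpha>] less.prems by blast
    then have "v (poly r \<alpha>) = 0" by (rule place_const[OF v])
    with poly_minus_value[OF K v \<alpha> u1 less.prems(1)]
    have "val_ge v (poly r u - poly r \<alpha>) (v (poly r \<alpha>) + 1)" by simp
    from place_add_dominant[OF v False this] \<open>v (poly r \<alpha>) = 0\<close>
    have "poly r u \<noteq> 0" "v (poly r u) = 0" by simp_all
    then show ?thesis using order_root[of r \<alpha>] False by simp
  next
    case True
    define s where "s = synthetic_div r \<alpha>"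
    have r: "r = [:-\<alpha>, 1:] * s" using synthetic_div_correct'[of \<alpha> r] True by (simp add: s_def)
    have s: "s \<noteq> 0" "s \<in> polys_over K"
      using less.prems(2) polys_over_synthetic_div[OF K \<alpha> less.prems(1)] r
      unfolding s_def[symmetric] by (metis mult_zero_right, simp)
    have "degree ([:-\<alpha>, 1:] * s) = degree [:-\<alpha>, 1:] + degree s"
      by (rule degree_mult_eq) (simp, rule s(1))
    then have "degree r = Suc (degree s)" by (simp only: r[symmetric]) simp
    then have IH: "poly s u \<noteq> 0" "v (poly s u) = int (order \<alpha> s) * v (u - \<alpha>)"
      using less.hyps[of s] s by auto
    have "order \<alpha> ([:-\<alpha>, 1:] * s) = order \<alpha> [:-\<alpha>, 1:] + order \<alpha> s"
      using less.prems(2) by (intro order_mult) (simp only: r[symmetric], simp)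
    then have "order \<alpha> r = Suc (order \<alpha> s)"
      using order_power_n_n[of \<alpha> 1] by (simp only: r[symmetric]) simp
    moreover have "poly r u = poly [:-\<alpha>, 1:] u * poly s u"
      by (subst r, rule poly_mult)
    then have "poly r u = (u - \<alpha>) * poly s u" by simp
    moreover have "v ((u - \<alpha>) * poly s u) = v (u - \<alpha>) + int (order \<alpha> s) * v (u - \<alpha>)"
      using IH nz by (simp add: place_mult[OF v])
    ultimately show ?thesis using IH nz by (simp only:) (simp add: algebra_simps)
  qed
qed

section \<open>Places from prime ideals\<close>

definition prime_ideal_of :: "'f::field set \<Rightarrow> 'f set \<Rightarrow> bool" where
  "prime_ideal_of A J \<longleftrightarrow> J \<subseteq> A \<and> 0 \<in> J \<and> 1 \<notin> J \<and> (\<forall>u\<in>J. \<forall>w\<in>J. u + w \<in> J) \<and>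
     (\<forall>a\<in>A. \<forall>u\<in>J. a * u \<in> J) \<and> (\<forall>a\<in>A. \<forall>b\<in>A. a * b \<in> J \<longrightarrow> a \<in> J \<or> b \<in> J)"

text \<open>
  By Zorn's lemma there is a proper ideal that is maximal among those containing \<open>I\<close>.
\<close>

lemma exists_prime_ideal:
  fixes A :: "'f::field set"
  assumes A: "is_subring A" and I: "I \<subseteq> A" "0 \<in> I" "1 \<notin> I" "\<And>u w. u \<in> I \<Longrightarrow> w \<in> I \<Longrightarrow> u + w \<in> I"
    "\<And>a u. a \<in> A \<Longrightarrow> u \<in> I \<Longrightarrow> a * u \<in> I"
  shows "\<exists>J. prime_ideal_of A J \<and> I \<subseteq> J"
proof -
  define proper where "proper = {J. I \<subseteq> J \<and> J \<subseteq> A \<and> 1 \<notin> J \<and> (\<forall>u\<in>J. \<forall>w\<in>J. u + w \<in> J) \<and>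
     (\<forall>a\<in>A. \<forall>u\<in>J. a * u \<in> J)}"
  have "\<exists>J\<in>proper. \<forall>X\<in>proper. J \<subseteq> X \<longrightarrow> X = J"
  proof (rule subset_Zorn_nonempty)
    have "I \<in> proper" unfolding proper_def using I by simp
    then show "proper \<noteq> {}" by blast
    fix C assume C: "C \<noteq> {}" "subset.chain proper C"
    have sub: "J \<in> proper" if "J \<in> C" for J using C(2) that by (auto simp: subset_chain_def)
    show "\<Union>C \<in> proper"
      unfolding proper_def mem_Collect_eq
    proof (intro conjI ballI)
      obtain X where "X \<in> C" using C(1) by blast
      moreover have "I \<subseteq> X" using sub[OF \<open>X \<in> C\<close>] by (simp add: proper_def)
      ultimately show "I \<subseteq> \<Union>C" by blast
      have "X \<subseteq> A" "1 \<notin> X" if "X \<in> C" for X using sub[OF that] by (simp_all add: proper_def)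
      then show "\<Union>C \<subseteq> A" "1 \<notin> \<Union>C" by blast+
      fix u w assume "u \<in> \<Union>C" "w \<in> \<Union>C"
      then obtain X Y where XY: "X \<in> C" "u \<in> X" "Y \<in> C" "w \<in> Y" by blast
      have "X \<subseteq> Y \<or> Y \<subseteq> X" using C(2) XY by (auto simp: subset_chain_def)
      moreover have "\<forall>u\<in>X. \<forall>w\<in>X. u + w \<in> X" "\<forall>u\<in>Y. \<forall>w\<in>Y. u + w \<in> Y"
        using sub[OF XY(1)] sub[OF XY(3)] by (simp_all add: proper_def)
      ultimately show "u + w \<in> \<Union>C" using XY by blast
    next
      fix a u assume "a \<in> A" "u \<in> \<Union>C"
      then obtain X where X: "X \<in> C" "u \<in> X" by blast
      then have "a * u \<in> X" using sub[OF X(1)] \<open>a \<in> A\<close> by (simp add: proper_def)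
      then show "a * u \<in> \<Union>C" using X(1) by blast
    qed
  qed
  then obtain J where J: "J \<in> proper" "\<And>X. X \<in> proper \<Longrightarrow> J \<subseteq> X \<Longrightarrow> X = J" by blast
  have Jd: "I \<subseteq> J" "J \<subseteq> A" "1 \<notin> J" "\<And>u w. u \<in> J \<Longrightarrow> w \<in> J \<Longrightarrow> u + w \<in> J"
    "\<And>a u. a \<in> A \<Longrightarrow> u \<in> J \<Longrightarrow> a * u \<in> J" using J(1) by (auto simp: proper_def)
  have "b \<in> J" if ab: "a \<in> A" "b \<in> A" "a * b \<in> J" "a \<notin> J" for a b
  proof -
    define X where "X = {u + a * d | u d. u \<in> J \<and> d \<in> A}"
    have 0: "0 \<in> J" using Jd(1) I(2) by blast
    have "a = 0 + a * 1" by simp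
    then have "a \<in> X" unfolding X_def using 0 subring_1[OF A] by blast
    moreover have JX: "J \<subseteq> X"
    proof
      fix u assume "u \<in> J"
      moreover have "u = u + a * 0" by simp
      ultimately show "u \<in> X" unfolding X_def using subring_0[OF A] by blast
    qed
    ultimately have "X \<notin> proper" using J(2) ab(4) by blast
    moreover have "X \<subseteq> A" unfolding X_def using Jd(2) ab(1) A by (auto intro!: subring_add subring_mult)
    moreover have "s + t \<in> X" if st: "s \<in> X" "t \<in> X" for s t
    proof -
      obtain u d u' d' where "s = u + a * d" "t = u' + a * d'" "u \<in> J" "u' \<in> J" "d \<in> A" "d' \<in> A"
        using st unfolding X_def by blast
      then have "s + t = (u + u') + a * (d + d')" "u + u' \<in> J" "d + d' \<in> A"
        using Jd(4) subring_add[OF A] by (auto simp: algebra_simps)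
      then show ?thesis unfolding X_def by blast
    qed
    moreover have "e * s \<in> X" if es: "e \<in> A" "s \<in> X" for e s
    proof -
      obtain u d where "s = u + a * d" "u \<in> J" "d \<in> A" using es unfolding X_def by blast
      then have "e * s = e * u + a * (e * d)" "e * u \<in> J" "e * d \<in> A"
        using Jd(5) subring_mult[OF A] es by (auto simp: algebra_simps)
      then show ?thesis unfolding X_def by blast
    qed
    ultimately have "1 \<in> X" using JX Jd(1) unfolding proper_def by blast
    then obtain u d where ud: "1 = u + a * d" "u \<in> J" "d \<in> A" unfolding X_def by blast
    have "b = b * (u + a * d)" unfolding ud(1)[symmetric] by simp
    also have "\<dots> = b * u + d * (a * b)" by (simp add: algebra_simps)
    also have "\<dots> \<in> J" using ud ab Jd(4,5) by blast
    finally show ?thesis .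
  qed
  then have "prime_ideal_of A J"
    unfolding prime_ideal_of_def using Jd I(2) by blast
  then show ?thesis using Jd(1) by blast
qed

text \<open>
  The last hypothesis says that the localisation of \<open>A\<close> at \<open>J\<close> is a discrete valuation ring with
  uniformiser \<open>\<pi>\<close>. The value of \<open>f\<close> is the exponent \<open>k\<close> in \<open>f = u \<pi>\<^sup>k\<close> with \<open>u\<close> a quotient of two elements
  outside \<open>J\<close>, and an element of nonnegative value has a denominator outside \<open>J\<close>.
\<close>

lemma place_of_prime_ideal:
  fixes K A :: "'f::field set"
  assumes K: "is_subfield K" and A: "is_subring A" "K \<subseteq> A" and J: "prime_ideal_of A J"
    and \<pi>: "\<pi> \<in> J" "\<pi> \<noteq> 0"
    and fraction: "\<And>f. \<exists>a\<in>A. \<exists>b\<in>A. b \<noteq> 0 \<and> f * b = a"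
    and uniformiser: "\<And>a. a \<in> A \<Longrightarrow> a \<noteq> 0 \<Longrightarrow> \<exists>k. \<exists>s\<in>A - J. \<exists>s'\<in>A - J. s * a = s' * \<pi> ^ k"
  shows "\<exists>v. place K v \<and> (\<forall>a\<in>A. 0 \<le> v a) \<and> (\<forall>f. 0 \<le> v f \<longrightarrow> (\<exists>s\<in>A - J. s * f \<in> A))"
proof -
  define U where "U = A - J"
  have Jd: "J \<subseteq> A" "0 \<in> J" "1 \<notin> J" "\<And>a u. a \<in> A \<Longrightarrow> u \<in> J \<Longrightarrow> a * u \<in> J"
    "\<And>a b. a \<in> A \<Longrightarrow> b \<in> A \<Longrightarrow> a * b \<in> J \<Longrightarrow> a \<in> J \<or> b \<in> J"
    using J unfolding prime_ideal_of_def by auto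
  have U1: "1 \<in> U" and Um: "\<And>s t. s \<in> U \<Longrightarrow> t \<in> U \<Longrightarrow> s * t \<in> U"
    using Jd subring_1[OF A(1)] subring_mult[OF A(1)] unfolding U_def by blast+
  have pow_J: "a * \<pi> powi j \<in> J" if "a \<in> A" "j > 0" for a j
  proof -
    obtain k where k: "j = int (Suc k)" using \<open>j > 0\<close> by (metis pos_int_cases Suc_pred)
    have "\<pi> ^ k \<in> A" using \<pi> Jd(1) by (intro subring_power[OF A(1)]) blast
    then have "(a * \<pi> ^ k) * \<pi> \<in> J" using that \<pi> by (intro Jd(4) subring_mult[OF A(1)])
    then show ?thesis unfolding k power_int_of_nat by (simp add: mult_ac)
  qed
  define ord where "ord f k \<longleftrightarrow> (\<exists>s\<in>U. \<exists>s'\<in>U. s * f = s' * \<pi> powi k)" for f k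
  have ord_ge: "l \<le> k" if prems: "ord f k" "u \<in> U" "b \<in> A" "u * f = b * \<pi> powi l" for f k l u b
  proof (rule ccontr)
    assume "\<not> l \<le> k"
    then have "l - k > 0" by simp
    obtain s s' where s: "s \<in> U" "s' \<in> U" "s * f = s' * \<pi> powi k"
      using prems(1) unfolding ord_def by blast
    have "(u * s') * \<pi> powi k = u * (s * f)" by (simp add: s)
    also have "\<dots> = s * (b * \<pi> powi l)" using prems(4) by (metis mult.left_commute)
    also have "\<pi> powi l = \<pi> powi (l - k) * \<pi> powi k"
      using \<pi>(2) by (simp flip: power_int_add)
    finally have "u * s' = (s * b) * \<pi> powi (l - k)" using \<pi>(2) by simp
    also have "\<dots> \<in> J"
      using s(1) prems(3) \<open>l - k > 0\<close> by (intro pow_J subring_mult[OF A(1)]) (auto simp: U_def)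
    finally show False using Um[OF prems(2) s(2)] by (simp add: U_def)
  qed
  have ord_unique: "k = l" if kl: "ord f k" "ord f l" for f k l
    using kl ord_ge[OF kl(1)] ord_ge[OF kl(2)] unfolding ord_def U_def by (metis DiffD1 order_antisym)
  have ord_exists: "\<exists>k. ord f k" if "f \<noteq> 0" for f
  proof -
    obtain a b where ab: "a \<in> A" "b \<in> A" "b \<noteq> 0" "f * b = a" using fraction by blast
    then have "a \<noteq> 0" using that by auto
    obtain k s s' where s: "s \<in> U" "s' \<in> U" "s * a = s' * \<pi> ^ k"
      using uniformiser[OF ab(1) \<open>a \<noteq> 0\<close>] unfolding U_def by blast
    obtain l t t' where t: "t \<in> U" "t' \<in> U" "t * b = t' * \<pi> ^ l"
      using uniformiser[OF ab(2,3)] unfolding U_def by blast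
    have "(s * t') * f * \<pi> ^ l = s * (f * (t' * \<pi> ^ l))" by (simp only: mult_ac)
    also have "\<dots> = t * (s * (f * b))" unfolding t(3)[symmetric] by (simp only: mult_ac)
    also have "\<dots> = (t * s') * \<pi> ^ k" unfolding ab(4) s(3) by (simp only: mult_ac)
    finally have "(s * t') * f * \<pi> ^ l = (t * s') * \<pi> ^ k" .
    moreover have "\<pi> powi (int k - int l) * \<pi> ^ l = \<pi> ^ k"
      using \<pi>(2) by (simp add: power_int_diff)
    ultimately have "(s * t') * f = (t * s') * \<pi> powi (int k - int l)"
      using \<pi>(2) by (metis (no_types, lifting) mult.assoc mult_right_cancel power_not_zero)
    then show ?thesis unfolding ord_def using Um s t by blast
  qed
  define v where "v f = (if f = 0 then 0 else THE k. ord f k)" for f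
  have v_ord: "ord f (v f)" if "f \<noteq> 0" for f
    unfolding v_def using that theI'[of "ord f"] ord_exists[OF that] ord_unique by auto
  have v_eqI: "v f = k" if "f \<noteq> 0" "ord f k" for f k
    using v_ord[OF that(1)] that(2) ord_unique by blast
  have "place K v"
    unfolding place_def
  proof (intro conjI allI impI ballI)
    show "v 0 = 0" by (simp add: v_def)
    fix f g :: 'f assume fg: "f \<noteq> 0" "g \<noteq> 0"
    obtain s s' where s: "s \<in> U" "s' \<in> U" "s * f = s' * \<pi> powi v f"
      using v_ord[OF fg(1)] unfolding ord_def by blast
    obtain t t' where t: "t \<in> U" "t' \<in> U" "t * g = t' * \<pi> powi v g"
      using v_ord[OF fg(2)] unfolding ord_def by blast
    have "(s * t) * (f * g) = (s * f) * (t * g)" by (simp only: mult_ac)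
    also have "\<dots> = (s' * t') * \<pi> powi (v f + v g)"
      unfolding s(3) t(3) using \<pi>(2) by (simp add: power_int_add mult_ac)
    finally have "(s * t) * (f * g) = (s' * t') * \<pi> powi (v f + v g)" .
    then have "ord (f * g) (v f + v g)" unfolding ord_def using s t Um by blast
    then show "v (f * g) = v f + v g" using fg by (intro v_eqI) auto
    assume nz: "f + g \<noteq> 0"
    define m where "m = min (v f) (v g)"
    define b where "b = t * s' * \<pi> ^ nat (v f - m) + s * t' * \<pi> ^ nat (v g - m)"
    have "\<pi> powi v f = \<pi> ^ nat (v f - m) * \<pi> powi m" "\<pi> powi v g = \<pi> ^ nat (v g - m) * \<pi> powi m"
      using \<pi>(2) by (simp_all add: m_def flip: power_int_of_nat power_int_add)
    then have "t * (s * f) + s * (t * g) = b * \<pi> powi m"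
      unfolding s(3) t(3) b_def by (simp add: ring_distribs mult_ac)
    then have "(s * t) * (f + g) = b * \<pi> powi m"
      by (simp add: ring_distribs mult_ac)
    moreover have "b \<in> A"
      unfolding b_def using s t \<pi>(1) Jd(1) U_def
      by (intro subring_add[OF A(1)] subring_mult[OF A(1)] subring_power[OF A(1)]) auto
    ultimately show "min (v f) (v g) \<le> v (f + g)"
      using ord_ge[OF v_ord[OF nz]] Um[OF s(1) t(1)] unfolding m_def by blast
  next
    fix u assume u: "u \<in> K"
    show "v u = 0"
    proof (cases "u = 0")
      case False
      have "inverse u * u \<notin> J" using False Jd(3) by simp
      then have "u \<in> U"
        using Jd(4)[of "inverse u" u] A(2) u subfield_inverse[OF K u] unfolding U_def by blast
      moreover have "1 * u = u * \<pi> powi 0" by simp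
      ultimately have "ord u 0" unfolding ord_def using U1 by blast
      then show ?thesis using False by (intro v_eqI)
    qed (simp add: v_def)
  next
    have "1 * \<pi> = 1 * \<pi> powi 1" by simp
    then have "ord \<pi> 1" unfolding ord_def using U1 by blast
    then show "\<exists>f. f \<noteq> 0 \<and> v f = 1" using \<pi>(2) v_eqI by blast
  qed
  moreover have "0 \<le> v a" if "a \<in> A" for a
  proof (cases "a = 0")
    case False
    have "1 * a = a * \<pi> powi 0" by simp
    then show ?thesis using ord_ge[OF v_ord[OF False] U1 that] by blast
  qed (simp add: v_def)
  moreover have "\<exists>s\<in>A - J. s * f \<in> A" if "0 \<le> v f" for f
  proof (cases "f = 0")
    case True
    then show ?thesis using U1 subring_0[OF A(1)] unfolding U_def by auto
  next
    case False
    obtain s s' where s: "s \<in> U" "s' \<in> U" "s * f = s' * \<pi> powi v f"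
      using v_ord[OF False] unfolding ord_def by blast
    have "s' * \<pi> powi v f \<in> A"
      using that s(2) \<pi>(1) Jd(1) unfolding U_def
      by (auto simp: power_int_def intro!: subring_mult[OF A(1)] subring_power[OF A(1)])
    then show ?thesis using s unfolding U_def by metis
  qed
  ultimately show ?thesis by blast
qed

section \<open>Finite subfields and Frobenius\<close>

text \<open>
  Multiplication by \<open>u \<noteq> 0\<close> permutes the nonzero elements of \<open>K\<close>, so it does not change their product.
\<close>

lemma finite_subfield_power_card:
  assumes K: "is_subfield K" "finite K" and u: "u \<in> K"
  shows "u ^ card K = (u::'f::field)"
proof (cases "u = 0")
  case True
  have "0 < card K" using K u by (auto simp: card_gt_0_iff)
  then show ?thesis using True by simp
next
  case False
  note R = subfield_imp_subring[OF K(1)]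
  have 0: "0 \<in> K" by (rule subring_0[OF R])
  have "(\<Prod>w\<in>K - {0}. u * w) = (\<Prod>w\<in>K - {0}. w)"
  proof (rule prod.reindex_bij_witness[of _ "\<lambda>w. inverse u * w" "\<lambda>w. u * w"])
    fix w assume "w \<in> K - {0}"
    then have w: "w \<in> K" "w \<noteq> 0" by auto
    have "inverse u * w \<in> K" "inverse u * w \<noteq> 0" "u * w \<in> K" "u * w \<noteq> 0"
      using subring_mult[OF R subfield_inverse[OF K(1) u] w(1)] subring_mult[OF R u w(1)] False w(2)
      by (assumption | simp)+
    then show "inverse u * w \<in> K - {0}" "u * w \<in> K - {0}" by blast+
  qed (use False in simp_all)
  then have "u ^ card (K - {0}) * (\<Prod>w\<in>K - {0}. w) = (\<Prod>w\<in>K - {0}. w)"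
    by (simp add: prod.distrib)
  moreover have "(\<Prod>w\<in>K - {0}. w) \<noteq> 0" using K(2) by simp
  ultimately have "u ^ card (K - {0}) = 1" by simp
  moreover have "card K = Suc (card (K - {0}))" by (rule card.remove[OF K(2) 0])
  ultimately show ?thesis by (metis power_Suc mult.right_neutral)
qed

text \<open>
  Translation by \<open>1\<close> permutes \<open>K\<close>, so it does not change the sum of its elements.
\<close>

lemma of_nat_card_subfield:
  fixes K :: "'f::field set"
  assumes K: "is_subfield K" "finite K"
  shows "of_nat (card K) = (0::'f::field)"
proof -
  note R = subfield_imp_subring[OF K(1)]
  have "(\<Sum>w\<in>K. w + 1) = (\<Sum>w\<in>K. w)"
    by (rule sum.reindex_bij_witness[of _ "\<lambda>w. w - 1" "\<lambda>w. w + 1"])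
      (auto simp: subring_add[OF R] subring_diff[OF R] subring_1[OF R])
  then show ?thesis by (simp add: sum.distrib)
qed

lemma CHAR_of_subfield:
  fixes K :: "'f::field set"
  assumes K: "is_subfield K" and card: "card K = p ^ k" and p: "prime p"
  shows "CHAR('f) = p"
proof -
  have nz: "p ^ k \<noteq> 0" using prime_gt_0_nat[OF p] by simp
  then have "finite K" using card by (intro card_ge_0_finite) simp
  then have "of_nat (p ^ k) = (0::'f)" using of_nat_card_subfield[OF K] card by metis
  then have dvd: "CHAR('f) dvd p ^ k" by (simp only: of_nat_eq_0_iff_char_dvd)
  then have "CHAR('f) \<noteq> 0" using nz by (metis dvd_0_left_iff)
  then have "prime CHAR('f)" using prime_CHAR_semidom[where ?'a = 'f] by simp
  then show ?thesis using dvd p by (meson prime_dvd_power primes_dvd_imp_eq)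
qed

lemma frobenius_diff:
  fixes u w :: "'f::field"
  assumes "prime CHAR('f)"
  shows "(u - w) ^ (CHAR('f) ^ k) = u ^ (CHAR('f) ^ k) - w ^ (CHAR('f) ^ k)"
  using freshmans_dream'[OF assms refl, of "u - w" w k] by (simp add: algebra_simps)

section \<open>The common shape of the two curves\<close>

text \<open>
  For the first family \<open>T\<close> is \<open>t\<close>, of degree \<open>d = q / p\<^sup>b\<close>; for the second one \<open>c = 1\<close>,
  \<open>T = X\<^sup>q + X\<close> and \<open>d = q\<close>. That \<open>0\<close> is a simple root of the additive \<open>T\<close> says that \<open>T\<close> is
  separable. The membership of \<open>x\<^sup>q\<^sup>2 - x\<close> in \<open>K[y]\<close> exhibits \<open>x\<close> as the solution of an Artin-Schreier
  equation over \<open>K[y]\<close>, just as \<open>y\<close> is one over \<open>K[z]\<close>.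
\<close>

locale curve_model =
  fixes K :: "'f::field set" and x y z c :: 'f and T :: "'f poly" and p a n q d M :: nat
    and Pinf :: "'f \<Rightarrow> int"
  assumes K: "is_subfield K" and card_K: "card K = q ^ (2 * n)"
    and p: "prime p" and q: "q = p ^ a" and a: "1 \<le> a" and n: "1 \<le> n"
    and generated: "is_subfield hull (K \<union> {x, y, z}) = UNIV"
    and c: "c \<in> K" "c \<noteq> 0"
    and T: "T \<in> polys_over K" "lead_coeff T = 1" "degree T = d" "order 0 T = 1"
    and T_diff: "\<And>u w. poly T (u - w) = poly T u - poly T w"
    and d: "d dvd q"
    and y_power: "c * y ^ (q + 1) = poly T x"
    and z_power: "z ^ M = y ^ (q ^ 2) - y"
    and x_frobenius: "x ^ (q ^ 2) - x \<in> is_subring hull (insert y K)"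
    and M: "M * (q + 1) = q ^ n + 1"
    and Pinf: "common_poles K x y z = {Pinf}"
begin

lemma subring_K: "is_subring K"
  by (rule subfield_imp_subring[OF K])

lemma q_ge_2: "2 \<le> q"
proof -
  have "p ^ 1 \<le> p ^ a" using a prime_ge_2_nat[OF p] by (intro power_increasing) auto
  then show ?thesis using prime_ge_2_nat[OF p] by (simp add: q)
qed

lemma d_pos: "0 < d"
  using d q_ge_2 by (auto intro!: Nat.gr0I)

lemma M_pos: "0 < M"
  using M by (auto intro!: Nat.gr0I)

lemma finite_K: "finite K"
  using card_K q_ge_2 by (intro card_ge_0_finite) simp

lemma CHAR_eq: "CHAR('f) = p"
  using CHAR_of_subfield[OF K _ p, of "a * (2 * n)"] by (simp add: card_K q power_mult)

lemma q_frobenius: "(u - w) ^ (q ^ k) = u ^ (q ^ k) - w ^ (q ^ k)"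
  and q_frobenius_add: "(u + w) ^ (q ^ k) = u ^ (q ^ k) + w ^ (q ^ k)" for u w :: 'f
proof -
  have "q ^ k = CHAR('f) ^ (a * k)" by (simp add: CHAR_eq q power_mult)
  moreover have "prime CHAR('f)" using p by (simp add: CHAR_eq)
  ultimately show "(u - w) ^ (q ^ k) = u ^ (q ^ k) - w ^ (q ^ k)"
    "(u + w) ^ (q ^ k) = u ^ (q ^ k) + w ^ (q ^ k)"
    using frobenius_diff[of u w "a * k"] freshmans_dream'[of "q ^ k" "a * k" u w] by auto
qed

lemma of_nat_p: "of_nat p = (0::'f)"
  by (metis CHAR_eq of_nat_CHAR)

lemma coprime_M_q: "coprime M q"
proof (rule coprimeI)
  fix r assume r: "r dvd M" "r dvd q"
  have "r dvd q ^ n" using r(2) n by (intro dvd_power_le[of r q 1 n, simplified]) auto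
  moreover have "r dvd q ^ n + 1" using r(1) M by (metis dvd_mult2)
  ultimately show "r dvd 1" using dvd_add_right_iff by blast
qed

lemma coprime_d_q1: "coprime d (q + 1)"
  using d coprime_divisors[of d q "q + 1" "q + 1"] by simp

lemma Pinf_place: "place K Pinf" and Pinf_x: "Pinf x < 0" and Pinf_y: "Pinf y < 0"
  and Pinf_z: "Pinf z < 0"
  using Pinf unfolding common_poles_def by blast+

lemma x_notin_K: "x \<notin> K"
  using place_const[OF Pinf_place] Pinf_x by fastforce

lemma y_nz: "y \<noteq> 0" and z_nz: "z \<noteq> 0"
  using place_zero[OF Pinf_place] Pinf_y Pinf_z by auto

lemma q2: "1 < q ^ 2"
  using q_ge_2 by (intro one_less_power) auto

lemma place_y_frobenius_pole:
  assumes v: "place K v" and y: "v y < 0"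
  shows "v (z ^ M) = int (q ^ 2) * v y"
proof -
  have "val_ge v (- y) (v (y ^ (q ^ 2)) + 1)"
  proof -
    have "2 \<le> int (q ^ 2)" using q2 by linarith
    then have "int (q ^ 2) * v y \<le> 2 * v y" using y by (intro mult_right_mono_neg) auto
    then have "int (q ^ 2) * v y + 1 \<le> v y" using y by linarith
    then show ?thesis
      by (simp only: val_ge_def place_uminus[OF v] place_power[OF v y_nz] simp_thms)
  qed
  from place_add_dominant(2)[OF v _ this] y_nz show ?thesis
    by (simp add: z_power place_power[OF v])
qed

lemma place_y_power:
  assumes v: "place K v"
  shows "v (c * y ^ (q + 1)) = int (q + 1) * v y"
  unfolding place_mult[OF v c(2) power_not_zero[OF y_nz]] place_const[OF v c(1)]
    place_power[OF v y_nz] by simp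

text \<open>
  Both equations are dominated by their leading terms at a pole of \<open>x\<close>; in particular \<open>y\<close> and \<open>z\<close> have
  poles there as well, which identifies the place as \<open>Pinf\<close>.
\<close>

lemma place_pole:
  assumes v: "place K v" and x: "v x < 0"
  shows "int (q + 1) * v y = int d * v x" and "int M * v z = int (q ^ 2) * v y"
proof -
  have T0: "T \<noteq> 0" using T by auto
  show 1: "int (q + 1) * v y = int d * v x"
    using place_poly_at_pole[OF v x T(1) T0] T(3) place_y_power[OF v] by (simp only: y_power)
  have "int d * v x < 0" using d_pos x by (simp add: mult_pos_neg)
  then have "int (q + 1) * v y < 0" using 1 by simp
  then have "v y < 0" by (simp add: mult_less_0_iff)
  from place_y_frobenius_pole[OF v this] z_nz show "int M * v z = int (q ^ 2) * v y"
    by (simp add: place_power[OF v])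
qed

lemma pole_of_x_is_Pinf:
  assumes v: "place K v" and x: "v x < 0"
  shows "v = Pinf"
proof -
  have "int d * v x < 0" using d_pos x by (simp add: mult_pos_neg)
  then have "int (q + 1) * v y < 0" using place_pole(1)[OF assms] by simp
  then have y: "v y < 0" by (simp add: mult_less_0_iff)
  moreover have "0 < int (q ^ 2)" using q2 by linarith
  ultimately have "int (q ^ 2) * v y < 0" by (simp only: mult_pos_neg)
  then have "int M * v z < 0" using place_pole(2)[OF assms] by simp
  then have "v z < 0" by (simp add: mult_less_0_iff)
  then have "v \<in> common_poles K x y z" using v x y by (simp add: common_poles_def)
  then show ?thesis using Pinf by simp
qed

lemma place_affine:
  assumes v: "place K v" "v \<noteq> Pinf"
  shows "val_ge v x 0" "val_ge v y 0" "val_ge v z 0"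
proof -
  show x: "val_ge v x 0" using pole_of_x_is_Pinf[OF v(1)] v(2) by (force simp: val_ge_def)
  have "val_ge v (c * y ^ (q + 1)) 0"
    unfolding y_power by (rule place_poly_integral[OF v(1) x T(1)])
  then have "0 \<le> int (q + 1) * v y"
    using c y_nz unfolding place_y_power[OF v(1), symmetric] by (simp add: val_ge_def)
  then have y0: "0 \<le> v y" by (simp add: zero_le_mult_iff)
  then show "val_ge v y 0" by (simp add: val_ge_def)
  then have "val_ge v (y ^ (q ^ 2) - y) 0"
    using y0 y_nz by (intro val_ge_diff[OF v(1)]) (simp_all add: val_ge_def place_power[OF v(1)])
  then have "0 \<le> v (z ^ M)" using z_nz by (simp add: val_ge_def flip: z_power)
  then have "0 \<le> int M * v z" using z_nz by (simp add: place_power[OF v(1)])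
  then show "val_ge v z 0" using M_pos by (simp add: val_ge_def zero_le_mult_iff)
qed

subsection \<open>The affine coordinate ring\<close>

definition coord_ring :: "'f set" where
  "coord_ring = is_subring hull (K \<union> {x, y, z})"

lemma subring_coord_ring: "is_subring coord_ring"
  unfolding coord_ring_def by (rule subring_hull)

lemma coord_ring_gens: "K \<subseteq> coord_ring" "x \<in> coord_ring" "y \<in> coord_ring" "z \<in> coord_ring"
  unfolding coord_ring_def by (auto intro: hull_inc)

lemma coord_ring_subset:
  "is_subring S \<Longrightarrow> K \<subseteq> S \<Longrightarrow> x \<in> S \<Longrightarrow> y \<in> S \<Longrightarrow> z \<in> S \<Longrightarrow> coord_ring \<subseteq> S"
  unfolding coord_ring_def by (rule hull_minimal) auto

lemma fraction_coord_ring: "\<exists>a\<in>coord_ring. \<exists>b\<in>coord_ring. b \<noteq> 0 \<and> f * b = a"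
proof -
  let ?F = "{f. \<exists>a\<in>coord_ring. \<exists>b\<in>coord_ring. b \<noteq> 0 \<and> f * b = a}"
  note R = subring_coord_ring
  have base: "f \<in> ?F" if "f \<in> coord_ring" for f
  proof -
    have "f * 1 = f" "(1::'f) \<noteq> 0" by simp_all
    then show ?thesis using that subring_1[OF R] by blast
  qed
  have "is_subfield ?F"
    unfolding is_subfield_def
  proof (intro conjI ballI)
    show "0 \<in> ?F" "1 \<in> ?F" using base subring_0[OF R] subring_1[OF R] by auto
    fix u w assume "u \<in> ?F" "w \<in> ?F"
    then obtain b b' where b: "b \<in> coord_ring" "b \<noteq> 0" "u * b \<in> coord_ring"
      "b' \<in> coord_ring" "b' \<noteq> 0" "w * b' \<in> coord_ring" by blast
    have "(u - w) * (b * b') = (u * b) * b' - (w * b') * b" "(u * w) * (b * b') = (u * b) * (w * b')"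
      by (simp_all add: algebra_simps)
    moreover have "(u * b) * b' - (w * b') * b \<in> coord_ring" "(u * b) * (w * b') \<in> coord_ring"
      by (rule subring_diff[OF R]; rule subring_mult[OF R]; fact b)
        (rule subring_mult[OF R]; fact b)
    ultimately have "(u - w) * (b * b') \<in> coord_ring" "(u * w) * (b * b') \<in> coord_ring"
      by (simp_all only:)
    moreover have "b * b' \<in> coord_ring" "b * b' \<noteq> 0" using b subring_mult[OF R] by auto
    ultimately show "u - w \<in> ?F" "u * w \<in> ?F" by blast+
  next
    fix u assume "u \<in> ?F"
    then obtain b where b: "b \<in> coord_ring" "b \<noteq> 0" "u * b \<in> coord_ring" by blast
    show "inverse u \<in> ?F"
    proof (cases "u = 0")
      case True
      then show ?thesis using base[OF subring_0[OF R]] by simp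
    next
      case False
      then have "inverse u * (u * b) = b" "u * b \<noteq> 0" using b by (simp_all flip: mult.assoc)
      then show ?thesis using b by blast
    qed
  qed
  moreover have "K \<union> {x, y, z} \<subseteq> ?F" using base coord_ring_gens by blast
  ultimately have "is_subfield hull (K \<union> {x, y, z}) \<subseteq> ?F" by (intro hull_minimal)
  then show ?thesis using generated by blast
qed

definition polys_x :: "'f set" where "polys_x = (\<lambda>r. poly r x) ` polys_over K"
definition polys_z :: "'f set" where "polys_z = (\<lambda>r. poly r z) ` polys_over K"

lemma subring_polys_x: "is_subring polys_x" and subring_polys_z: "is_subring polys_z"
  unfolding polys_x_def polys_z_def by (rule subring_poly_values[OF subring_K])+

lemma polys_x_gens: "K \<subseteq> polys_x" "x \<in> polys_x"
  and polys_z_gens: "K \<subseteq> polys_z" "z \<in> polys_z"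
  using poly_values_superset[OF subring_K] unfolding polys_x_def polys_z_def by blast+

lemma polys_z_subset: "polys_z \<subseteq> coord_ring"
  unfolding polys_z_def
  using poly_in_subring[OF subring_coord_ring coord_ring_gens(1)] coord_ring_gens by blast+

definition indices :: "(nat \<times> nat) set" where "indices = {..<M} \<times> {..q}"
definition yz_monomial :: "nat \<times> nat \<Rightarrow> 'f" where "yz_monomial i = y ^ snd i * z ^ fst i"

lemma finite_indices: "finite indices"
  by (simp add: indices_def)

text \<open>
  The equations rewrite \<open>y\<^sup>q\<^sup>+\<^sup>1\<close> as a polynomial in \<open>x\<close> and \<open>z\<^sup>M\<close> as a polynomial in \<open>y\<close>.
\<close>

lemma coord_ring_subset_span_yz: "coord_ring \<subseteq> lin_span polys_x indices yz_monomial"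
proof -
  let ?V = "lin_span polys_x indices yz_monomial"
  note L = subring_polys_x
  have base: "y ^ B * z ^ A \<in> ?V" if "A < M" "B \<le> q" for A B
    using lin_span_base[OF L finite_indices, of "(A, B)" yz_monomial] that
    by (simp add: yz_monomial_def indices_def)
  have y: "y * f \<in> ?V" if "f \<in> ?V" for f
  proof (rule lin_span_mult_closed[OF L _ that])
    fix i assume "i \<in> indices"
    then obtain A B where i: "i = (A, B)" "A < M" "B \<le> q" by (auto simp: indices_def)
    show "y * yz_monomial i \<in> ?V"
    proof (cases "B < q")
      case True
      then show ?thesis using base[of A "Suc B"] i by (simp add: yz_monomial_def mult.assoc)
    next
      case False
      then have "y ^ Suc B = inverse c * poly T x"
        using i c by (simp flip: y_power)
      then have "y * yz_monomial i = (inverse c * poly T x) * (y ^ 0 * z ^ A)"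
        using i by (simp add: yz_monomial_def flip: mult.assoc)
      moreover have "inverse c * poly T x \<in> polys_x"
        using polys_x_gens subfield_inverse[OF K c(1)] T(1)
        by (intro subring_mult[OF L]) (auto simp: polys_x_def)
      ultimately show ?thesis using lin_span_scale[OF L base[of A 0]] i by simp
    qed
  qed
  have yk: "y ^ k * f \<in> ?V" if "f \<in> ?V" for f k
    by (induction k) (use that y in \<open>auto simp: mult.assoc\<close>)
  have z: "z * f \<in> ?V" if "f \<in> ?V" for f
  proof (rule lin_span_mult_closed[OF L _ that])
    fix i assume "i \<in> indices"
    then obtain A B where i: "i = (A, B)" "A < M" "B \<le> q" by (auto simp: indices_def)
    show "z * yz_monomial i \<in> ?V"
    proof (cases "Suc A < M")
      case True
      then show ?thesis using base[of "Suc A" B] i by (simp add: yz_monomial_def mult_ac)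
    next
      case False
      then have "Suc A = M" using i by simp
      then have "z * yz_monomial i = y ^ B * z ^ M"
        using i by (auto simp: yz_monomial_def mult_ac)
      also have "\<dots> = y ^ (q ^ 2) * (y ^ B * z ^ 0) - y * (y ^ B * z ^ 0)"
        by (simp add: z_power algebra_simps)
      also have "\<dots> \<in> ?V"
        using i M_pos by (intro lin_span_diff[OF L] y yk base) auto
      finally show ?thesis .
    qed
  qed
  show ?thesis
    unfolding coord_ring_def
  proof (rule subring_hull_subset_lin_span[OF L])
    show "1 \<in> ?V" using base[of 0 0] M_pos by simp
    show "w * f \<in> ?V" if "w \<in> K \<union> {x, y, z}" "f \<in> ?V" for w f
      using that y z lin_span_scale[OF L that(2)] polys_x_gens by blast
  qed
qed

text \<open>
  Read the other way round, the equations are monic of degree \<open>d\<close> in \<open>x\<close> and of degree \<open>q\<^sup>2\<close> in \<open>y\<close>, so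
  that the coordinate ring is finite over \<open>K[z]\<close>.
\<close>

lemma coord_ring_subset_span_xy:
  "coord_ring \<subseteq> lin_span polys_z ({..<d} \<times> {..<q ^ 2}) (\<lambda>i. x ^ fst i * y ^ snd i)"
proof -
  let ?I = "{..<d} \<times> {..<q ^ 2}"
  let ?V = "lin_span polys_z ?I (\<lambda>i. x ^ fst i * y ^ snd i)"
  note L = subring_polys_z
  have base: "x ^ A * y ^ B \<in> ?V" if "A < d" "B < q ^ 2" for A B
    using lin_span_base[OF L, of ?I "(A, B)" "\<lambda>i. x ^ fst i * y ^ snd i"] that by simp
  have K_V: "u * f \<in> ?V" if "f \<in> ?V" "u \<in> K" for f u
    using lin_span_scale[OF L that(1)] polys_z_gens that(2) by blast
  have y: "y * f \<in> ?V" if "f \<in> ?V" for f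
  proof (rule lin_span_mult_closed[OF L _ that])
    fix i assume "i \<in> ?I"
    then obtain A B where i: "i = (A, B)" "A < d" "B < q ^ 2" by auto
    show "y * (x ^ fst i * y ^ snd i) \<in> ?V"
    proof (cases "Suc B < q ^ 2")
      case True
      then show ?thesis using base[of A "Suc B"] i by (simp add: mult_ac)
    next
      case False
      then have "Suc B = q ^ 2" using i by simp
      then have "y ^ Suc B = y ^ 1 + z ^ M * y ^ 0" by (simp add: z_power)
      then have "x ^ A * y ^ Suc B = x ^ A * y ^ 1 + z ^ M * (x ^ A * y ^ 0)"
        by (simp only: distrib_left mult_ac)
      moreover have "y * (x ^ fst i * y ^ snd i) = x ^ A * y ^ Suc B"
        using i by (simp add: mult_ac)
      ultimately have "y * (x ^ fst i * y ^ snd i) = x ^ A * y ^ 1 + z ^ M * (x ^ A * y ^ 0)"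
        by (simp only:)
      also have "\<dots> \<in> ?V"
        using i q2 q_ge_2 polys_z_gens
        by (intro lin_span_add[OF L] lin_span_scale[OF L, of "x ^ A * y ^ 0"] base subring_power[OF L]) auto
      finally show ?thesis .
    qed
  qed
  have yk: "y ^ k * f \<in> ?V" if "f \<in> ?V" for f k
    by (induction k) (use that y in \<open>auto simp: mult.assoc\<close>)
  have x: "x * f \<in> ?V" if "f \<in> ?V" for f
  proof (rule lin_span_mult_closed[OF L _ that])
    fix i assume "i \<in> ?I"
    then obtain A B where i: "i = (A, B)" "A < d" "B < q ^ 2" by auto
    show "x * (x ^ fst i * y ^ snd i) \<in> ?V"
    proof (cases "Suc A < d")
      case True
      then show ?thesis using base[of "Suc A" B] i by (simp add: mult_ac)
    next
      case False
      then have d: "d = Suc A" using i by simp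
      have "poly T x = (\<Sum>l<d. coeff T l * x ^ l) + x ^ d"
        using T by (simp add: poly_altdef flip: lessThan_Suc_atMost)
      then have "x ^ Suc A = c * y ^ (q + 1) - (\<Sum>l<d. coeff T l * x ^ l)"
        unfolding y_power d[symmetric] by simp
      then have "(x ^ Suc A) * y ^ B = c * (y ^ (q + 1) * (x ^ 0 * y ^ B)) - (\<Sum>l<d. coeff T l * (x ^ l * y ^ B))"
        by (simp add: left_diff_distrib sum_distrib_right mult.assoc)
      also have "\<dots> \<in> ?V"
        using i d_pos T(1) c
        by (intro lin_span_diff[OF L] K_V yk lin_span_sum[OF L] base) (auto simp: polys_over_def)
      finally show ?thesis using i by (simp add: mult.assoc)
    qed
  qed
  show ?thesis
    unfolding coord_ring_def
  proof (rule subring_hull_subset_lin_span[OF L])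
    show "1 \<in> ?V" using base[of 0 0] d_pos q_ge_2 by simp
    show "w * f \<in> ?V" if "w \<in> K \<union> {x, y, z}" "f \<in> ?V" for w f
      using that x y K_V[OF that(2)] lin_span_scale[OF L that(2)] polys_z_gens by blast
  qed
qed

subsection \<open>Functions without affine poles lie in the coordinate ring\<close>

lemma poly_z_nz: "r \<in> polys_over K \<Longrightarrow> r \<noteq> 0 \<Longrightarrow> poly r z \<noteq> 0"
  and poly_x_nz: "r \<in> polys_over K \<Longrightarrow> r \<noteq> 0 \<Longrightarrow> poly r x \<noteq> 0"
  using place_poly_at_pole[OF Pinf_place Pinf_z] place_poly_at_pole[OF Pinf_place Pinf_x] by blast+

text \<open>
  The next lemmas show that every element of the coordinate ring is fixed modulo \<open>\<pi>\<close> by some power of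
  the Frobenius map \<open>u \<mapsto> u\<^sup>q\<^sup>2\<close>, if \<open>z\<close> is. The residue ring modulo \<open>\<pi>\<close> is then reduced, which is
  what the etaleness over the \<open>z\<close>-line amounts to, and makes \<open>\<pi>\<close> a uniformiser at every prime containing it.
\<close>

definition frobenius_fixed :: "'f \<Rightarrow> nat \<Rightarrow> 'f set" where
  "frobenius_fixed \<pi> k = {f \<in> coord_ring. \<exists>g\<in>coord_ring. f ^ ((q ^ 2) ^ k) - f = \<pi> * g}"

lemma Q_frobenius: "(u - w) ^ ((q ^ 2) ^ k) = u ^ ((q ^ 2) ^ k) - w ^ ((q ^ 2) ^ k)"
  and Q_frobenius_add: "(u + w) ^ ((q ^ 2) ^ k) = u ^ ((q ^ 2) ^ k) + w ^ ((q ^ 2) ^ k)" for u w :: 'f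
  using q_frobenius[of u w "2 * k"] q_frobenius_add[of u w "2 * k"] by (simp_all add: power_mult)

lemma Q_power_mult: "(\<pi> * h) ^ ((q ^ 2) ^ k) = \<pi> * (\<pi> ^ ((q ^ 2) ^ k - 1) * h ^ ((q ^ 2) ^ k))"
  for \<pi> h :: 'f
proof -
  have "0 < (q ^ 2) ^ k" using q_ge_2 by simp
  then have "\<pi> ^ ((q ^ 2) ^ k) = \<pi> * \<pi> ^ ((q ^ 2) ^ k - 1)"
    using power_minus_mult[of "(q ^ 2) ^ k" \<pi>] by (simp only: mult.commute)
  then have "\<pi> ^ ((q ^ 2) ^ k) * h ^ ((q ^ 2) ^ k) = \<pi> * \<pi> ^ ((q ^ 2) ^ k - 1) * h ^ ((q ^ 2) ^ k)"
    by (rule arg_cong)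
  then show ?thesis unfolding power_mult_distrib by (simp only: mult.assoc)
qed

lemma subring_frobenius_fixed:
  assumes \<pi>: "\<pi> \<in> coord_ring"
  shows "is_subring (frobenius_fixed \<pi> k)"
proof -
  note R = subring_coord_ring
  let ?Q = "(q ^ 2) ^ k"
  have Q0: "0 < ?Q" using q_ge_2 by simp
  have "u - w \<in> frobenius_fixed \<pi> k \<and> u * w \<in> frobenius_fixed \<pi> k"
    if uw: "u \<in> frobenius_fixed \<pi> k" "w \<in> frobenius_fixed \<pi> k" for u w
  proof -
    obtain g h where g: "u \<in> coord_ring" "g \<in> coord_ring" "u ^ ?Q - u = \<pi> * g"
      and h: "w \<in> coord_ring" "h \<in> coord_ring" "w ^ ?Q - w = \<pi> * h"
      using uw unfolding frobenius_fixed_def by blast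
    have "(u - w) ^ ?Q - (u - w) = (u ^ ?Q - u) - (w ^ ?Q - w)"
      by (simp add: Q_frobenius)
    also have "\<dots> = \<pi> * (g - h)" by (simp add: g h algebra_simps)
    finally have 1: "(u - w) ^ ?Q - (u - w) = \<pi> * (g - h)" .
    have "(u * w) ^ ?Q - u * w = u ^ ?Q * (w ^ ?Q - w) + (u ^ ?Q - u) * w"
      by (simp add: power_mult_distrib algebra_simps)
    also have "\<dots> = \<pi> * (u ^ ?Q * h + g * w)" by (simp add: g h algebra_simps)
    finally have 2: "(u * w) ^ ?Q - u * w = \<pi> * (u ^ ?Q * h + g * w)" .
    have "g - h \<in> coord_ring" "u ^ ?Q * h + g * w \<in> coord_ring" "u - w \<in> coord_ring" "u * w \<in> coord_ring"
      using g h by (auto intro!: subring_diff[OF R] subring_add[OF R] subring_mult[OF R] subring_power[OF R])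
    then show ?thesis unfolding frobenius_fixed_def using 1 2 by blast
  qed
  moreover have "0 ^ ?Q - 0 = \<pi> * 0" "1 ^ ?Q - 1 = \<pi> * 0" using Q0 by (auto simp: power_0_left)
  then have "0 \<in> frobenius_fixed \<pi> k" "1 \<in> frobenius_fixed \<pi> k"
    unfolding frobenius_fixed_def using subring_0[OF R] subring_1[OF R] by blast+
  ultimately show ?thesis unfolding is_subring_def by blast
qed

text \<open>
  Modulo \<open>\<pi>\<close>, Frobenius is a ring homomorphism, so whatever one power of it fixes, its iterates fix as well.
\<close>

lemma frobenius_fixed_mono:
  assumes \<pi>: "\<pi> \<in> coord_ring"
  shows "frobenius_fixed \<pi> k \<subseteq> frobenius_fixed \<pi> (k * l)"
proof (induction l)
  case 0
  have "f ^ ((q ^ 2) ^ (k * 0)) - f = \<pi> * 0" for f by simp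
  then show ?case unfolding frobenius_fixed_def using subring_0[OF subring_coord_ring] by blast
next
  case (Suc l)
  note R = subring_coord_ring
  let ?Q = "(q ^ 2) ^ k" and ?Ql = "(q ^ 2) ^ (k * l)"
  show ?case
  proof
    fix f assume f: "f \<in> frobenius_fixed \<pi> k"
    then obtain g where g: "f \<in> coord_ring" "g \<in> coord_ring" "f ^ ?Q - f = \<pi> * g"
      unfolding frobenius_fixed_def by blast
    obtain h where h: "h \<in> coord_ring" "f ^ ?Ql - f = \<pi> * h"
      using f Suc unfolding frobenius_fixed_def by blast
    have "f ^ ((q ^ 2) ^ (k * Suc l)) - f = (f ^ ?Ql) ^ ?Q - f"
      by (simp add: power_add flip: power_mult) (simp add: mult_ac)
    also have "\<dots> = (f ^ ?Ql - f) ^ ?Q + (f ^ ?Q - f)" by (simp add: Q_frobenius)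
    also have "\<dots> = \<pi> * (\<pi> ^ (?Q - 1) * h ^ ?Q + g)"
      unfolding g h Q_power_mult[of \<pi> h] by (simp only: distrib_left)
    finally have "f ^ ((q ^ 2) ^ (k * Suc l)) - f = \<pi> * (\<pi> ^ (?Q - 1) * h ^ ?Q + g)" .
    moreover have "\<pi> ^ (?Q - 1) * h ^ ?Q + g \<in> coord_ring"
      using g h \<pi> by (intro subring_add[OF R] subring_mult[OF R] subring_power[OF R])
    ultimately show "f \<in> frobenius_fixed \<pi> (k * Suc l)"
      unfolding frobenius_fixed_def using g(1) by blast
  qed
qed

lemma K_frobenius_fixed:
  assumes \<pi>: "\<pi> \<in> coord_ring"
  shows "K \<subseteq> frobenius_fixed \<pi> (n * l)"
proof -
  have "u ^ ((q ^ 2) ^ n) - u = \<pi> * 0" if "u \<in> K" for u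
    using finite_subfield_power_card[OF K finite_K that] by (simp add: card_K power_mult)
  then have "K \<subseteq> frobenius_fixed \<pi> n"
    unfolding frobenius_fixed_def using coord_ring_gens(1) subring_0[OF subring_coord_ring] by blast
  then show ?thesis using frobenius_fixed_mono[OF \<pi>] by blast
qed

text \<open>
  Put \<open>Q = q\<^sup>2\<close>, \<open>w = u\<^sup>Q - u\<close> and \<open>g = u\<^sup>Q\<^sup>k - u\<close>. By additivity \<open>g\<close> is the sum of the conjugates
  \<open>w\<^sup>Q\<^sup>j\<close> with \<open>j < k\<close>, hence is fixed as well, and \<open>k l\<close> steps of Frobenius add \<open>l g\<close> to \<open>u\<close>. For
  \<open>l = p\<close> this vanishes.
\<close>

lemma frobenius_fixed_artin_schreier:
  assumes \<pi>: "\<pi> \<in> coord_ring" and u: "u \<in> coord_ring"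
    and w: "u ^ (q ^ 2) - u \<in> frobenius_fixed \<pi> k"
  shows "u \<in> frobenius_fixed \<pi> (k * p)"
proof -
  note R = subring_coord_ring and FR = subring_frobenius_fixed[OF \<pi>, of k]
  let ?Q = "(q ^ 2) ^ k"
  have sub: "frobenius_fixed \<pi> k \<subseteq> coord_ring" by (auto simp: frobenius_fixed_def)
  define g where "g = u ^ ?Q - u"
  have "u ^ ((q ^ 2) ^ j) - u \<in> frobenius_fixed \<pi> k" for j
  proof (induction j)
    case 0
    then show ?case using subring_0[OF FR] by simp
  next
    case (Suc j)
    have "u ^ ((q ^ 2) ^ Suc j) - u = (u ^ (q ^ 2)) ^ ((q ^ 2) ^ j) - u"
      by (simp flip: power_mult)
    also have "\<dots> = (u ^ (q ^ 2) - u) ^ ((q ^ 2) ^ j) + (u ^ ((q ^ 2) ^ j) - u)"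
      by (simp add: Q_frobenius)
    finally have eq: "u ^ ((q ^ 2) ^ Suc j) - u =
      (u ^ (q ^ 2) - u) ^ ((q ^ 2) ^ j) + (u ^ ((q ^ 2) ^ j) - u)" .
    show ?case unfolding eq by (intro subring_add[OF FR] subring_power[OF FR] w Suc)
  qed
  then have g: "g \<in> frobenius_fixed \<pi> k" by (simp add: g_def)
  have "\<exists>h\<in>coord_ring. u ^ ((q ^ 2) ^ (k * l)) - u = of_nat l * g + \<pi> * h" for l
  proof (induction l)
    case 0
    then show ?case using subring_0[OF R] by (intro bexI[of _ 0]) auto
  next
    case (Suc l)
    then obtain h where h: "h \<in> coord_ring" "u ^ ((q ^ 2) ^ (k * l)) - u = of_nat l * g + \<pi> * h"
      by blast
    have "of_nat l \<in> frobenius_fixed \<pi> k"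
      by (induction l) (auto simp: subring_0[OF FR] subring_1[OF FR] subring_add[OF FR])
    then have "of_nat l * g \<in> frobenius_fixed \<pi> k" using g by (rule subring_mult[OF FR])
    then obtain h' where h': "h' \<in> coord_ring" "(of_nat l * g) ^ ?Q - of_nat l * g = \<pi> * h'"
      unfolding frobenius_fixed_def by blast
    have "u ^ ((q ^ 2) ^ (k * Suc l)) - u = (u ^ ((q ^ 2) ^ (k * l))) ^ ?Q - u"
      by (simp add: power_add flip: power_mult) (simp add: mult_ac)
    also have "\<dots> = (u ^ ((q ^ 2) ^ (k * l)) - u) ^ ?Q + g" by (simp add: Q_frobenius g_def)
    also have "\<dots> = ((of_nat l * g) ^ ?Q - of_nat l * g) + of_nat l * g + (\<pi> * h) ^ ?Q + g"
      unfolding h(2) by (simp add: Q_frobenius_add)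
    also have "\<dots> = of_nat (Suc l) * g + \<pi> * (h' + \<pi> ^ (?Q - 1) * h ^ ?Q)"
      unfolding h'(2) Q_power_mult[of \<pi> h] by (simp add: algebra_simps)
    finally have "u ^ ((q ^ 2) ^ (k * Suc l)) - u =
      of_nat (Suc l) * g + \<pi> * (h' + \<pi> ^ (?Q - 1) * h ^ ?Q)" .
    moreover have "h' + \<pi> ^ (?Q - 1) * h ^ ?Q \<in> coord_ring"
      using h h' \<pi> by (intro subring_add[OF R] subring_mult[OF R] subring_power[OF R])
    ultimately show ?case by blast
  qed
  from this[of p] show ?thesis using u by (auto simp: of_nat_p frobenius_fixed_def)
qed

text \<open>
  The property climbs from \<open>K\<close> and \<open>z\<close> to \<open>y\<close> and then to \<open>x\<close>, each time multiplying the exponent by \<open>p\<close>.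
\<close>

lemma coord_ring_frobenius_fixed:
  assumes \<pi>: "\<pi> \<in> coord_ring" and z: "z \<in> frobenius_fixed \<pi> k" and k: "0 < k"
  shows "\<exists>l>0. coord_ring \<subseteq> frobenius_fixed \<pi> l"
proof -
  note FR = subring_frobenius_fixed[OF \<pi>]
  have K': "K \<subseteq> frobenius_fixed \<pi> (n * l)" for l by (rule K_frobenius_fixed[OF \<pi>])
  have z1: "z \<in> frobenius_fixed \<pi> (n * k)"
    using z frobenius_fixed_mono[OF \<pi>, of k n] by (auto simp: mult.commute)
  have "y ^ (q ^ 2) - y \<in> frobenius_fixed \<pi> (n * k)"
    unfolding z_power[symmetric] by (rule subring_power[OF FR z1])
  then have y2: "y \<in> frobenius_fixed \<pi> (n * k * p)"
    by (rule frobenius_fixed_artin_schreier[OF \<pi> coord_ring_gens(3)])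
  have "is_subring hull (insert y K) \<subseteq> frobenius_fixed \<pi> (n * k * p)"
    using y2 K'[of "k * p"] by (intro hull_minimal FR) (auto simp: mult.assoc)
  then have x3: "x \<in> frobenius_fixed \<pi> (n * k * p * p)"
    using x_frobenius by (intro frobenius_fixed_artin_schreier[OF \<pi> coord_ring_gens(2)]) blast
  have y3: "y \<in> frobenius_fixed \<pi> (n * k * p * p)" "z \<in> frobenius_fixed \<pi> (n * k * p * p)"
    using y2 z1 frobenius_fixed_mono[OF \<pi>] by (blast, metis mult.assoc subsetD)
  have "coord_ring \<subseteq> frobenius_fixed \<pi> (n * k * p * p)"
    using K'[of "k * p * p"] x3 y3 by (intro coord_ring_subset FR) (auto simp: mult.assoc)
  moreover have "0 < n * k * p * p" using n k prime_gt_0_nat[OF p] by simp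
  ultimately show ?thesis by blast
qed

text \<open>
  The polynomials in \<open>z\<close> that lie in \<open>J\<close> form a principal ideal, generated by one of least degree.
\<close>

lemma exists_generator:
  assumes J: "prime_ideal_of coord_ring J" and h: "h \<in> polys_over K" "h \<noteq> 0" "poly h z \<in> J"
  obtains r where "r \<in> polys_over K" "r \<noteq> 0" "poly r z \<in> J"
    "\<And>g. g \<in> polys_over K \<Longrightarrow> poly g z \<in> J \<Longrightarrow> \<exists>s\<in>polys_over K. g = r * s"
proof -
  define P where "P r \<longleftrightarrow> r \<in> polys_over K \<and> r \<noteq> 0 \<and> poly r z \<in> J" for r
  define r where "r = (ARG_MIN degree r. P r)"
  have "P h" using h by (simp add: P_def)
  then have r: "P r" unfolding r_def by (rule arg_min_natI)
  have least: "degree r \<le> degree g" if "P g" for g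
    unfolding r_def using that by (rule arg_min_nat_le)
  have "\<exists>s\<in>polys_over K. g = r * s" if g: "g \<in> polys_over K" "poly g z \<in> J" for g
  proof -
    obtain s t where st: "s \<in> polys_over K" "t \<in> polys_over K" "g = r * s + t"
      "t = 0 \<or> degree t < degree r"
      using polys_over_division[OF K _ _ g(1)] r unfolding P_def by blast
    have coord: "poly f z \<in> coord_ring" if "f \<in> polys_over K" for f
      by (rule poly_in_subring[OF subring_coord_ring coord_ring_gens(1,4) that])
    have "- s \<in> polys_over K"
      using polys_over_diff[OF subring_K polys_over_0[OF subring_K] st(1)] by simp
    then have "poly (- s) z * poly r z \<in> J"
      using J r coord[of "- s"] unfolding prime_ideal_of_def P_def by blast
    then have "poly g z + poly (- s) z * poly r z \<in> J"
      using J g(2) unfolding prime_ideal_of_def by blast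
    moreover have "poly t z = poly g z + poly (- s) z * poly r z" by (simp add: st(3))
    ultimately have "poly t z \<in> J" by simp
    then have "t = 0" using st least[of t] unfolding P_def by fastforce
    then show ?thesis using st by auto
  qed
  then show ?thesis using that r unfolding P_def by blast
qed

text \<open>
  Modulo the generator there are only finitely many polynomials, so two iterates of Frobenius agree at
  \<open>z\<close>; as Frobenius is injective modulo a prime, the iterate leading from one to the other fixes \<open>z\<close>.
\<close>

lemma z_frobenius_fixed:
  assumes J: "prime_ideal_of coord_ring J" and r: "r \<in> polys_over K" "r \<noteq> 0" "poly r z \<in> J"
    and gen: "\<And>g. g \<in> polys_over K \<Longrightarrow> poly g z \<in> J \<Longrightarrow> \<exists>s\<in>polys_over K. g = r * s"
  shows "\<exists>k>0. z \<in> frobenius_fixed (poly r z) k"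
proof -
  note R = subring_K
  have rem: "\<exists>t. t \<in> polys_over K \<and> (t = 0 \<or> degree t < degree r) \<and>
    (\<exists>s\<in>polys_over K. monom 1 ((q ^ 2) ^ j) = r * s + t)" for j
    using polys_over_division[OF K r(1,2) polys_over_monom[OF R subring_1[OF R]]] by metis
  then obtain t where t: "\<And>j. t j \<in> polys_over K" "\<And>j. t j = 0 \<or> degree (t j) < degree r"
    "\<And>j. \<exists>s\<in>polys_over K. monom 1 ((q ^ 2) ^ j) = r * s + t j" by metis
  have "range t \<subseteq> {g \<in> polys_over K. g = 0 \<or> degree g < degree r}" using t(1,2) by blast
  then have "finite (range t)" using finite_polys_over_degree_less[OF finite_K] finite_subset by blast
  then have "\<not> inj t" using finite_imageD infinite_UNIV_nat by blast
  then obtain i j where ij: "i < j" "t i = t j"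
    unfolding inj_on_def by (metis linorder_neqE_nat)
  define k where "k = j - i"
  have k: "j = i + k" "0 < k" using ij by (auto simp: k_def)
  obtain s s' where s: "s \<in> polys_over K" "monom 1 ((q ^ 2) ^ i) = r * s + t i"
    "s' \<in> polys_over K" "monom 1 ((q ^ 2) ^ j) = r * s' + t j" using t(3) by metis
  have coord: "poly f z \<in> coord_ring" if "f \<in> polys_over K" for f
    by (rule poly_in_subring[OF subring_coord_ring coord_ring_gens(1,4) that])
  have "z ^ ((q ^ 2) ^ j) = poly (monom 1 ((q ^ 2) ^ j)) z" "z ^ ((q ^ 2) ^ i) = poly (monom 1 ((q ^ 2) ^ i)) z"
    by (simp_all add: poly_monom)
  then have "z ^ ((q ^ 2) ^ j) - z ^ ((q ^ 2) ^ i) = poly (s' - s) z * poly r z"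
    unfolding s ij by (simp add: algebra_simps)
  moreover have "poly (s' - s) z * poly r z \<in> J"
    using J r(3) coord[OF polys_over_diff[OF R s(3,1)]] unfolding prime_ideal_of_def by blast
  moreover have "z ^ ((q ^ 2) ^ j) - z ^ ((q ^ 2) ^ i) = (z ^ ((q ^ 2) ^ k) - z) ^ ((q ^ 2) ^ i)"
    unfolding Q_frobenius k(1) by (simp add: power_add flip: power_mult) (simp add: mult.commute)
  ultimately have J_pow: "(z ^ ((q ^ 2) ^ k) - z) ^ ((q ^ 2) ^ i) \<in> J" by simp
  define w where "w = z ^ ((q ^ 2) ^ k) - z"
  have w: "w \<in> coord_ring"
    unfolding w_def using coord_ring_gens(4)
    by (intro subring_diff[OF subring_coord_ring] subring_power[OF subring_coord_ring])
  have "w ^ l \<in> J \<Longrightarrow> w \<in> J" for l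
  proof (induction l)
    case 0
    then show ?case using J by (simp add: prime_ideal_of_def)
  next
    case (Suc l)
    then have "w * w ^ l \<in> J" by simp
    then have "w \<in> J \<or> w ^ l \<in> J"
      using J w subring_power[OF subring_coord_ring w] unfolding prime_ideal_of_def by blast
    then show ?case using Suc.IH by blast
  qed
  then have "w \<in> J" using J_pow unfolding w_def by blast
  moreover have "w = poly (monom 1 ((q ^ 2) ^ k) - monom 1 1) z"
    by (simp add: w_def poly_monom)
  ultimately obtain g where "g \<in> polys_over K" "monom 1 ((q ^ 2) ^ k) - monom 1 1 = r * g"
    using gen[of "monom 1 ((q ^ 2) ^ k) - monom 1 1"] subring_1[OF R]
    by (metis polys_over_diff[OF R] polys_over_monom[OF R])
  then have "w = poly r z * poly g z" "poly g z \<in> coord_ring"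
    using coord \<open>w = poly _ z\<close> by simp_all
  then show ?thesis using k(2) coord_ring_gens(4) unfolding frobenius_fixed_def w_def by blast
qed

lemma split_off_generator:
  assumes r: "r \<in> polys_over K" "r \<noteq> 0" "degree r > 0"
    and gen: "\<And>g. g \<in> polys_over K \<Longrightarrow> poly g z \<in> J \<Longrightarrow> \<exists>s\<in>polys_over K. g = r * s"
  shows "h \<in> polys_over K \<Longrightarrow> h \<noteq> 0 \<Longrightarrow> \<exists>e. \<exists>g\<in>polys_over K. h = r ^ e * g \<and> poly g z \<notin> J"
proof (induction "degree h" arbitrary: h rule: less_induct)
  case less
  show ?case
  proof (cases "poly h z \<in> J")
    case False
    then show ?thesis using less.prems by (intro exI[of _ 0] bexI[of _ h]) auto
  next
    case True
    then obtain s where s: "s \<in> polys_over K" "h = r * s" using gen less.prems by blast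
    then have "s \<noteq> 0" using less.prems by auto
    moreover have "degree s < degree h"
      unfolding s(2) using r \<open>s \<noteq> 0\<close> by (subst degree_mult_eq) auto
    ultimately obtain e g where "g \<in> polys_over K" "s = r ^ e * g" "poly g z \<notin> J"
      using less.hyps s(1) by blast
    then show ?thesis using s(2) by (intro exI[of _ "Suc e"] bexI[of _ g]) (auto simp: mult.assoc)
  qed
qed

text \<open>
  Divide \<open>f\<close> by the generator \<open>\<pi>\<close> as often as denominators outside \<open>J\<close> permit. This stops, because \<open>f\<close>
  divides a nonzero polynomial in \<open>z\<close>, which contains only a finite power of \<open>\<pi>\<close>. When it stops, the
  cofactor \<open>b\<close> is outside \<open>J\<close>: if it were inside, then \<open>b\<^sup>Q - b\<close> would be a multiple of \<open>\<pi>\<close>, for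
  the power of Frobenius that fixes the ring modulo \<open>\<pi>\<close>, while \<open>b\<^sup>Q\<^sup>-\<^sup>1 - 1\<close> is outside \<open>J\<close>, and one
  more division would be possible.
\<close>

lemma local_uniformiser:
  assumes J: "prime_ideal_of coord_ring J" and r: "r \<in> polys_over K" "r \<noteq> 0" "poly r z \<in> J"
    and gen: "\<And>g. g \<in> polys_over K \<Longrightarrow> poly g z \<in> J \<Longrightarrow> \<exists>s\<in>polys_over K. g = r * s"
    and f: "f \<in> coord_ring" "f \<noteq> 0"
  shows "\<exists>k. \<exists>s\<in>coord_ring - J. \<exists>s'\<in>coord_ring - J. s * f = s' * poly r z ^ k"
proof -
  note R = subring_coord_ring
  define \<pi> where "\<pi> = poly r z"
  have coord: "poly g z \<in> coord_ring" if "g \<in> polys_over K" for g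
    by (rule poly_in_subring[OF R coord_ring_gens(1,4) that])
  have Jd: "J \<subseteq> coord_ring" "0 \<in> J" "1 \<notin> J" "\<And>u w. u \<in> J \<Longrightarrow> w \<in> J \<Longrightarrow> u + w \<in> J"
    "\<And>a u. a \<in> coord_ring \<Longrightarrow> u \<in> J \<Longrightarrow> a * u \<in> J"
    "\<And>a b. a \<in> coord_ring \<Longrightarrow> b \<in> coord_ring \<Longrightarrow> a * b \<in> J \<Longrightarrow> a \<in> J \<or> b \<in> J"
    using J unfolding prime_ideal_of_def by auto
  have \<pi>: "\<pi> \<in> coord_ring" "\<pi> \<in> J" "\<pi> \<noteq> 0"
    using coord[OF r(1)] r(3) poly_z_nz[OF r(1,2)] by (simp_all add: \<pi>_def)
  have "degree r > 0"
  proof (rule ccontr)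
    assume "\<not> degree r > 0"
    then obtain u where u: "r = [:u:]" by (auto elim: degree_eq_zeroE)
    then have "u \<in> K" "u \<noteq> 0" using r(1,2) by (auto simp: polys_over_pCons)
    then have "inverse u \<in> coord_ring" using subfield_inverse[OF K] coord_ring_gens(1) by blast
    then have "inverse u * u \<in> J" using r(3) u by (intro Jd(5)) auto
    then show False using Jd(3) \<open>u \<noteq> 0\<close> by simp
  qed
  obtain f' where f': "f' \<in> coord_ring" "f * f' \<in> polys_z" "f * f' \<noteq> 0"
    using exists_multiple_in_base[OF subring_polys_z R polys_z_subset _ coord_ring_subset_span_xy f]
    by auto
  then obtain h where h: "h \<in> polys_over K" "f * f' = poly h z" unfolding polys_z_def by blast
  then have "h \<noteq> 0" using f' by auto
  from split_off_generator[OF r(1,2) \<open>degree r > 0\<close> gen h(1) this]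
  obtain e g where g: "g \<in> polys_over K" "h = r ^ e * g" "poly g z \<notin> J" by blast
  define S where "S = {k. \<exists>s\<in>coord_ring - J. \<exists>b\<in>coord_ring. s * f = b * \<pi> ^ k}"
  have "1 * f = f * \<pi> ^ 0" by simp
  then have "0 \<in> S" unfolding S_def using subring_1[OF R] Jd(3) f(1) by blast
  have bound: "k \<le> e" if kS: "k \<in> S" for k
  proof (rule ccontr)
    assume "\<not> k \<le> e"
    then obtain l where l: "k = Suc l + e" by (metis add.commute add_Suc less_imp_Suc_add not_le)
    obtain s b where s: "s \<in> coord_ring" "s \<notin> J" "b \<in> coord_ring" "s * f = b * \<pi> ^ k"
      using kS unfolding S_def by blast
    have "s * poly g z * \<pi> ^ e = s * (f * f')" unfolding h(2) g(2) \<pi>_def by simp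
    also have "\<dots> = (b * f' * \<pi> ^ l * \<pi>) * \<pi> ^ e"
      using s(4) unfolding l by (simp add: power_add flip: mult.assoc)
    finally have "s * poly g z = (b * f' * \<pi> ^ l) * \<pi>" using \<pi>(3) by simp
    also have "\<dots> \<in> J"
      using s(3) f'(1) \<pi> by (intro Jd(5) subring_mult[OF R] subring_power[OF R])
    finally show False using Jd(6)[OF s(1) coord[OF g(1)]] s(2) g(3) by blast
  qed
  define k where "k = Max S"
  have fin: "finite S" using bound by (meson finite_nat_set_iff_bounded_le)
  then have "k \<in> S" unfolding k_def using \<open>0 \<in> S\<close> by (intro Max_in) auto
  then obtain s b where s: "s \<in> coord_ring" "s \<notin> J" "b \<in> coord_ring" "s * f = b * \<pi> ^ k"
    unfolding S_def by blast
  have "b \<notin> J"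
  proof
    assume "b \<in> J"
    obtain l where l: "l > 0" "coord_ring \<subseteq> frobenius_fixed \<pi> l"
      using z_frobenius_fixed[OF J r gen] coord_ring_frobenius_fixed[OF \<pi>(1)] unfolding \<pi>_def by blast
    define Q where "Q = (q ^ 2) ^ l"
    have "1 < Q" unfolding Q_def by (rule one_less_power[OF q2 l(1)])
    define j where "j = Q - 2"
    have j: "Q = Suc (Suc j)" using \<open>1 < Q\<close> unfolding j_def by linarith
    obtain b' where b': "b' \<in> coord_ring" "b ^ Q - b = \<pi> * b'"
      using s(3) l(2) unfolding frobenius_fixed_def Q_def by blast
    define w where "w = b ^ Suc j - 1"
    have w: "w \<in> coord_ring" unfolding w_def
      using s(3) by (intro subring_diff[OF R] subring_power[OF R] subring_1[OF R])
    have "w \<notin> J"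
    proof
      assume "w \<in> J"
      have "b * b ^ j \<in> J" using Jd(5)[OF subring_power[OF R s(3)] \<open>b \<in> J\<close>] by (simp add: mult.commute)
      moreover have "(-1) * w \<in> J"
        using \<open>w \<in> J\<close> subring_uminus[OF R subring_1[OF R]] by (intro Jd(5))
      ultimately have "b * b ^ j + (-1) * w \<in> J" by (rule Jd(4))
      then show False using Jd(3) by (simp add: w_def)
    qed
    have "w * b = \<pi> * b'" using b'(2) by (simp add: w_def j algebra_simps)
    have "(w * s) * f = w * b * \<pi> ^ k" using s(4) by (simp add: mult.assoc)
    also have "\<dots> = b' * \<pi> ^ Suc k" unfolding \<open>w * b = \<pi> * b'\<close> by simp
    finally have "(w * s) * f = b' * \<pi> ^ Suc k" .
    moreover have "w * s \<in> coord_ring - J"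
      using Jd(6)[OF w s(1)] subring_mult[OF R w s(1)] s(2) \<open>w \<notin> J\<close> by blast
    ultimately have "Suc k \<in> S" unfolding S_def using b'(1) by blast
    then show False using Max_ge[OF fin] unfolding k_def by fastforce
  qed
  then show ?thesis using s unfolding \<pi>_def by blast
qed

text \<open>
  If \<open>f\<close> is not in the ring, its denominators form a proper ideal \<open>I\<close>. The place of a prime ideal that
  contains \<open>I\<close> is nonnegative on the ring but negative at \<open>f\<close>.
\<close>

lemma coord_ring_integrally_closed:
  assumes f: "\<And>v. place K v \<Longrightarrow> v \<noteq> Pinf \<Longrightarrow> val_ge v f 0"
  shows "f \<in> coord_ring"
proof (rule ccontr)
  assume "f \<notin> coord_ring"
  note R = subring_coord_ring
  define I where "I = {a \<in> coord_ring. a * f \<in> coord_ring}"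
  have "\<exists>J. prime_ideal_of coord_ring J \<and> I \<subseteq> J"
  proof (rule exists_prime_ideal[OF R])
    show "I \<subseteq> coord_ring" "0 \<in> I" "1 \<notin> I"
      using \<open>f \<notin> coord_ring\<close> subring_0[OF R] by (auto simp: I_def)
    show "u + w \<in> I" if "u \<in> I" "w \<in> I" for u w
      using that subring_add[OF R] by (auto simp: I_def ring_distribs)
    show "b * u \<in> I" if "b \<in> coord_ring" "u \<in> I" for b u
      using that subring_mult[OF R] by (auto simp: I_def mult.assoc)
  qed
  then obtain J where J: "prime_ideal_of coord_ring J" "I \<subseteq> J" by blast
  obtain a b where ab: "a \<in> coord_ring" "b \<in> coord_ring" "b \<noteq> 0" "f * b = a"
    using fraction_coord_ring by blast
  obtain b' where b': "b' \<in> coord_ring" "b * b' \<in> polys_z" "b * b' \<noteq> 0"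
    using exists_multiple_in_base[OF subring_polys_z R polys_z_subset _ coord_ring_subset_span_xy ab(2,3)]
    by auto
  then obtain h where h: "h \<in> polys_over K" "b * b' = poly h z" unfolding polys_z_def by blast
  have "b * b' * f = a * b'" using ab(4) by (simp add: mult_ac)
  moreover have "a * b' \<in> coord_ring" "b * b' \<in> coord_ring"
    using ab b' by (auto intro: subring_mult[OF R])
  ultimately have "b * b' \<in> I" unfolding I_def mem_Collect_eq by (simp only: simp_thms)
  then have hJ: "poly h z \<in> J" using J(2) h(2) by auto
  have "h \<noteq> 0" using h(2) b'(3) by auto
  obtain r where r: "r \<in> polys_over K" "r \<noteq> 0" "poly r z \<in> J"
    "\<And>g. g \<in> polys_over K \<Longrightarrow> poly g z \<in> J \<Longrightarrow> \<exists>s\<in>polys_over K. g = r * s"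
    using exists_generator[OF J(1) h(1) \<open>h \<noteq> 0\<close> hJ] by blast
  obtain v where v: "place K v" "\<forall>a\<in>coord_ring. 0 \<le> v a"
    "\<forall>f. 0 \<le> v f \<longrightarrow> (\<exists>s\<in>coord_ring - J. s * f \<in> coord_ring)"
    using place_of_prime_ideal[OF K R coord_ring_gens(1) J(1) r(3) poly_z_nz[OF r(1,2)]
      fraction_coord_ring local_uniformiser[OF J(1) r]] by blast
  have "v \<noteq> Pinf" using v(2) coord_ring_gens(2) Pinf_x by fastforce
  then have "0 \<le> v f" using f[OF v(1)] place_zero[OF v(1)] by (auto simp: val_ge_def)
  then obtain s where s: "s \<in> coord_ring - J" "s * f \<in> coord_ring" using v(3) by blast
  then have "s \<in> I" by (simp add: I_def)
  then show False using J(2) s(1) by blast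
qed

subsection \<open>Expansions with pairwise distinct valuations\<close>

text \<open>
  The number \<open>e\<close> is a possible ramification that still has to be excluded: all values at \<open>v\<close> turn out to be
  multiples of \<open>e\<close>, and since places are normalised, this forces \<open>e = 1\<close> (\<open>separating_normalised\<close>).
\<close>

definition separating :: "('f \<Rightarrow> int) \<Rightarrow> int \<Rightarrow> bool" where
  "separating v e \<longleftrightarrow> place K v \<and> 0 < e \<and>
     (\<forall>r\<in>polys_over K. r \<noteq> 0 \<longrightarrow> e * (int q ^ n + 1) dvd v (poly r x)) \<and>
     (\<forall>i\<in>indices. e dvd v (yz_monomial i)) \<and>
     (\<forall>i\<in>indices. \<forall>j\<in>indices.
        e * (int q ^ n + 1) dvd v (yz_monomial i) - v (yz_monomial j) \<longrightarrow> i = j)"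

lemma yz_monomial_nz: "yz_monomial i \<noteq> 0"
  by (simp add: yz_monomial_def y_nz z_nz)

lemma place_yz_monomial:
  assumes v: "place K v"
  shows "v (yz_monomial i) = int (snd i) * v y + int (fst i) * v z"
  by (simp add: yz_monomial_def place_mult[OF v] place_power[OF v] y_nz z_nz)

lemma coord_ring_expansion:
  assumes "f \<in> coord_ring"
  obtains g where "\<forall>i\<in>indices. g i \<in> polys_over K"
    "f = (\<Sum>i\<in>indices. poly (g i) x * yz_monomial i)"
proof -
  obtain h where h: "\<And>i. i \<in> indices \<Longrightarrow> h i \<in> polys_x" "f = (\<Sum>i\<in>indices. h i * yz_monomial i)"
    using coord_ring_subset_span_yz assms by (blast elim: lin_spanE)
  then have "\<forall>i\<in>indices. \<exists>r. r \<in> polys_over K \<and> h i = poly r x" unfolding polys_x_def by blast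
  then obtain g where g: "\<forall>i\<in>indices. g i \<in> polys_over K \<and> h i = poly (g i) x"
    using bchoice by metis
  then have "f = (\<Sum>i\<in>indices. poly (g i) x * yz_monomial i)" unfolding h(2) by (intro sum.cong) auto
  then show ?thesis using that g by blast
qed

text \<open>
  Two terms of the expansion with the same value at \<open>v\<close> would come from monomials that agree modulo
  \<open>e N\<close>, hence from the same monomial.
\<close>

lemma separating_expansion:
  assumes v: "separating v e" and g: "\<forall>i\<in>indices. g i \<in> polys_over K"
    and f: "f = (\<Sum>i\<in>indices. poly (g i) x * yz_monomial i)" "f \<noteq> 0"
  shows "\<exists>i\<in>indices. g i \<noteq> 0 \<and> v f = v (poly (g i) x) + v (yz_monomial i)"
    and "\<And>i. i \<in> indices \<Longrightarrow> g i \<noteq> 0 \<Longrightarrow> v f \<le> v (poly (g i) x) + v (yz_monomial i)"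
proof -
  define t where "t i = poly (g i) x * yz_monomial i" for i
  have pl: "place K v" using v by (simp add: separating_def)
  have t0: "t i \<noteq> 0 \<longleftrightarrow> g i \<noteq> 0" if "i \<in> indices" for i
    using poly_x_nz[OF bspec[OF g that]] by (auto simp: t_def yz_monomial_nz)
  have vt: "v (t i) = v (poly (g i) x) + v (yz_monomial i)" if "i \<in> indices" "g i \<noteq> 0" for i
    unfolding t_def using poly_x_nz[OF bspec[OF g that(1)] that(2)] by (intro place_mult[OF pl] yz_monomial_nz)
  have dist1: "i = j"
    if "i \<in> indices" "j \<in> indices" "t i \<noteq> 0" "t j \<noteq> 0" "v (t i) = v (t j)" for i j
  proof -
    have "g i \<noteq> 0" "g j \<noteq> 0" using t0 that by auto
    then have "v (yz_monomial i) - v (yz_monomial j) = v (poly (g j) x) - v (poly (g i) x)"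
      using vt that by simp
    also have "e * (int q ^ n + 1) dvd \<dots>"
      using v g that \<open>g i \<noteq> 0\<close> \<open>g j \<noteq> 0\<close> unfolding separating_def by (intro dvd_diff) auto
    finally show ?thesis using v that unfolding separating_def by blast
  qed
  then have dist: "\<forall>i\<in>indices. \<forall>j\<in>indices. t i \<noteq> 0 \<longrightarrow> t j \<noteq> 0 \<longrightarrow> v (t i) = v (t j) \<longrightarrow> i = j"
    by blast
  have fs: "f = sum t indices" unfolding f t_def ..
  have "\<exists>i\<in>indices. t i \<noteq> 0"
  proof (rule ccontr)
    assume "\<not> (\<exists>i\<in>indices. t i \<noteq> 0)"
    then have "sum t indices = 0" by (intro sum.neutral) blast
    then show False using f(2) fs by simp
  qed
  note sums = place_sum_distinct[OF pl finite_indices dist this]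
  show "\<exists>i\<in>indices. g i \<noteq> 0 \<and> v f = v (poly (g i) x) + v (yz_monomial i)"
    using sums(2) t0 vt unfolding fs by metis
  show "v f \<le> v (poly (g i) x) + v (yz_monomial i)" if "i \<in> indices" "g i \<noteq> 0" for i
    using sums(3)[OF that(1)] t0[OF that(1)] vt[OF that] that(2) unfolding fs by (auto simp: val_ge_def)
qed

lemma separating_dvd:
  assumes v: "separating v e" and f: "f \<noteq> 0"
  shows "e dvd v f"
proof -
  have pl: "place K v" using v by (simp add: separating_def)
  have coord: "e dvd v h" if "h \<in> coord_ring" "h \<noteq> 0" for h
  proof -
    obtain g where g: "\<forall>i\<in>indices. g i \<in> polys_over K"
      "h = (\<Sum>i\<in>indices. poly (g i) x * yz_monomial i)" using coord_ring_expansion[OF \<open>h \<in> _\<close>] by blast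
    obtain i where "i \<in> indices" "g i \<noteq> 0" "v h = v (poly (g i) x) + v (yz_monomial i)"
      using separating_expansion(1)[OF v g \<open>h \<noteq> 0\<close>] by blast
    moreover from this have "e dvd v (poly (g i) x)"
      using v g(1) unfolding separating_def by (metis dvd_mult_left)
    ultimately show ?thesis using v unfolding separating_def by (metis dvd_add)
  qed
  obtain a b where ab: "a \<in> coord_ring" "b \<in> coord_ring" "b \<noteq> 0" "f * b = a"
    using fraction_coord_ring by blast
  then have "a \<noteq> 0" using f by auto
  have "v a = v f + v b" using place_mult[OF pl f ab(3)] ab(4) by simp
  then have "v f = v a - v b" by simp
  then show ?thesis using coord ab \<open>a \<noteq> 0\<close> by (simp add: dvd_diff)
qed

lemma separating_normalised:
  assumes v: "separating v e"
  shows "e = 1"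
proof -
  obtain f where "f \<noteq> 0" "v f = 1" using v unfolding separating_def place_def by blast
  then have "e dvd 1" using separating_dvd[OF v] by metis
  then show ?thesis using v by (simp add: separating_def)
qed

lemma N_eq: "int q ^ n + 1 = int M * (int q + 1)"
proof -
  have "int (q ^ n + 1) = int (M * (q + 1))" by (simp only: M)
  then show ?thesis by (simp only: of_nat_add of_nat_mult of_nat_power of_nat_1)
qed

lemma coprime_M_dq2: "coprime (int M) (int (d * q ^ 2))"
proof -
  have "coprime M d" by (rule coprime_divisors[OF dvd_refl d coprime_M_q])
  then have "coprime M (d * q ^ 2)" using coprime_M_q by simp
  then show ?thesis by (simp only: coprime_int_iff)
qed

text \<open>
  Up to a common factor \<open>e\<close>, the values follow from the two equations and the coprimality of \<open>q + 1\<close>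
  with \<open>d\<close> and of \<open>M\<close> with \<open>d q\<^sup>2\<close>. Modulo \<open>M\<close> the value of \<open>y\<^sup>B z\<^sup>A\<close> determines \<open>A\<close>, and then modulo
  \<open>q + 1\<close> it determines \<open>B\<close>.
\<close>

lemma Pinf_values:
  shows "Pinf x = - (int q ^ n + 1)" "Pinf y = - int (d * M)" "Pinf z = - int (d * q ^ 2)"
    and "separating Pinf 1"
proof -
  note v = Pinf_place
  have "int (q + 1) dvd int d * Pinf x" using place_pole(1)[OF v Pinf_x] by (metis dvd_triv_left)
  moreover have "coprime (int (q + 1)) (int d)"
    using coprime_d_q1 by (simp only: coprime_int_iff coprime_commute)
  ultimately have "int (q + 1) dvd Pinf x" by (simp only: coprime_dvd_mult_right_iff)
  then obtain s where s: "Pinf x = int (q + 1) * s" by blast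
  have y: "Pinf y = int d * s"
    using place_pole(1)[OF v Pinf_x] unfolding s by simp
  have Mz: "int M * Pinf z = int (d * q ^ 2) * s"
    using place_pole(2)[OF v Pinf_x] unfolding y by (simp add: mult_ac)
  then have "int M dvd int (d * q ^ 2) * s" by (metis dvd_triv_left)
  then have "int M dvd s" using coprime_M_dq2 by (simp only: coprime_dvd_mult_right_iff)
  then obtain s' where s': "s = int M * s'" by blast
  define e where "e = - s'"
  have x_e: "Pinf x = - (e * (int q ^ n + 1))" unfolding N_eq s s' e_def by (simp add: algebra_simps)
  have y_e: "Pinf y = - (e * int (d * M))" unfolding y s' e_def by (simp add: algebra_simps)
  have z_e: "Pinf z = - (e * int (d * q ^ 2))" using Mz M_pos unfolding s' e_def by (simp add: algebra_simps)
  have N_pos: "0 < int q ^ n + 1" by (simp add: add_nonneg_pos)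
  have "0 < e * (int q ^ n + 1)" using Pinf_x x_e by simp
  then have e: "0 < e" using N_pos by (simp add: zero_less_mult_iff)
  have sep: "separating Pinf e"
    unfolding separating_def
  proof (intro conjI ballI impI)
    show "place K Pinf" "0 < e" by fact+
    show "e * (int q ^ n + 1) dvd Pinf (poly r x)" if "r \<in> polys_over K" "r \<noteq> 0" for r
      using place_poly_at_pole[OF v Pinf_x that] by (simp add: x_e)
    show "e dvd Pinf (yz_monomial i)" for i
      unfolding place_yz_monomial[OF v] y_e z_e by simp
    fix i j assume ij: "i \<in> indices" "j \<in> indices"
      "e * (int q ^ n + 1) dvd Pinf (yz_monomial i) - Pinf (yz_monomial j)"
    obtain A B A' B' where AB: "i = (A, B)" "j = (A', B')" "A < M" "A' < M" "B \<le> q" "B' \<le> q"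
      using ij by (auto simp: indices_def)
    define D where "D = (int B' - int B) * int (d * M) + (int A' - int A) * int (d * q ^ 2)"
    have "Pinf (yz_monomial i) - Pinf (yz_monomial j) = e * D"
      unfolding place_yz_monomial[OF v] y_e z_e AB D_def by (simp add: algebra_simps)
    then have D: "int M * (int q + 1) dvd D" using ij(3) e by (simp flip: N_eq)
    then have "int M dvd D" by (rule dvd_mult_left)
    moreover have "int M dvd (int B' - int B) * int (d * M)" by simp
    ultimately have "int M dvd (int A' - int A) * int (d * q ^ 2)"
      unfolding D_def by (metis dvd_add_right_iff)
    then have "int M dvd int A' - int A" using coprime_M_dq2 by (simp only: coprime_dvd_mult_left_iff)
    then have A: "A = A'" using AB dvd_imp_le_int[of "int A' - int A" "int M"] by fastforce
    have "int M * (int q + 1) dvd int M * ((int B' - int B) * int d)"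
      using D unfolding D_def A by (simp add: mult_ac)
    then have "int q + 1 dvd (int B' - int B) * int d" using M_pos by simp
    then have "int (q + 1) dvd (int B' - int B) * int d" by (simp only: of_nat_add of_nat_1)
    moreover have "coprime (int (q + 1)) (int d)" by fact
    ultimately have "int (q + 1) dvd int B' - int B" by (simp only: coprime_dvd_mult_left_iff)
    then have "B = B'" using AB dvd_imp_le_int[of "int B' - int B" "int (q + 1)"] by fastforce
    then show "i = j" using A AB by simp
  qed
  then have "e = 1" by (rule separating_normalised)
  then show "Pinf x = - (int q ^ n + 1)" "Pinf y = - int (d * M)" "Pinf z = - int (d * q ^ 2)"
    "separating Pinf 1" using x_e y_e z_e sep by simp_all
qed

text \<open>
  As \<open>0\<close> is a simple root of \<open>T\<close>, the value of \<open>T(x) = T(x - \<alpha>)\<close> is that of \<open>x - \<alpha>\<close>; as \<open>y\<close> is a simple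
  factor of \<open>y\<^sup>Q - y\<close> with \<open>Q = q\<^sup>2\<close>, the value of \<open>z\<^sup>M\<close> is that of \<open>y\<close>. The values \<open>A + B M\<close> of the monomials run
  through the residues modulo \<open>N\<close>.
\<close>

lemma base_point_values:
  assumes v: "place K v" and \<alpha>: "\<alpha> \<in> K" and x: "val_ge v (x - \<alpha>) 1" and y: "val_ge v y 1"
  shows "poly T \<alpha> = 0" "v (x - \<alpha>) = int q ^ n + 1" "v y = int M" "v z = 1" "separating v 1"
proof -
  have vy: "0 < v y" using y y_nz by (simp add: val_ge_def)
  have "0 < int (q + 1) * v y" using vy by (simp only: zero_less_mult_iff) simp
  then have yT: "val_ge v (poly T x) 1" using place_y_power[OF v] by (simp add: val_ge_def flip: y_power)
  have "val_ge v (poly T x - (poly T x - poly T \<alpha>)) 1"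
    by (intro val_ge_diff[OF v] yT poly_minus_value[OF subring_K v \<alpha> x T(1)])
  moreover have "v (poly T \<alpha>) = 0"
    using poly_in_subring[OF subring_K _ \<alpha> T(1)] by (intro place_const[OF v]) blast
  ultimately show T\<alpha>: "poly T \<alpha> = 0" by (simp add: val_ge_def)
  have x\<alpha>: "x - \<alpha> \<noteq> 0" using x_notin_K \<alpha> by auto
  then have vx: "0 < v (x - \<alpha>)" using x by (simp add: val_ge_def)
  have "T \<noteq> 0" using T(2) by auto
  then have "v (poly T (x - \<alpha>)) = v (x - \<alpha>)"
    using place_poly_at_zero[OF subring_K v subring_0[OF subring_K], of "x - \<alpha>" T] vx T by auto
  then have xy: "int (q + 1) * v y = v (x - \<alpha>)"
    using place_y_power[OF v] unfolding y_power T_diff T\<alpha> by simp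
  have "val_ge v (y ^ (q ^ 2)) (v (- y) + 1)"
  proof -
    have "2 \<le> int (q ^ 2)" using q2 by linarith
    then have "2 * v y \<le> int (q ^ 2) * v y" using vy by (intro mult_right_mono) auto
    then have "v (- y) + 1 \<le> v (y ^ (q ^ 2))"
      unfolding place_uminus[OF v] place_power[OF v y_nz] using vy by linarith
    then show ?thesis by (simp add: val_ge_def)
  qed
  from place_add_dominant(2)[OF v _ this] y_nz have "v (z ^ M) = v y"
    by (simp add: z_power place_uminus[OF v])
  then have zM: "v y = int M * v z" by (simp add: place_power[OF v z_nz])
  define e where "e = v z"
  have "0 < int M * e" using vy zM by (simp add: e_def)
  then have e: "0 < e" using M_pos by (simp add: zero_less_mult_iff)
  have y_e: "v y = e * int M" unfolding zM e_def by simp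
  have x_e: "v (x - \<alpha>) = e * (int q ^ n + 1)" unfolding N_eq xy[symmetric] y_e by (simp add: algebra_simps)
  have sep: "separating v e"
    unfolding separating_def
  proof (intro conjI ballI impI)
    show "place K v" "0 < e" by fact+
    show "e * (int q ^ n + 1) dvd v (poly r x)" if "r \<in> polys_over K" "r \<noteq> 0" for r
      using place_poly_at_zero[OF subring_K v \<alpha> vx that] by (simp add: x_e)
    show "e dvd v (yz_monomial i)" for i
      unfolding place_yz_monomial[OF v] y_e e_def by simp
    fix i j assume ij: "i \<in> indices" "j \<in> indices"
      "e * (int q ^ n + 1) dvd v (yz_monomial i) - v (yz_monomial j)"
    obtain A B A' B' where AB: "i = (A, B)" "j = (A', B')" "A < M" "A' < M" "B \<le> q" "B' \<le> q"
      using ij by (auto simp: indices_def)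
    define D where "D = (int B - int B') * int M + (int A - int A')"
    have "v (yz_monomial i) - v (yz_monomial j) = e * D"
      unfolding place_yz_monomial[OF v] y_e AB D_def e_def by (simp add: algebra_simps)
    then have D: "int M * (int q + 1) dvd D" using ij(3) e by (simp flip: N_eq)
    then have "int M dvd D" by (rule dvd_mult_left)
    moreover have "int M dvd (int B - int B') * int M" by simp
    ultimately have "int M dvd int A - int A'"
      unfolding D_def by (metis dvd_add_right_iff)
    then have A: "A = A'" using AB dvd_imp_le_int[of "int A - int A'" "int M"] by fastforce
    have "int M * (int q + 1) dvd int M * (int B - int B')"
      using D unfolding D_def A by (simp add: mult_ac)
    then have "int q + 1 dvd int B - int B'" using M_pos by simp
    then have "int (q + 1) dvd int B - int B'" by (simp only: of_nat_add of_nat_1)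
    then have "B = B'" using AB dvd_imp_le_int[of "int B - int B'" "int (q + 1)"] by fastforce
    then show "i = j" using A AB by simp
  qed
  then have e1: "e = 1" by (rule separating_normalised)
  then show "v (x - \<alpha>) = int q ^ n + 1" "v y = int M" "v z = 1" "separating v 1"
    using x_e y_e sep by (simp_all add: e_def)
qed

text \<open>
  The expansion computes all values at a base point from \<open>\<alpha>\<close> alone.
\<close>

lemma base_point_unique:
  assumes v: "place K v" "val_ge v (x - \<alpha>) 1" "val_ge v y 1"
    and w: "place K w" "val_ge w (x - \<alpha>) 1" "val_ge w y 1" and \<alpha>: "\<alpha> \<in> K"
  shows "v = w"
proof
  fix f
  note valv = base_point_values[OF v(1) \<alpha> v(2,3)] and valw = base_point_values[OF w(1) \<alpha> w(2,3)]
  have poly: "v (poly r x) = w (poly r x)" if "r \<in> polys_over K" "r \<noteq> 0" for r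
    using place_poly_at_zero[OF subring_K v(1) \<alpha> _ that] place_poly_at_zero[OF subring_K w(1) \<alpha> _ that]
      valv(2) valw(2) by (simp add: add_nonneg_pos)
  have mono: "v (yz_monomial i) = w (yz_monomial i)" for i
    using valv valw by (simp add: place_yz_monomial[OF v(1)] place_yz_monomial[OF w(1)])
  have coord: "v h = w h" if "h \<in> coord_ring" "h \<noteq> 0" for h
  proof -
    obtain g where g: "\<forall>i\<in>indices. g i \<in> polys_over K"
      "h = (\<Sum>i\<in>indices. poly (g i) x * yz_monomial i)" using coord_ring_expansion[OF \<open>h \<in> _\<close>] by blast
    note ev = separating_expansion[OF valv(5) g \<open>h \<noteq> 0\<close>] and ew = separating_expansion[OF valw(5) g \<open>h \<noteq> 0\<close>]
    obtain i where i: "i \<in> indices" "g i \<noteq> 0" "v h = v (poly (g i) x) + v (yz_monomial i)"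
      using ev(1) by blast
    obtain j where j: "j \<in> indices" "g j \<noteq> 0" "w h = w (poly (g j) x) + w (yz_monomial j)"
      using ew(1) by blast
    show ?thesis using i j ev(2)[OF j(1,2)] ew(2)[OF i(1,2)] poly g(1) mono by simp
  qed
  show "v f = w f"
  proof (cases "f = 0")
    case True
    then show ?thesis using place_zero v(1) w(1) by metis
  next
    case False
    obtain a b where ab: "a \<in> coord_ring" "b \<in> coord_ring" "b \<noteq> 0" "f * b = a"
      using fraction_coord_ring by blast
    then have "a \<noteq> 0" using False by auto
    have "v a = v f + v b" "w a = w f + w b"
      using place_mult[OF v(1) False ab(3)] place_mult[OF w(1) False ab(3)] ab(4) by simp_all
    then show ?thesis using coord ab \<open>a \<noteq> 0\<close> by simp
  qed
qed

lemma affine_zero_is_base_point: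
  assumes v: "place K v" and \<alpha>: "\<alpha> \<in> K" "poly T \<alpha> = 0" and x: "val_ge v (x - \<alpha>) 1"
  shows "val_ge v y 1"
proof -
  have "val_ge v (c * y ^ (q + 1)) 1"
    using poly_minus_value[OF subring_K v \<alpha>(1) x T(1)] \<alpha>(2) by (simp only: y_power) simp
  then have "1 \<le> int (q + 1) * v y"
    using c y_nz unfolding place_y_power[OF v, symmetric] by (simp add: val_ge_def)
  then have "0 < int (q + 1) * v y" by linarith
  then show ?thesis unfolding zero_less_mult_iff by (auto simp: val_ge_def)
qed

end

section \<open>The Weierstrass semigroup\<close>

lemma pole_divisor_eq_iff:
  assumes distinct: "distinct R" and places: "\<forall>v\<in>set R. place K v"
  shows "pole_divisor K f = divisor_of R ns \<longleftrightarrow>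
    (\<forall>l<length R. nat (- (R ! l) f) = ns ! l) \<and> (\<forall>v. place K v \<longrightarrow> v \<notin> set R \<longrightarrow> 0 \<le> v f)"
proof -
  have at: "divisor_of R ns (R ! l) = ns ! l" if "l < length R" for l
  proof -
    have "divisor_of R ns (R ! l) = (\<Sum>i<length R. if i = l then ns ! i else 0)"
      unfolding divisor_of_def using distinct that
      by (intro sum.cong refl) (simp add: nth_eq_iff_index_eq)
    then show ?thesis using that by simp
  qed
  have off: "divisor_of R ns v = 0" if "v \<notin> set R" for v
    unfolding divisor_of_def using that by (auto intro!: sum.neutral)
  show ?thesis
  proof (intro iffI conjI allI impI)
    assume eq: "pole_divisor K f = divisor_of R ns"
    show "nat (- (R ! l) f) = ns ! l" if "l < length R" for l
      using fun_cong[OF eq, of "R ! l"] at[OF that] places that by (simp add: pole_divisor_def)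
    show "0 \<le> v f" if "place K v" "v \<notin> set R" for v
      using fun_cong[OF eq, of v] off[OF that(2)] that(1) by (simp add: pole_divisor_def)
  next
    assume *: "(\<forall>l<length R. nat (- (R ! l) f) = ns ! l) \<and> (\<forall>v. place K v \<longrightarrow> v \<notin> set R \<longrightarrow> 0 \<le> v f)"
    show "pole_divisor K f = divisor_of R ns"
    proof
      fix v
      show "pole_divisor K f v = divisor_of R ns v"
      proof (cases "v \<in> set R")
        case True
        then obtain l where "l < length R" "v = R ! l" by (auto simp: in_set_conv_nth)
        then show ?thesis using * at places True by (auto simp: pole_divisor_def)
      next
        case False
        then show ?thesis using * off by (auto simp: pole_divisor_def)
      qed
    qed
  qed
qed

locale curve_points = curve_model K x y z c T p a n q d M Pinf
  for K :: "'f::field set" and x y z c :: 'f and T :: "'f poly" and p a n q d M :: nat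
    and Pinf :: "'f \<Rightarrow> int" +
  fixes P :: "nat \<Rightarrow> 'f \<Rightarrow> int" and \<alpha> :: "nat \<Rightarrow> 'f" and m :: nat
  assumes P_place: "\<And>l. l \<in> {1..m} \<Longrightarrow> place K (P l)"
    and \<alpha>: "\<And>l. l \<in> {1..m} \<Longrightarrow> \<alpha> l \<in> K"
    and P_x: "\<And>l. l \<in> {1..m} \<Longrightarrow> val_ge (P l) (x - \<alpha> l) 1"
    and P_y: "\<And>l. l \<in> {1..m} \<Longrightarrow> val_ge (P l) y 1"
    and P_inj: "inj_on P {1..m}"
    and m: "1 \<le> m"
begin

definition N :: int where "N = int q ^ n + 1"

lemma N_pos: "0 < N"
  by (simp add: N_def add_nonneg_pos)

lemma P_values:
  assumes l: "l \<in> {1..m}"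
  shows "poly T (\<alpha> l) = 0" "P l (x - \<alpha> l) = N" "P l y = int M" "P l z = 1" "separating (P l) 1"
  using base_point_values[OF P_place[OF l] \<alpha>[OF l] P_x[OF l] P_y[OF l]] by (simp_all add: N_def)

lemma \<alpha>_inj: "inj_on \<alpha> {1..m}"
proof (rule inj_onI)
  fix l l' assume l: "l \<in> {1..m}" "l' \<in> {1..m}" "\<alpha> l = \<alpha> l'"
  have "P l = P l'"
    using P_x[OF l(2)] l(3) by (intro base_point_unique[of _ "\<alpha> l"] P_place P_x P_y \<alpha> l) auto
  then show "l = l'" using P_inj l by (auto dest: inj_onD)
qed

lemma x_minus_\<alpha>_nz: "l \<in> {1..m} \<Longrightarrow> x - \<alpha> l \<noteq> 0"
  using x_notin_K \<alpha> by auto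

lemma Pinf_x_minus_\<alpha>: "l \<in> {1..m} \<Longrightarrow> Pinf (x - \<alpha> l) = - N"
  using place_poly_at_pole[OF Pinf_place Pinf_x, of "[:- \<alpha> l, 1:]"] \<alpha>[of l] Pinf_values(1)
  by (simp add: polys_over_pCons polys_over_0[OF subring_K] subring_1[OF subring_K]
      subring_uminus[OF subring_K] N_def)

lemma P_neq_Pinf: "l \<in> {1..m} \<Longrightarrow> P l \<noteq> Pinf"
  using P_values(2) Pinf_x_minus_\<alpha> N_pos by fastforce

lemma affine_x_minus_\<alpha>:
  assumes v: "place K v" "v \<noteq> Pinf" and l: "l \<in> {1..m}"
  shows "v (x - \<alpha> l) = (if v = P l then N else 0)"
proof (cases "v = P l")
  case False
  have "\<not> val_ge v (x - \<alpha> l) 1"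
  proof
    assume x: "val_ge v (x - \<alpha> l) 1"
    then have "val_ge v y 1" by (rule affine_zero_is_base_point[OF v(1) \<alpha>[OF l] P_values(1)[OF l]])
    then have "v = P l"
      by (intro base_point_unique[OF v(1) x _ P_place[OF l] P_x[OF l] P_y[OF l] \<alpha>[OF l]])
    then show False using False by simp
  qed
  moreover have "val_ge v (x - \<alpha> l) 0"
    by (intro val_ge_diff[OF v(1)] place_affine[OF v] val_ge_const[OF v(1) \<alpha>[OF l]])
  ultimately show ?thesis using False by (auto simp: val_ge_def)
qed (use P_values(2)[OF l] in simp)

text \<open>
  The pole and the \<open>P\<^sub>l\<close> are treated uniformly, with index \<open>0\<close> for the pole as in the tuples.
\<close>

definition pt :: "nat \<Rightarrow> 'f \<Rightarrow> int" where
  "pt l = (if l = 0 then Pinf else P l)"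

definition points :: "('f \<Rightarrow> int) list" where
  "points = map pt [0..<Suc m]"

lemma points_eq: "points = Pinf # map P [1..<Suc m]"
proof -
  have "map pt [1..<Suc m] = map P [1..<Suc m]" by (intro map_cong) (auto simp: pt_def)
  moreover have "[0..<Suc m] = 0 # [1..<Suc m]" by (simp add: upt_conv_Cons del: upt_Suc)
  ultimately show ?thesis by (simp add: points_def pt_def del: upt_Suc)
qed

lemma length_points: "length points = Suc m"
  by (simp add: points_def)

lemma points_nth: "l \<le> m \<Longrightarrow> points ! l = pt l"
  unfolding points_def by (subst nth_map) (auto simp del: upt_Suc)

lemma pt_place: "l \<le> m \<Longrightarrow> place K (pt l)"
  using Pinf_place P_place by (auto simp: pt_def)

lemma distinct_points: "distinct points"
proof -
  have "inj_on pt {0..<Suc m}"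
  proof (rule inj_onI)
    fix l l' assume l: "l \<in> {0..<Suc m}" "l' \<in> {0..<Suc m}" "pt l = pt l'"
    have "l = l'" if "l \<noteq> 0" "l' \<noteq> 0"
      using l that P_inj by (auto simp: pt_def dest: inj_onD)
    moreover have "l = 0 \<longleftrightarrow> l' = 0"
      using l P_neq_Pinf[of l] P_neq_Pinf[of l'] by (auto simp: pt_def split: if_splits)
    ultimately show "l = l'" by blast
  qed
  then show ?thesis by (simp add: points_def distinct_map del: upt_Suc)
qed

lemma set_points: "set points = insert Pinf (P ` {1..m})"
  unfolding points_eq by (auto simp del: upt_Suc)

lemma semigroup_iff:
  "ns \<in> weierstrass_semigroup K points \<longleftrightarrow> length ns = Suc m \<and>
    (\<exists>f. f \<noteq> 0 \<and> (\<forall>l\<le>m. nat (- pt l f) = ns ! l) \<and>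
      (\<forall>v. place K v \<longrightarrow> v \<noteq> Pinf \<longrightarrow> v \<notin> P ` {1..m} \<longrightarrow> 0 \<le> v f))"
proof -
  have "\<forall>v\<in>set points. place K v" using Pinf_place P_place by (auto simp: set_points)
  from pole_divisor_eq_iff[OF distinct_points this]
  show ?thesis
    unfolding weierstrass_semigroup_def length_points less_Suc_eq_le set_points
    by (auto simp: points_nth)
qed

text \<open>
  The pole orders of a term \<open>r(x) y\<^sup>B z\<^sup>A\<close>, where \<open>r\<close> has a pole of order \<open>e\<^sub>l\<close> at \<open>\<alpha>\<^sub>l\<close> and of order \<open>\<delta>\<close>
  at infinity. Negative entries stand for zeros.
\<close>

definition pole_order :: "nat \<Rightarrow> nat \<Rightarrow> (nat \<Rightarrow> int) \<Rightarrow> int \<Rightarrow> nat \<Rightarrow> int" where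
  "pole_order A B e \<delta> l =
     (if l = 0 then N * \<delta> + int B * int (d * M) + int A * int (d * q ^ 2)
      else N * e l - int B * int M - int A)"

text \<open>
  The function \<open>\<Prod> (x - \<alpha>\<^sub>l)\<^sup>-\<^sup>e\<^sup>l y\<^sup>B z\<^sup>A\<close> has no further poles, since the only zero of \<open>x - \<alpha>\<^sub>l\<close> is \<open>P\<^sub>l\<close>.
\<close>

lemma monomial_in_semigroup:
  assumes l: "A < M" "B \<le> q"
  shows "map (\<lambda>l. nat (pole_order A B e (- sum e {1..m}) l)) [0..<Suc m] \<in> weierstrass_semigroup K points"
proof -
  define D where "D = (\<Prod>l\<in>{1..m}. (x - \<alpha> l) powi (- e l))"
  define f where "f = D * yz_monomial (A, B)"
  have fac: "(x - \<alpha> l) powi (- e l) \<noteq> 0" if "l \<in> {1..m}" for l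
    using x_minus_\<alpha>_nz[OF that] by simp
  then have "D \<noteq> 0" unfolding D_def by simp
  then have "f \<noteq> 0" by (simp add: f_def yz_monomial_nz)
  have vf: "v f = (\<Sum>l\<in>{1..m}. - e l * v (x - \<alpha> l)) + int B * v y + int A * v z" if v: "place K v" for v
  proof -
    have "v D = (\<Sum>l\<in>{1..m}. v ((x - \<alpha> l) powi (- e l)))"
      unfolding D_def by (rule place_prod[OF v fac])
    also have "\<dots> = (\<Sum>l\<in>{1..m}. - e l * v (x - \<alpha> l))"
      by (intro sum.cong refl place_power_int[OF v] x_minus_\<alpha>_nz)
    finally show ?thesis
      unfolding f_def place_mult[OF v \<open>D \<noteq> 0\<close> yz_monomial_nz] by (simp add: place_yz_monomial[OF v])
  qed
  have "Pinf f = - pole_order A B e (- sum e {1..m}) 0"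
    unfolding vf[OF Pinf_place] Pinf_values(2,3) pole_order_def
    by (simp add: Pinf_x_minus_\<alpha> sum_distrib_left sum_negf algebra_simps)
  moreover have "P l f = - pole_order A B e (- sum e {1..m}) l" if l: "l \<in> {1..m}" for l
  proof -
    have "(\<Sum>l'\<in>{1..m}. - e l' * P l (x - \<alpha> l')) = (\<Sum>l'\<in>{1..m}. if l' = l then - e l * N else 0)"
    proof (intro sum.cong refl)
      fix l' assume l': "l' \<in> {1..m}"
      have "P l = P l' \<longleftrightarrow> l = l'" using P_inj l l' by (auto dest: inj_onD)
      then show "- e l' * P l (x - \<alpha> l') = (if l' = l then - e l * N else 0)"
        using affine_x_minus_\<alpha>[OF P_place[OF l] P_neq_Pinf[OF l] l'] by auto
    qed
    also have "\<dots> = - e l * N" using l by simp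
    finally show ?thesis
      using l unfolding vf[OF P_place[OF l]] P_values(3,4)[OF l] pole_order_def by (simp add: algebra_simps)
  qed
  ultimately have at: "nat (- pt l f) = nat (pole_order A B e (- sum e {1..m}) l)" if "l \<le> m" for l
    using that by (auto simp: pt_def)
  have other: "0 \<le> v f" if v: "place K v" "v \<noteq> Pinf" "v \<notin> P ` {1..m}" for v
  proof -
    have "(\<Sum>l\<in>{1..m}. - e l * v (x - \<alpha> l)) = 0"
      using v by (intro sum.neutral) (auto simp: affine_x_minus_\<alpha>)
    moreover have "0 \<le> v y" "0 \<le> v z" using place_affine[OF v(1,2)] y_nz z_nz by (auto simp: val_ge_def)
    ultimately show ?thesis unfolding vf[OF v(1)] by simp
  qed
  show ?thesis
    unfolding semigroup_iff using \<open>f \<noteq> 0\<close> at other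
    by (auto simp del: upt_Suc intro!: exI[of _ f])
qed

text \<open>
  A prescribed positive entry of a tuple in the semigroup is attained by one term of the expansion of
  a function with that pole divisor, and this term has no larger pole anywhere. The inequality between
  \<open>\<delta>\<close> and the \<open>e\<^sub>l\<close> says that the numerator of the coefficient has at least as large a degree as its
  zeros at the \<open>\<alpha>\<^sub>l\<close> demand.
\<close>

lemma semigroup_dominates_monomial:
  assumes ns: "ns \<in> weierstrass_semigroup K points" and l0: "l0 \<le> m" "0 < ns ! l0"
  obtains A B e \<delta> where "A < M" "B \<le> q" "- sum e {1..m} \<le> \<delta>"
    "\<And>l. l \<le> m \<Longrightarrow> pole_order A B e \<delta> l \<le> int (ns ! l)" "pole_order A B e \<delta> l0 = int (ns ! l0)"
proof -
  obtain f where f: "f \<noteq> 0" "\<And>l. l \<le> m \<Longrightarrow> nat (- pt l f) = ns ! l"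
    "\<And>v. place K v \<Longrightarrow> v \<noteq> Pinf \<Longrightarrow> v \<notin> P ` {1..m} \<Longrightarrow> 0 \<le> v f"
    using ns unfolding semigroup_iff by blast
  \<comment> \<open>a single exponent large enough to clear the poles at all \<open>P\<^sub>l\<close>\<close>
  define t where "t = (\<Sum>l\<in>{1..m}. ns ! l)"
  have t: "ns ! l \<le> t" if "l \<in> {1..m}" for l
    unfolding t_def by (rule member_le_sum[OF that]) auto
  define D where "D = (\<Prod>l\<in>{1..m}. (x - \<alpha> l) ^ t)"
  have fac: "(x - \<alpha> l) ^ t \<noteq> 0" if "l \<in> {1..m}" for l
    using x_minus_\<alpha>_nz[OF that] by simp
  then have D0: "D \<noteq> 0" unfolding D_def prod_zero_iff[OF finite_atLeastAtMost] by blast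
  have vD: "v D = (\<Sum>l\<in>{1..m}. int t * v (x - \<alpha> l))" if v: "place K v" for v
  proof -
    have "v D = (\<Sum>l\<in>{1..m}. v ((x - \<alpha> l) ^ t))"
      unfolding D_def by (rule place_prod[OF v fac])
    also have "\<dots> = (\<Sum>l\<in>{1..m}. int t * v (x - \<alpha> l))"
      by (intro sum.cong refl place_power[OF v] x_minus_\<alpha>_nz)
    finally show ?thesis .
  qed
  have PD: "P l D = int t * N" if l: "l \<in> {1..m}" for l
  proof -
    have "P l D = (\<Sum>l'\<in>{1..m}. if l' = l then int t * N else 0)"
      unfolding vD[OF P_place[OF l]]
    proof (intro sum.cong refl)
      fix l' assume l': "l' \<in> {1..m}"
      have "P l = P l' \<longleftrightarrow> l = l'" using P_inj l l' by (auto dest: inj_onD)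
      then show "int t * P l (x - \<alpha> l') = (if l' = l then int t * N else 0)"
        using affine_x_minus_\<alpha>[OF P_place[OF l] P_neq_Pinf[OF l] l'] by auto
    qed
    then show ?thesis using l by simp
  qed
  have PinfD: "Pinf D = - (int m * int t * N)"
    unfolding vD[OF Pinf_place] by (simp add: Pinf_x_minus_\<alpha>)
  have fD0: "f * D \<noteq> 0" using f(1) D0 by simp
  have vfD: "v (f * D) = v f + v D" if "place K v" for v
    by (rule place_mult[OF that f(1) D0])
  have "f * D \<in> coord_ring"
  proof (rule coord_ring_integrally_closed)
    fix v assume v: "place K v" "v \<noteq> Pinf"
    have "0 \<le> v f + v D"
    proof (cases "v \<in> P ` {1..m}")
      case True
      then obtain l where l: "l \<in> {1..m}" "v = P l" by blast
      have "- P l f \<le> int t" using f(2)[of l] t[OF l(1)] l(1) by (auto simp: pt_def)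
      also have "\<dots> \<le> int t * N" using N_pos by (simp add: mult_le_cancel_left1)
      finally show ?thesis using PD[OF l(1)] l(2) by simp
    next
      case False
      moreover have "v D = 0" unfolding vD[OF v(1)]
        using v False by (intro sum.neutral) (auto simp: affine_x_minus_\<alpha>)
      ultimately show ?thesis using f(3)[OF v] by simp
    qed
    then show "val_ge v (f * D) 0" using vfD[OF v(1)] by (simp add: val_ge_def)
  qed
  then obtain g where g: "\<forall>i\<in>indices. g i \<in> polys_over K"
    "f * D = (\<Sum>i\<in>indices. poly (g i) x * yz_monomial i)" using coord_ring_expansion by blast
  have sep: "separating (pt l) 1" if "l \<le> m" for l
    using that Pinf_values(4) P_values(5) by (auto simp: pt_def)
  obtain i where i: "i \<in> indices" "g i \<noteq> 0"
    "pt l0 (f * D) = pt l0 (poly (g i) x) + pt l0 (yz_monomial i)"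
    using separating_expansion(1)[OF sep[OF l0(1)] g fD0] by blast
  have le: "pt l (f * D) \<le> pt l (poly (g i) x) + pt l (yz_monomial i)" if "l \<le> m" for l
    by (rule separating_expansion(2)[OF sep[OF that] g fD0 i(1,2)])
  obtain A B where AB: "i = (A, B)" "A < M" "B \<le> q" using i(1) by (auto simp: indices_def)
  have gK: "g i \<in> polys_over K" using g i by blast
  define e where "e l = int t - int (order (\<alpha> l) (g i))" for l
  define \<delta> where "\<delta> = int (degree (g i)) - int m * int t"
  have "(\<Sum>l\<in>{1..m}. order (\<alpha> l) (g i)) = (\<Sum>u\<in>\<alpha> ` {1..m}. order u (g i))"
    unfolding sum.reindex[OF \<alpha>_inj] by (simp add: o_def)
  also have "\<dots> \<le> degree (g i)" by (rule sum_order_le_degree[OF i(2)]) simp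
  finally have "int (\<Sum>l\<in>{1..m}. order (\<alpha> l) (g i)) \<le> int (degree (g i))"
    by (simp only: of_nat_le_iff)
  then have "- sum e {1..m} \<le> \<delta>" unfolding e_def \<delta>_def by (simp add: sum_subtractf)
  moreover have po: "pole_order A B e \<delta> l = pt l D - pt l (poly (g i) x) - pt l (yz_monomial i)"
    if "l \<le> m" for l
  proof (cases "l = 0")
    case True
    have "Pinf (poly (g i) x) = - (int (degree (g i)) * N)"
      using place_poly_at_pole[OF Pinf_place Pinf_x gK i(2)] Pinf_values(1)
      by (simp add: N_def algebra_simps)
    then show ?thesis
      using True AB by (simp add: pt_def pole_order_def place_yz_monomial[OF Pinf_place]
          Pinf_values(2,3) PinfD \<delta>_def algebra_simps)
  next
    case False
    then have l: "l \<in> {1..m}" using that by auto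
    have "P l (poly (g i) x) = int (order (\<alpha> l) (g i)) * N"
      using place_poly_at_zero[OF subring_K P_place[OF l] \<alpha>[OF l] _ gK i(2)] P_values(2)[OF l] N_pos by simp
    then show ?thesis
      using False AB by (simp add: pt_def pole_order_def place_yz_monomial[OF P_place[OF l]]
          P_values(3,4)[OF l] PD[OF l] e_def algebra_simps)
  qed
  have fl: "pt l f = pt l (f * D) - pt l D" if "l \<le> m" for l
    using vfD[OF pt_place[OF that]] by simp
  have "pole_order A B e \<delta> l \<le> int (ns ! l)" if "l \<le> m" for l
    using po[OF that] fl[OF that] le[OF that] f(2)[OF that] by linarith
  moreover have "pole_order A B e \<delta> l0 = int (ns ! l0)"
    using po[OF l0(1)] fl[OF l0(1)] i(3) f(2)[OF l0(1)] l0(2) by linarith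
  ultimately show ?thesis using that AB by blast
qed

section \<open>The minimal generating set\<close>

lemma pole_order_0_inj:
  assumes AB: "A < M" "B \<le> q" "A' < M" "B' \<le> q"
    and eq: "pole_order A B e \<delta> 0 = pole_order A' B' e' \<delta>' 0"
  shows "A = A'" "B = B'" "\<delta> = \<delta>'"
proof -
  have "Pinf (yz_monomial (A, B)) - Pinf (yz_monomial (A', B')) = N * (\<delta> - \<delta>')"
    using eq by (simp add: pole_order_def place_yz_monomial[OF Pinf_place] Pinf_values(2,3) algebra_simps)
  then have "1 * (int q ^ n + 1) dvd Pinf (yz_monomial (A, B)) - Pinf (yz_monomial (A', B'))"
    by (simp add: N_def)
  then have "(A, B) = (A', B')"
    using Pinf_values(4) AB unfolding separating_def indices_def by blast
  then show "A = A'" "B = B'" "\<delta> = \<delta>'" using eq N_pos by (simp_all add: pole_order_def)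
qed

text \<open>
  Minimality in one entry forces the tuple of a product of powers of the \<open>x - \<alpha>\<^sub>l\<close>, \<open>y\<close> and \<open>z\<close>. Conversely
  these tuples are minimal in the entry that belongs to \<open>Pinf\<close>.
\<close>

lemma minimal_generating_set_points:
  "minimal_generating_set K points =
    {ns. \<exists>A B e. A < M \<and> B \<le> q \<and> (\<forall>l\<le>m. 0 < pole_order A B e (- sum e {1..m}) l) \<and>
      ns = map (\<lambda>l. nat (pole_order A B e (- sum e {1..m}) l)) [0..<Suc m]}" (is "?L = ?R")
proof (intro equalityI subsetI)
  fix ns assume "ns \<in> ?L"
  then obtain l0 where len: "length ns = Suc m" and pos: "\<And>l. l \<le> m \<Longrightarrow> 0 < ns ! l" and l0: "l0 \<le> m"
    and H: "ns \<in> weierstrass_semigroup K points"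
    and min: "\<And>ps. ps \<in> weierstrass_semigroup K points \<Longrightarrow> ps ! l0 = ns ! l0 \<Longrightarrow>
      list_all2 (\<le>) ps ns \<Longrightarrow> ps = ns"
    unfolding minimal_generating_set_def nabla_def length_points
    by (auto simp: less_Suc_eq_le in_set_conv_nth)
  obtain A B e \<delta> where AB: "A < M" "B \<le> q" and \<delta>: "- sum e {1..m} \<le> \<delta>"
    and le: "\<And>l. l \<le> m \<Longrightarrow> pole_order A B e \<delta> l \<le> int (ns ! l)"
    and eq: "pole_order A B e \<delta> l0 = int (ns ! l0)"
    using semigroup_dominates_monomial[OF H l0 pos[OF l0]] by blast
  \<comment> \<open>The excess \<open>\<delta> + \<Sum> e\<^sub>l\<close> is removed without changing the entry \<open>l0\<close>: from \<open>\<delta>\<close> if \<open>l0\<close> is one of the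
    points \<open>P\<^sub>l\<close>, and from \<open>e\<^sub>1\<close> if it is the pole \<open>Pinf\<close>.\<close>
  define e' where "e' = (if l0 = 0 then e(1 := e 1 - (\<delta> + sum e {1..m})) else e)"
  have sum_e': "sum e' {1..m} = sum e {1..m} - (if l0 = 0 then \<delta> + sum e {1..m} else 0)"
  proof -
    have "{1..m} = insert 1 {2..m}" using m by auto
    moreover have "sum (e(1 := u)) {2..m} = sum e {2..m}" for u by (intro sum.cong) auto
    ultimately show ?thesis unfolding e'_def by simp
  qed
  have e'_le: "e' l \<le> e l" for l using \<delta> by (auto simp: e'_def)
  define po where "po = pole_order A B e' (- sum e' {1..m})"
  have po_le: "po l \<le> pole_order A B e \<delta> l" for l
    using e'_le[of l] sum_e' \<delta> N_pos by (auto simp: po_def pole_order_def intro: mult_left_mono)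
  have po_l0: "po l0 = pole_order A B e \<delta> l0"
    using sum_e' by (auto simp: po_def pole_order_def e'_def)
  define ps where "ps = map (\<lambda>l. nat (po l)) [0..<Suc m]"
  have ps_nth: "ps ! l = nat (po l)" if "l \<le> m" for l
    unfolding ps_def using that by (subst nth_map) (auto simp del: upt_Suc)
  have len_ps: "length ps = Suc m" by (simp add: ps_def)
  have "ps = ns"
  proof (rule min)
    show "ps \<in> weierstrass_semigroup K points"
      unfolding ps_def po_def by (rule monomial_in_semigroup[OF AB])
    show "ps ! l0 = ns ! l0" using ps_nth[OF l0] po_l0 eq by simp
    show "list_all2 (\<le>) ps ns"
      unfolding list_all2_conv_all_nth
    proof (intro conjI allI impI)
      show "length ps = length ns" using len len_ps by simp
      fix l assume "l < length ps"
      then have l: "l \<le> m" using len_ps by simp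
      show "ps ! l \<le> ns ! l" using ps_nth[OF l] po_le[of l] le[OF l] by linarith
    qed
  qed
  moreover have "0 < po l" if "l \<le> m" for l
    using pos[OF that] ps_nth[OF that] \<open>ps = ns\<close> by simp
  ultimately show "ns \<in> ?R" using AB unfolding ps_def po_def by blast
next
  fix ns assume "ns \<in> ?R"
  then obtain A B e where AB: "A < M" "B \<le> q"
    and pos': "\<And>l. l \<le> m \<Longrightarrow> 0 < pole_order A B e (- sum e {1..m}) l"
    and ns: "ns = map (\<lambda>l. nat (pole_order A B e (- sum e {1..m}) l)) [0..<Suc m]" by blast
  define po where "po = pole_order A B e (- sum e {1..m})"
  have pos: "0 < po l" if "l \<le> m" for l using pos'[OF that] by (simp add: po_def)
  have ns_nth: "ns ! l = nat (po l)" if "l \<le> m" for l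
    unfolding ns po_def using that by (subst nth_map) (auto simp del: upt_Suc)
  have len: "length ns = Suc m" by (simp add: ns)
  have H: "ns \<in> weierstrass_semigroup K points"
    unfolding ns by (rule monomial_in_semigroup[OF AB])
  have min: "ps = ns"
    if ps: "ps \<in> weierstrass_semigroup K points" "ps ! 0 = ns ! 0" "list_all2 (\<le>) ps ns" for ps
  proof -
    have len_ps: "length ps = Suc m" using ps(3) len by (auto dest: list_all2_lengthD)
    have ps_le: "int (ps ! l) \<le> po l" if "l \<le> m" for l
    proof -
      have "ps ! l \<le> ns ! l" using ps(3) len_ps that by (auto simp: list_all2_conv_all_nth)
      then show ?thesis using ns_nth[OF that] pos[OF that] by linarith
    qed
    have "0 < ps ! 0" using ps(2) ns_nth[of 0] pos[of 0] by simp
    then obtain A' B' e' \<delta>' where AB': "A' < M" "B' \<le> q" and \<delta>': "- sum e' {1..m} \<le> \<delta>'"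
      and le: "\<And>l. l \<le> m \<Longrightarrow> pole_order A' B' e' \<delta>' l \<le> int (ps ! l)"
      and eq: "pole_order A' B' e' \<delta>' 0 = int (ps ! 0)"
      using semigroup_dominates_monomial[OF ps(1)] by blast
    have "pole_order A B e (- sum e {1..m}) 0 = pole_order A' B' e' \<delta>' 0"
      using eq ps(2) ns_nth[of 0] pos[of 0] by (simp add: po_def)
    note same = pole_order_0_inj[OF AB AB' this]
    have e_le: "e' l \<le> e l" if l: "l \<in> {1..m}" for l
    proof -
      have "pole_order A' B' e' \<delta>' l \<le> po l" using le[of l] ps_le[of l] l by auto
      then have "N * e' l \<le> N * e l" using l same by (simp add: po_def pole_order_def)
      then show ?thesis using N_pos by simp
    qed
    have "sum e' {1..m} = sum e {1..m}"
      using \<delta>' same sum_mono[of "{1..m}" e' e] e_le by force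
    then have "\<forall>l\<in>{1..m}. e' l = e l"
      using e_le by (intro sum_mono_inv[of e' "{1..m}" e, THEN ballI]) auto
    then have "pole_order A' B' e' \<delta>' l = po l" if "l \<le> m" for l
      using that same by (auto simp: po_def pole_order_def)
    then have "ps ! l = ns ! l" if "l \<le> m" for l
      using le[OF that] ps_le[OF that] ns_nth[OF that] that by fastforce
    then show ?thesis using len len_ps by (intro nth_equalityI) auto
  qed
  have "\<forall>k\<in>set ns. 0 < k" using ns_nth pos len by (auto simp: in_set_conv_nth less_Suc_eq_le)
  then show "ns \<in> ?L"
    unfolding minimal_generating_set_def nabla_def length_points
    using H min len by (auto intro!: exI[of _ 0])
qed

text \<open>
  The parameters correspond by \<open>k = M - A\<close>, \<open>i = q - B\<close> and \<open>j\<^sub>l = e\<^sub>l - 1\<close>. Positivity at \<open>P\<^sub>l\<close> is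
  equivalent to \<open>e\<^sub>l \<ge> 1\<close>, because \<open>0 \<le> B M + A < N\<close>.
\<close>

lemma explicit_tuples_eq:
  assumes q_eq: "q = d * PB"
  shows "explicit_tuples q PB n m =
    {ns. \<exists>A B e. A < M \<and> B \<le> q \<and> (\<forall>l\<le>m. 0 < pole_order A B e (- sum e {1..m}) l) \<and>
      ns = map (\<lambda>l. nat (pole_order A B e (- sum e {1..m}) l)) [0..<Suc m]}" (is "_ = ?R")
proof -
  have PB: "0 < PB" using q_eq q_ge_2 by (auto intro!: Nat.gr0I)
  have M_div: "(q ^ n + 1) div (q + 1) = M"
    unfolding M[symmetric] by (rule nonzero_mult_div_cancel_right) simp
  have N_M: "N = int M * (int q + 1)" by (simp add: N_def N_eq)
  define E where "E i k j = (int q ^ 2 - int m * int PB - int PB * (\<Sum>l=1..m. j l)) * N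
                    - i * int q * int M - k * int q ^ 3" for i k :: int and j :: "nat \<Rightarrow> int"
  have E: "E i k j = int PB * pole_order A B e (- sum e {1..m}) 0"
    if "int A = int M - k" "int B = int q - i" "\<And>l. l \<in> {1..m} \<Longrightarrow> e l = j l + 1" for i k j A B e
  proof -
    have "sum e {1..m} = (\<Sum>l=1..m. j l + 1)" using that(3) by (intro sum.cong) auto
    also have "\<dots> = (\<Sum>l=1..m. j l) + int m" by (simp add: sum.distrib)
    finally have s: "sum e {1..m} = (\<Sum>l=1..m. j l) + int m" .
    have qd: "int q = int d * int PB" by (simp add: q_eq)
    have "int PB * pole_order A B e (- sum e {1..m}) 0 =
      - N * (int PB * ((\<Sum>l=1..m. j l) + int m)) + (int q - i) * ((int d * int PB) * int M)
        + (int M - k) * ((int d * int PB) * int q ^ 2)"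
      unfolding pole_order_def s that(1,2) by (simp add: algebra_simps)
    also have "\<dots> = E i k j"
      unfolding qd[symmetric] E_def N_M by (simp add: algebra_simps power2_eq_square power3_eq_cube)
    finally show ?thesis ..
  qed
  have comp: "pole_order A B e (- sum e {1..m}) l = j l * N + i * int M + k"
    if "int A = int M - k" "int B = int q - i" "l \<in> {1..m}" "e l = j l + 1" for i k j A B e l
    using that(3) unfolding pole_order_def that(1,2,4) by (simp add: N_M algebra_simps)
  have expl: "explicit_tuples q PB n m = {ns. \<exists>i k j. 1 \<le> k \<and> k \<le> int M \<and> 0 \<le> i \<and> i \<le> int q \<and>
      (\<forall>l\<in>{1..m}. 0 \<le> j l) \<and> E i k j > 0 \<and>
      map int ns = (E i k j div int PB) # map (\<lambda>l. j l * N + i * int M + k) [1..<Suc m]}"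
    unfolding explicit_tuples_def Let_def M_div E_def N_def by (simp only:)
  have upt: "[0..<Suc m] = 0 # [1..<Suc m]" by (simp add: upt_conv_Cons del: upt_Suc)
  show ?thesis
    unfolding expl
  proof (intro equalityI subsetI)
    fix ns assume "ns \<in> {ns. \<exists>i k j. 1 \<le> k \<and> k \<le> int M \<and> 0 \<le> i \<and> i \<le> int q \<and>
      (\<forall>l\<in>{1..m}. 0 \<le> j l) \<and> E i k j > 0 \<and>
      map int ns = (E i k j div int PB) # map (\<lambda>l. j l * N + i * int M + k) [1..<Suc m]}"
    then obtain i k j where ijk: "1 \<le> k" "k \<le> int M" "0 \<le> i" "i \<le> int q" "\<forall>l\<in>{1..m}. 0 \<le> j l"
      "E i k j > 0" and ns: "map int ns = (E i k j div int PB) # map (\<lambda>l. j l * N + i * int M + k) [1..<Suc m]"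
      by (elim CollectE exE conjE) (rule that; assumption)
    define A where "A = nat (int M - k)"
    define B where "B = nat (int q - i)"
    define e where "e l = j l + 1" for l
    have AB: "int A = int M - k" "int B = int q - i" using ijk by (simp_all add: A_def B_def)
    define po where "po = pole_order A B e (- sum e {1..m})"
    have E0: "E i k j = int PB * po 0" unfolding po_def by (rule E[OF AB]) (simp add: e_def)
    then have po0: "0 < po 0" "E i k j div int PB = po 0"
      using ijk(6) PB by (simp_all add: zero_less_mult_iff)
    have pol: "po l = j l * N + i * int M + k" if "l \<in> {1..m}" for l
      unfolding po_def by (rule comp[OF AB that]) (simp add: e_def)
    have pos: "0 < po l" if "l \<le> m" for l
    proof (cases "l = 0")
      case False
      then have l: "l \<in> {1..m}" using that by auto
      then have "0 \<le> j l * N" "0 \<le> i * int M" using ijk N_pos by auto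
      then show ?thesis unfolding pol[OF l] using ijk(1) by linarith
    qed (use po0 in simp)
    have "map int ns = map po [0..<Suc m]"
      unfolding ns po0(2) upt by (auto simp: pol simp del: upt_Suc)
    then have "map nat (map int ns) = map nat (map po [0..<Suc m])" by (rule arg_cong)
    then have "ns = map (\<lambda>l. nat (po l)) [0..<Suc m]" by (simp add: o_def del: upt_Suc)
    moreover have "A < M" "B \<le> q" using AB ijk by linarith+
    ultimately show "ns \<in> ?R" using pos unfolding po_def by blast
  next
    fix ns assume "ns \<in> ?R"
    then obtain A B e where AB: "A < M" "B \<le> q"
      and pos: "\<And>l. l \<le> m \<Longrightarrow> 0 < pole_order A B e (- sum e {1..m}) l"
      and ns: "ns = map (\<lambda>l. nat (pole_order A B e (- sum e {1..m}) l)) [0..<Suc m]" by blast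
    define po where "po = pole_order A B e (- sum e {1..m})"
    define k where "k = int M - int A"
    define i where "i = int q - int B"
    define j where "j l = e l - 1" for l
    have AB': "int A = int M - k" "int B = int q - i" by (simp_all add: k_def i_def)
    have E0: "E i k j = int PB * po 0" unfolding po_def by (rule E[OF AB']) (simp add: j_def)
    have pol: "po l = j l * N + i * int M + k" if "l \<in> {1..m}" for l
      unfolding po_def by (rule comp[OF AB' that]) (simp add: j_def)
    have "0 < E i k j" "E i k j div int PB = po 0"
      using E0 pos[of 0] PB by (simp_all add: po_def)
    moreover have "0 \<le> j l" if l: "l \<in> {1..m}" for l
    proof -
      have "0 < N * e l - int B * int M - int A"
        using pos[of l] l by (simp add: pole_order_def)
      moreover have "0 \<le> int B * int M" "0 \<le> int A" by simp_all
      ultimately have "0 < N * e l" by linarith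
      then show ?thesis using N_pos by (simp add: zero_less_mult_iff j_def)
    qed
    moreover have "map int ns = map po [0..<Suc m]"
      unfolding ns using pos by (auto simp: po_def less_imp_le simp del: upt_Suc)
    then have "map int ns = po 0 # map (\<lambda>l. j l * N + i * int M + k) [1..<Suc m]"
      unfolding upt by (auto simp: pol simp del: upt_Suc)
    moreover have "1 \<le> k" "k \<le> int M" "0 \<le> i" "i \<le> int q" using AB by (auto simp: k_def i_def)
    ultimately show "ns \<in> {ns. \<exists>i k j. 1 \<le> k \<and> k \<le> int M \<and> 0 \<le> i \<and> i \<le> int q \<and>
      (\<forall>l\<in>{1..m}. 0 \<le> j l) \<and> E i k j > 0 \<and>
      map int ns = (E i k j div int PB) # map (\<lambda>l. j l * N + i * int M + k) [1..<Suc m]}"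
      by (intro CollectI exI[of _ i] exI[of _ k] exI[of _ j]) auto
  qed
qed

end

section \<open>The two families of curves\<close>

lemma odd_power_plus_one_dvd:
  fixes q n :: nat
  assumes "odd n"
  shows "(q + 1) dvd (q ^ n + 1)"
proof -
  have "int q + 1 dvd int q ^ (2 * k + 1) + 1" for k
  proof (induction k)
    case (Suc k)
    have "int q ^ (2 * Suc k + 1) + 1 = int q ^ 2 * (int q ^ (2 * k + 1) + 1) - (int q + 1) * (int q - 1)"
      by (simp add: algebra_simps power2_eq_square)
    then show ?case using Suc by (metis dvd_diff dvd_mult dvd_triv_left)
  qed simp
  moreover obtain k where "n = 2 * k + 1" using assms by (auto elim: oddE)
  ultimately have "int q + 1 dvd int q ^ n + 1" by metis
  then have "int (q + 1) dvd int (q ^ n + 1)" by (simp only: of_nat_add of_nat_power of_nat_1)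
  then show ?thesis by (simp only: of_nat_dvd_iff)
qed

lemma order_0_eq_1:
  fixes T :: "'f::field poly"
  assumes "coeff T 0 = 0" "coeff T 1 \<noteq> 0"
  shows "order 0 T = 1"
proof -
  obtain S where T: "T = pCons 0 S" using assms(1) by (cases T) auto
  have S: "coeff S 0 \<noteq> 0" using assms(2) unfolding T by simp
  then have "S \<noteq> 0" by auto
  have T': "T = [:- 0, 1:] * S" by (simp add: T)
  have "order 0 T = order 0 [:- 0, 1 :: 'f:] + order 0 S"
    unfolding T' by (rule order_mult) (use \<open>S \<noteq> 0\<close> in simp)
  also have "order 0 [:- 0, 1 :: 'f:] = 1" using order_power_n_n[of "0 :: 'f" 1] by simp
  also have "order 0 S = 0" using S by (intro order_0I) (simp add: poly_0_coeff_0)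
  finally show ?thesis by simp
qed

text \<open>
  The sum \<open>t(x)\<^sup>P - t(x)\<close> with \<open>P = p\<^sup>b\<close> telescopes to \<open>x\<^sup>q - x\<close>, which is therefore a polynomial in \<open>y\<close>.
\<close>

lemma curve_model_X:
  fixes K :: "'f::field set"
  assumes curve: "curve_X K x y z p a b n c" and q: "q = p ^ a" and Pinf: "common_poles K x y z = {Pinf}"
  shows "curve_model K x y z c (\<Sum>i<a div b. monom 1 (p ^ (i * b))) p a n q (q div p ^ b)
    ((q ^ n + 1) div (q + 1)) Pinf"
proof -
  define r where "r = a div b"
  define T :: "'f poly" where "T = (\<Sum>i<r. monom 1 (p ^ (i * b)))"
  have p: "prime p" and a: "1 \<le> a" and b: "1 \<le> b" "b dvd a" and n: "3 \<le> n" "odd n"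
    and card: "card K = q ^ (2 * n)" and c: "c \<in> K" "c ^ (q - 1) = - 1"
    and ff: "function_field K" and gen: "is_subfield hull (K \<union> {x, y, z}) = UNIV"
    and xy: "c * y ^ (q + 1) = (\<Sum>i<r. x ^ (p ^ (i * b)))"
    and yz: "z ^ ((q ^ n + 1) div (q + 1)) = y ^ (q ^ 2) - y"
    using curve unfolding curve_X_def Let_def q r_def by blast+
  have K: "is_subfield K" using ff by (simp add: function_field_def)
  note R = subfield_imp_subring[OF K]
  have a_rb: "a = r * b" using b by (simp add: r_def)
  then have r: "0 < r" using a by (auto intro!: Nat.gr0I)
  have p2: "2 \<le> p" by (rule prime_ge_2_nat[OF p])
  have char: "CHAR('f) = p"
    by (rule CHAR_of_subfield[OF K _ p, of "a * (2 * n)"]) (simp add: card q power_mult)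
  then have pc: "prime CHAR('f)" using p by simp
  have frob: "(u - w) ^ (p ^ k) = u ^ (p ^ k) - w ^ (p ^ k)" for u w :: 'f and k
    using frobenius_diff[OF pc] by (simp only: char)
  have poly_T: "poly T u = (\<Sum>i<r. u ^ (p ^ (i * b)))" for u
    by (simp add: T_def poly_sum poly_monom)
  have coeff_T: "coeff T k = (\<Sum>i<r. if p ^ (i * b) = k then 1 else 0)" for k
    by (simp add: T_def coeff_sum)
  define d where "d = p ^ ((r - 1) * b)"
  have exp_inj: "p ^ (i * b) = p ^ (j * b) \<longleftrightarrow> i = j" for i j
    using p2 b(1) by (auto simp: power_inject_exp)
  have coeff_d: "coeff T d = 1"
    using r unfolding coeff_T d_def by (simp add: exp_inj)
  have deg_le: "degree T \<le> d"
    unfolding T_def d_def using p2 r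
    by (intro degree_sum_le) (auto intro!: power_increasing order.trans[OF degree_monom_le])
  have deg: "degree T = d"
    using deg_le coeff_d le_degree[of T d] by simp
  have pos: "0 < p ^ (i * b)" for i using p2 by simp
  have "p ^ ((r - 1) * b) * p ^ b = p ^ a"
    using r by (simp add: a_rb algebra_simps flip: power_add)
  then have dq: "d * p ^ b = q" by (simp add: d_def q)
  then have d_div: "q div p ^ b = d" using p2 by auto
  have x_frob: "x ^ q - x = (c * y ^ (q + 1)) ^ (p ^ b) - c * y ^ (q + 1)"
  proof -
    have "(\<Sum>i<r. x ^ (p ^ (i * b))) ^ (p ^ b) = (\<Sum>i<r. (x ^ (p ^ (i * b))) ^ (p ^ b))"
      using freshmans_dream_sum'[OF pc, of "p ^ b" b] by (simp add: char)
    also have "\<dots> = (\<Sum>i<r. x ^ (p ^ (Suc i * b)))"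
      by (simp add: power_add mult.commute flip: power_mult)
    finally have "(c * y ^ (q + 1)) ^ (p ^ b) - c * y ^ (q + 1) =
      (\<Sum>i<r. x ^ (p ^ (Suc i * b)) - x ^ (p ^ (i * b)))"
      unfolding xy by (simp only: sum_subtractf)
    also have "\<dots> = x ^ (p ^ (r * b)) - x ^ (p ^ (0 * b))"
      by (rule sum_lessThan_telescope)
    finally show ?thesis by (simp add: q a_rb)
  qed
  show ?thesis
    unfolding r_def[symmetric] T_def[symmetric] d_div
  proof
    show "is_subfield K" "card K = q ^ (2 * n)" "prime p" "q = p ^ a" "1 \<le> a"
      "is_subfield hull (K \<union> {x, y, z}) = UNIV" "c \<in> K" "common_poles K x y z = {Pinf}"
      "z ^ ((q ^ n + 1) div (q + 1)) = y ^ (q ^ 2) - y" by fact+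
    show "1 \<le> n" using n by simp
    show "c \<noteq> 0"
    proof
      assume "c = 0"
      moreover have "2 \<le> q" using p2 a power_increasing[of 1 a p] by (simp add: q)
      ultimately have "c ^ (q - 1) = 0" by simp
      moreover have "(- 1 :: 'f) \<noteq> 0" by simp
      ultimately show False using c(2) by metis
    qed
    show "T \<in> polys_over K"
      unfolding T_def by (intro polys_over_sum[OF R] polys_over_monom[OF R] subring_1[OF R])
    show "lead_coeff T = 1" using deg coeff_d by simp
    show "degree T = d" by fact
    show "order 0 T = 1"
    proof (rule order_0_eq_1)
      show "coeff T 0 = 0" unfolding coeff_T using pos by (intro sum.neutral) auto
      have "(\<Sum>i<r. if p ^ (i * b) = 1 then 1 else 0) = (\<Sum>i<r. if i = 0 then 1 else (0::'f))"
        using p2 b(1) by (intro sum.cong) auto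
      then show "coeff T 1 \<noteq> 0" unfolding coeff_T using r by simp
    qed
    show "poly T (u - w) = poly T u - poly T w" for u w
      unfolding poly_T frob by (rule sum_subtractf)
    show "d dvd q" unfolding dq[symmetric] by simp
    show "c * y ^ (q + 1) = poly T x" unfolding poly_T by (rule xy)
    show "(q ^ n + 1) div (q + 1) * (q + 1) = q ^ n + 1"
      by (rule dvd_div_mult_self[OF odd_power_plus_one_dvd[OF n(2)]])
    let ?S = "is_subring hull (insert y K)"
    note S = subring_hull[of "insert y K"]
    have yc: "y \<in> ?S" "c \<in> ?S" using c(1) by (auto intro: hull_inc)
    have "x ^ q - x \<in> ?S"
      unfolding x_frob by (intro subring_diff[OF S] subring_power[OF S] subring_mult[OF S] yc)
    moreover have "x ^ (q ^ 2) - x = (x ^ q - x) ^ q + (x ^ q - x)"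
      using frob[of "x ^ q" x a] by (simp add: power2_eq_square power_mult q)
    ultimately show "x ^ (q ^ 2) - x \<in> ?S"
      by (simp only: subring_add[OF S] subring_power[OF S])
  qed
qed

text \<open>
  Here \<open>(x\<^sup>q + x)\<^sup>q - (x\<^sup>q + x)\<close> is the difference of \<open>x\<close> and its image under the \<open>q\<^sup>2\<close>-power map.
\<close>

lemma curve_model_Y:
  fixes K :: "'f::field set"
  assumes curve: "curve_Y K x y z p a n" and q: "q = p ^ a" and Pinf: "common_poles K x y z = {Pinf}"
  shows "curve_model K x y z 1 (monom 1 q + monom 1 1) p a n q q ((q ^ n + 1) div (q + 1)) Pinf"
proof -
  define T :: "'f poly" where "T = monom 1 q + monom 1 1"
  have p: "prime p" and a: "1 \<le> a" and n: "3 \<le> n" "odd n"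
    and card: "card K = q ^ (2 * n)"
    and ff: "function_field K" and gen: "is_subfield hull (K \<union> {x, y, z}) = UNIV"
    and xy: "y ^ (q + 1) = x ^ q + x"
    and yz: "z ^ ((q ^ n + 1) div (q + 1)) = y ^ (q ^ 2) - y"
    using curve unfolding curve_Y_def Let_def q by blast+
  have K: "is_subfield K" using ff by (simp add: function_field_def)
  note R = subfield_imp_subring[OF K]
  have p2: "2 \<le> p" by (rule prime_ge_2_nat[OF p])
  then have q2: "2 \<le> q" using a power_increasing[of 1 a p] by (simp add: q)
  have char: "CHAR('f) = p"
    by (rule CHAR_of_subfield[OF K _ p, of "a * (2 * n)"]) (simp add: card q power_mult)
  then have pc: "prime CHAR('f)" using p by simp
  have frob: "(u - w) ^ (p ^ k) = u ^ (p ^ k) - w ^ (p ^ k)" for u w :: 'f and k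
    using frobenius_diff[OF pc] by (simp only: char)
  have frob_add: "(u + w) ^ q = u ^ q + w ^ q" for u w :: 'f
    using freshmans_dream'[OF pc, of q a] by (simp add: char q)
  have poly_T: "poly T u = u ^ q + u" for u by (simp add: T_def poly_monom)
  have deg: "degree T = q"
    unfolding T_def using q2 by (subst degree_add_eq_left) (simp_all add: degree_monom_eq)
  show ?thesis
    unfolding T_def[symmetric]
  proof
    show "is_subfield K" "card K = q ^ (2 * n)" "prime p" "q = p ^ a" "1 \<le> a"
      "is_subfield hull (K \<union> {x, y, z}) = UNIV" "common_poles K x y z = {Pinf}"
      "z ^ ((q ^ n + 1) div (q + 1)) = y ^ (q ^ 2) - y" by fact+
    show "1 \<le> n" using n by simp
    show "1 \<in> K" by (rule subring_1[OF R])
    show "(1::'f) \<noteq> 0" by simp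
    show "T \<in> polys_over K"
      unfolding T_def by (intro polys_over_add[OF R] polys_over_monom[OF R] subring_1[OF R])
    show "lead_coeff T = 1" unfolding deg using q2 by (simp add: T_def)
    show "degree T = q" by fact
    show "order 0 T = 1" by (rule order_0_eq_1) (use q2 in \<open>simp_all add: T_def\<close>)
    show "poly T (u - w) = poly T u - poly T w" for u w
      unfolding poly_T using frob[of u w a] by (simp add: q)
    show "q dvd q" by simp
    show "1 * y ^ (q + 1) = poly T x" unfolding poly_T using xy by simp
    show "(q ^ n + 1) div (q + 1) * (q + 1) = q ^ n + 1"
      by (rule dvd_div_mult_self[OF odd_power_plus_one_dvd[OF n(2)]])
    let ?S = "is_subring hull (insert y K)"
    note S = subring_hull[of "insert y K"]
    have "y \<in> ?S" by (auto intro: hull_inc)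
    then have "(y ^ (q + 1)) ^ q - y ^ (q + 1) \<in> ?S"
      by (intro subring_diff[OF S] subring_power[OF S])
    moreover have "(y ^ (q + 1)) ^ q - y ^ (q + 1) = x ^ (q ^ 2) - x"
      unfolding xy frob_add by (simp add: power2_eq_square power_mult)
    ultimately show "x ^ (q ^ 2) - x \<in> ?S" by (simp only:)
  qed
qed

lemma (in curve_model) minimal_generating_set_eq_explicit:
  assumes P: "bij_betw P {1..d} (base_points K x y z)" and m: "1 \<le> m" "m \<le> d"
    and PB: "q = d * PB"
  shows "minimal_generating_set K (Pinf # map P [1..<Suc m]) = explicit_tuples q PB n m"
proof -
  have base: "P l \<in> base_points K x y z" if "l \<in> {1..m}" for l
    using P m that by (auto simp: bij_betw_def)
  then have "\<forall>l\<in>{1..m}. \<exists>u. u \<in> K \<and> has_value (P l) x u"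
    unfolding base_points_def by blast
  then obtain \<alpha> where \<alpha>: "\<forall>l\<in>{1..m}. \<alpha> l \<in> K \<and> has_value (P l) x (\<alpha> l)"
    using bchoice by metis
  interpret curve_points K x y z c T p a n q d M Pinf P \<alpha> m
  proof
    fix l assume l: "l \<in> {1..m}"
    show "place K (P l)" "\<alpha> l \<in> K" "val_ge (P l) (x - \<alpha> l) 1" "val_ge (P l) y 1"
      using base[OF l] bspec[OF \<alpha> l]
      by (simp_all add: base_points_def rational_place_def has_value_iff)
  next
    show "inj_on P {1..m}" using P m by (auto simp: bij_betw_def intro: inj_on_subset)
    show "1 \<le> m" by fact
  qed
  show ?thesis
    unfolding points_eq[symmetric] minimal_generating_set_points explicit_tuples_eq[OF PB] ..
qed

theorem theorem5p5:
  fixes K :: "'f::field set" and x y z c :: 'f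
    and p a b q n m :: nat
    and Pinf :: "'f \<Rightarrow> int" and P :: "nat \<Rightarrow> 'f \<Rightarrow> int"
  assumes curve: "curve_X K x y z p a b n c \<or> (curve_Y K x y z p a n \<and> b = 0)"
    and q: "q = p ^ a"
    and Pinf: "common_poles K x y z = {Pinf}"
    and P: "bij_betw P {1..q div p ^ b} (base_points K x y z)"
    and m: "1 \<le> m" "m \<le> q div p ^ b"
  shows "minimal_generating_set K (Pinf # map P [1..<Suc m]) = explicit_tuples q (p ^ b) n m"
  using curve
proof
  assume X: "curve_X K x y z p a b n c"
  interpret curve_model K x y z c "\<Sum>i<a div b. monom 1 (p ^ (i * b))" p a n q "q div p ^ b"
    "(q ^ n + 1) div (q + 1)" Pinf
    by (rule curve_model_X[OF X q Pinf])
  have "1 \<le> a" "b dvd a" using X by (simp_all add: curve_X_def)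
  then have "p ^ b dvd q" unfolding q by (intro le_imp_power_dvd dvd_imp_le) auto
  then show ?thesis by (intro minimal_generating_set_eq_explicit P m) simp
next
  assume Y: "curve_Y K x y z p a n \<and> b = 0"
  then interpret curve_model K x y z 1 "monom 1 q + monom 1 1" p a n q q
    "(q ^ n + 1) div (q + 1)" Pinf
    by (intro curve_model_Y q Pinf) auto
  show ?thesis using Y P m by (intro minimal_generating_set_eq_explicit) simp_all
qed

end
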